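(* Let $K$ be an abelian number field of conductor $n$, and put $G=\mathrm{Gal}(\mathbb{Q}^{(n)}/\mathbb{Q})$, $H=\mathrm{Gal}(\mathbb{Q}^{(n)}/K)$. Let $\pi:\mathbb{Q}[G]\to\mathbb{Q}[G/H]$ denote the $\mathbb{Q}$-linear map induced by the natural projection $G\to G/H$. Suppose $\mathcal{O}^{(n)}=\mathcal{A}_{\mathbb{Q}^{(n)}/\mathbb{Q}}\cdot\alpha$ for some $\alpha\in\mathcal{O}^{(n)}$. Then $\mathcal{A}_{K/\mathbb{Q}}=\pi(\mathcal{A}_{\mathbb{Q}^{(n)}/\mathbb{Q}})$ and $\mathcal{O}_K=\mathcal{A}_{K/\mathbb{Q}}\cdot\beta$, where $\beta=\hat{T}_{\mathbb{Q}^{(n)}/K}(\alpha)$.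
   Context: An abelian number field is a finite abelian extension of $\mathbb{Q}$; its conductor is the smallest positive integer $n$ with $K\subseteq\mathbb{Q}^{(n)}:=\mathbb{Q}(\zeta_n)$, where $\zeta_n$ is a primitive $n$-th root of unity. $\mathcal{O}_K$ is the ring of integers of $K$ and $\mathcal{O}^{(n)}=\mathbb{Z}[\zeta_n]$ that of $\mathbb{Q}^{(n)}$. $G/H$ is identified with $\mathrm{Gal}(K/\mathbb{Q})$. For a finite Galois extension $L/K$ of number fields with group $G=\mathrm{Gal}(L/K)$, the associated order is $\mathcal{A}_{L/K}:=\{\gamma\in K[G] : \gamma(\mathcal{O}_L)\subseteq\mathcal{O}_L\}$, where $K[G]$ acts on $L$ in the natural way; $\mathcal{A}_{L/K}\cdot\alpha=\{\gamma(\alpha):\gamma\in\mathcal{A}_{L/K}\}$. "Tamely ramified" means "not wildly ramified at any nonzero prime" (unramified is allowed). $T_{L/K}$ is the usual field trace. Definition of the adjusted trace map $\hat{T}_{\mathbb{Q}^{(n)}/K}$: if $\mathbb{Q}^{(n)}/K$ is tamely ramified, $\hat{T}_{\mathbb{Q}^{(n)}/K}=T_{\mathbb{Q}^{(n)}/K}$. Otherwise let $e=v_2(n)$ (in this case $e\geq 3$) and $m=n/2^e$; then $\mathcal{O}^{(n)}=\mathcal{O}^{(2^e)}\otimes_{\mathbb{Z}}\mathcal{O}^{(m)}$ (with $x\otimes y$ identified with the product $xy$) has $\mathbb{Z}$-basis $\{\zeta_{2^e}^{i}\otimes\zeta_m^{j} : 0\le i\le 2^{e-1}-1,\ 0\le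 j\le\phi(m)-1\}$, with $\phi$ Euler's function. Put $$\hat{T}_{\mathbb{Q}^{(n)}/K}(\zeta_{2^e}^{i}\otimes\zeta_m^{j})=\begin{cases}\frac12 T_{\mathbb{Q}^{(n)}/K}(\zeta_m^{j}) & i=0,\\ T_{\mathbb{Q}^{(n)}/K}(\zeta_{2^e}^{i}\otimes\zeta_m^{j}) & 1\le i\le 2^{e-1}-1,\end{cases}$$ and extend to a $\mathbb{Q}$-linear map $\mathbb{Q}^{(n)}\to K$. *)

theory Defs
  imports
    Complex_Main
    "HOL-Algebra.Algebra"
    "HOL-Algebra.Algebraic_Closure_Type"
    "HOL-Computational_Algebra.Computational_Algebra"
    "HOL-Number_Theory.Totient"
begin

text \<open>
  Number fields are realised as subfields of the complex numbers. The field of complex numbers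
  itself, as a structure in the sense of HOL-Algebra, is \<open>\<CC>\<close>; an intermediate ring is obtained
  by replacing its carrier.
\<close>

abbreviation complex_field :: "complex ring"  (\<open>\<CC>\<close>)
  where "\<CC> \<equiv> ring_of_type_algebra"


section \<open>Number fields and Galois groups\<close>

definition number_field :: "complex set \<Rightarrow> bool"
  where "number_field K \<longleftrightarrow> subfield K \<CC> \<and> ring.finite_dimension \<CC> \<rat> K"

text \<open>
  Automorphisms of \<open>L\<close> are extensional functions (undefined outside \<open>L\<close>), as in the library's
  \<^const>\<open>BijGroup\<close>, so that distinct functions are distinct automorphisms.
\<close>

definition Gal :: "complex set \<Rightarrow> complex set \<Rightarrow> (complex \<Rightarrow> complex) monoid"
  where "Gal L K = BijGroup L
    \<lparr>carrier := {\<sigma> \<in> Bij L. \<sigma> \<in> ring_hom (\<CC>\<lparr>carrier := L\<rparr>) (\<CC>\<lparr>carrier := L\<rparr>) \<and> (\<forall>x\<in>K. \<sigma> x = x)}\<rparr>"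

text \<open>A finite extension is Galois iff the fixed field of its automorphism group is the base field.\<close>

definition galois_extension :: "complex set \<Rightarrow> complex set \<Rightarrow> bool"
  where "galois_extension L K \<longleftrightarrow>
    subfield K \<CC> \<and> subfield L \<CC> \<and> K \<subseteq> L \<and> ring.finite_dimension \<CC> K L \<and>
    {x \<in> L. \<forall>\<sigma>\<in>carrier (Gal L K). \<sigma> x = x} = K"

definition abelian_number_field :: "complex set \<Rightarrow> bool"
  where "abelian_number_field K \<longleftrightarrow>
    number_field K \<and> galois_extension K \<rat> \<and> comm_group (Gal K \<rat>)"

definition zeta :: "nat \<Rightarrow> complex"
  where "zeta n = cis (2 * pi / real n)"

definition cyclotomic_field :: "nat \<Rightarrow> complex set"
  where "cyclotomic_field n = generate_field \<CC> (insert (zeta n) \<rat>)"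

definition is_conductor :: "complex set \<Rightarrow> nat \<Rightarrow> bool"
  where "is_conductor K n \<longleftrightarrow> n > 0 \<and> K \<subseteq> cyclotomic_field n \<and>
    (\<forall>m>0. K \<subseteq> cyclotomic_field m \<longrightarrow> n \<le> m)"

definition ring_of_integers :: "complex set \<Rightarrow> complex set"  (\<open>\<O>\<close>)
  where "\<O> K = {x \<in> K. algebraic_int x}"

abbreviation integer_ring :: "complex set \<Rightarrow> complex ring"
  where "integer_ring K \<equiv> \<CC>\<lparr>carrier := \<O> K\<rparr>"


section \<open>Group algebras and associated orders\<close>

text \<open>
  All groups are finite here, so that the underlying vector space of the group algebra \<open>F[G]\<close>
  consists of all functions from \<open>G\<close> to \<open>F\<close> (again extensional).
\<close>

definition group_algebra :: "complex set \<Rightarrow> ('g, 'm) monoid_scheme \<Rightarrow> ('g \<Rightarrow> complex) set"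
  where "group_algebra F G = carrier G \<rightarrow>\<^sub>E F"

definition act :: "(complex \<Rightarrow> complex, 'm) monoid_scheme \<Rightarrow> ((complex \<Rightarrow> complex) \<Rightarrow> complex)
    \<Rightarrow> complex \<Rightarrow> complex"
  where "act G \<gamma> x = (\<Sum>\<sigma>\<in>carrier G. \<gamma> \<sigma> * \<sigma> x)"

definition associated_order ::
    "complex set \<Rightarrow> complex set \<Rightarrow> ((complex \<Rightarrow> complex) \<Rightarrow> complex) set"
  where "associated_order L K =
    {\<gamma> \<in> group_algebra K (Gal L K). act (Gal L K) \<gamma> ` \<O> L \<subseteq> \<O> L}"

definition order_orbit :: "complex set \<Rightarrow> complex set \<Rightarrow> complex \<Rightarrow> complex set"
  where "order_orbit L K \<alpha> = (\<lambda>\<gamma>. act (Gal L K) \<gamma> \<alpha>) ` associated_order L K"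

text \<open>The linear map of group algebras induced by a map \<open>f\<close> from \<open>G\<close> to \<open>G'\<close>, i.e. the linear
  extension of \<open>f\<close>.\<close>

definition induced_map :: "('g, 'm) monoid_scheme \<Rightarrow> ('h, 'k) monoid_scheme \<Rightarrow> ('g \<Rightarrow> 'h)
    \<Rightarrow> ('g \<Rightarrow> complex) \<Rightarrow> 'h \<Rightarrow> complex"
  where "induced_map G G' f \<gamma> = (\<lambda>\<tau>\<in>carrier G'. \<Sum>\<sigma> | \<sigma> \<in> carrier G \<and> f \<sigma> = \<tau>. \<gamma> \<sigma>)"

definition quotient_map ::
    "('g, 'm) monoid_scheme \<Rightarrow> 'g set \<Rightarrow> ('g \<Rightarrow> complex) \<Rightarrow> 'g set \<Rightarrow> complex"
  where "quotient_map G H = induced_map G (G Mod H) (\<lambda>\<sigma>. H #>\<^bsub>G\<^esub> \<sigma>)"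

text \<open>
  For \<open>G = Gal(L/F)\<close> and \<open>H = Gal(L/K)\<close>, the identification of \<open>G/H\<close> with \<open>Gal(K/F)\<close> sends a coset
  to the common restriction to \<open>K\<close> of its members.
\<close>

definition coset_restriction ::
    "complex set \<Rightarrow> (complex \<Rightarrow> complex) set \<Rightarrow> complex \<Rightarrow> complex"
  where "coset_restriction K C = the_elem ((\<lambda>\<sigma>. restrict \<sigma> K) ` C)"

definition quotient_identification ::
    "complex set \<Rightarrow> complex set \<Rightarrow> complex set \<Rightarrow> ((complex \<Rightarrow> complex) set \<Rightarrow> complex)
      \<Rightarrow> (complex \<Rightarrow> complex) \<Rightarrow> complex"
  where "quotient_identification L K F =
    induced_map (Gal L F Mod carrier (Gal L K)) (Gal K F) (coset_restriction K)"


section \<open>Trace and ramification\<close>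

text \<open>The trace of the \<open>K\<close>-linear map \<open>y \<mapsto> x y\<close> on \<open>L\<close>; \<open>M\<close> is its matrix with respect to the
  \<open>K\<close>-basis \<open>bs\<close> of \<open>L\<close>.\<close>

definition field_trace :: "complex set \<Rightarrow> complex set \<Rightarrow> complex \<Rightarrow> complex"
  where "field_trace L K x = (THE t. \<exists>bs M.
    ring.independent \<CC> K bs \<and> ring.Span \<CC> K bs = L \<and>
    (\<forall>i<length bs. \<forall>j<length bs. M i j \<in> K) \<and>
    (\<forall>i<length bs. x * bs ! i = (\<Sum>j<length bs. M i j * bs ! j)) \<and>
    t = (\<Sum>i<length bs. M i i))"

text \<open>
  The largest \<open>k\<close> such that \<open>P^k\<close> contains (equivalently, as \<open>\<O> L\<close> is a Dedekind domain,
  divides) the extension to \<open>\<O> L\<close> of the prime \<open>P \<inter> \<O> K\<close> below \<open>P\<close>.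
\<close>

definition ramification_index :: "complex set \<Rightarrow> complex set \<Rightarrow> complex set \<Rightarrow> nat"
  where "ramification_index L K P = (GREATEST k::nat.
    Idl\<^bsub>integer_ring L\<^esub> (P \<inter> \<O> K) \<subseteq> P [^]\<^bsub>ideals_set (integer_ring L)\<^esub> k)"

text \<open>
  The residue characteristic of \<open>P\<close> is the prime number contained in \<open>P\<close>. Residue fields are
  finite, so inseparable residue field extensions do not occur.
\<close>

definition wildly_ramified_at :: "complex set \<Rightarrow> complex set \<Rightarrow> complex set \<Rightarrow> bool"
  where "wildly_ramified_at L K \<pp> \<longleftrightarrow>
    (\<exists>P l. primeideal P (integer_ring L) \<and> P \<inter> \<O> K = \<pp> \<and>
       Factorial_Ring.prime (l::nat) \<and> of_nat l \<in> P \<and> l dvd ramification_index L K P)"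

definition tamely_ramified :: "complex set \<Rightarrow> complex set \<Rightarrow> bool"
  where "tamely_ramified L K \<longleftrightarrow>
    (\<forall>\<pp>. primeideal \<pp> (integer_ring K) \<and> \<pp> \<noteq> {0} \<longrightarrow> \<not> wildly_ramified_at L K \<pp>)"

text \<open>
  In the wildly ramified case, \<open>c i j\<close> are the coordinates of \<open>x\<close> with respect to the
  \<open>\<rat>\<close>-basis \<open>b i j\<close> of the \<open>n\<close>-th cyclotomic field, and the trace is halved on
  the basis elements with \<open>i = 0\<close>.
\<close>

definition adjusted_trace :: "nat \<Rightarrow> complex set \<Rightarrow> complex \<Rightarrow> complex"
  where "adjusted_trace n K x =
    (let L = cyclotomic_field n; T = field_trace L K in
     if tamely_ramified L K then T x
     else
       let e = multiplicity 2 n; m = n div 2 ^ e;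
           b = (\<lambda>i j. zeta (2 ^ e) ^ i * zeta m ^ j);
           c = (SOME c :: nat \<Rightarrow> nat \<Rightarrow> rat.
                  x = (\<Sum>i<2 ^ (e - 1). \<Sum>j<totient m. of_rat (c i j) * b i j))
       in \<Sum>i<2 ^ (e - 1). \<Sum>j<totient m.
            of_rat (c i j) * (if i = 0 then T (zeta m ^ j) / 2 else T (b i j)))"

end

theory Submission
  imports Defs "HOL-Number_Theory.Number_Theory" "Jordan_Normal_Form.Char_Poly"
begin

text \<open>
  Write \<open>L\<close> for the conductor field and \<open>H\<close> for its Galois group over \<open>K\<close>. The adjusted trace is
  \<open>\<rat>\<close>-linear and commutes with the Galois group of \<open>L\<close>. Once it is known to map \<open>\<O> L\<close> onto \<open>\<O> K\<close>, it
  carries \<open>\<O> L = A \<alpha>\<close> to \<open>\<O> K = \<pi>(A) \<beta>\<close>; the inclusion of \<open>\<pi>(A)\<close> in the associated order of \<open>K\<close> is clear,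
  and equality holds because an element of the group algebra of \<open>K\<close> that kills \<open>\<beta>\<close> kills \<open>K\<close> and
  hence vanishes by the independence of automorphisms.

  Since \<open>n\<close> is the conductor, the subgroup \<open>N\<close> of \<open>H\<close> acting trivially on the roots of unity of
  squarefree order dividing \<open>n\<close> is trivial, or of order two and generated by some \<open>\<tau>\<close> that inverts the
  roots of unity of order \<open>2 ^ e\<close> up to sign, \<open>e \<ge> 3\<close>. The product \<open>w\<close> of the \<open>zeta l\<close> over the primes
  \<open>l\<close> dividing \<open>n\<close> has conjugates of sum \<open>\<plusminus>1\<close> on which \<open>H\<close> acts with stabilizers \<open>N\<close>; hence a sum of
  orbit representatives has trace \<open>\<plusminus>card N\<close> over \<open>K\<close>. If \<open>N\<close> is trivial this makes the trace
  surjective and the extension tame. Otherwise the valuation above 2 is even on the fixed field of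
  \<open>\<tau>\<close>, so the extension is wild, and splitting an integer \<open>y\<close> of \<open>K\<close> as \<open>E y + w + \<tau> w\<close> yields a
  preimage under the adjusted trace.
\<close>

text \<open>The adjusted trace is defined by cases on tameness, while the argument distinguishes
  whether \<open>N\<close> is trivial; so tameness has to be decided exactly in both cases.
  Valuations are read off from one explicit element \<open>\<theta>\<close> that generates each
  prime above \<open>p\<close> locally, once the ring of integers is known to be generated by
  \<open>\<zeta>\<close>. The prime 2 is exceptional because \<open>1 + b\<close> may be divisible
  by 4 for odd \<open>b\<close>, whereas for odd \<open>p\<close> and \<open>b\<close> congruent to
  1 modulo \<open>p\<close> the sum \<open>1 + b + ... + b ^ (p - 1)\<close> contains
  \<open>p\<close> only once. The halving is natural: an integer fixed by \<open>\<tau>\<close> has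
  trace over \<open>K\<close> in \<open>2 * \<O> K\<close>, since its conjugates pair up. This
  applies to the component with \<open>i = 0\<close>, so halving costs no integrality there, and it
  lets \<open>E y\<close> itself be attained. Degree counts are largely replaced by Fourier
  inversion over the powers of \<open>\<zeta>\<close>: it bounds denominators, identifies the two
  notions of trace, and shows that automorphisms of \<open>K\<close> extend to
  \<open>L\<close>.\<close>

text \<open>The relations say that \<open>v\<close> is an eigenvector of an integer matrix, so
  \<open>z\<close> is a root of its characteristic polynomial, which is monic with integer
  coefficients.\<close>

lemma algebraic_int_eigenvalue:
  fixes z :: complex and v :: "nat \<Rightarrow> complex" and M :: "nat \<Rightarrow> nat \<Rightarrow> int"
  assumes "\<And>i. i < N \<Longrightarrow> z * v i = (\<Sum>j<N. of_int (M i j) * v j)"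
    and "i0 < N" "v i0 \<noteq> 0"
  shows "algebraic_int z"
proof -
  define A where "A = mat N N (\<lambda>(i,j). M i j)"
  define B :: "complex mat" where "B = map_mat of_int A"
  have A: "A \<in> carrier_mat N N" and B: "B \<in> carrier_mat N N"
    by (auto simp: A_def B_def)
  have "eigenvector B (vec N v) z"
    unfolding eigenvector_def
  proof (intro conjI)
    show "vec N v \<in> carrier_vec (dim_row B)" using B by auto
    show "vec N v \<noteq> 0\<^sub>v (dim_row B)"
      using assms(2,3) B by (metis carrier_matD(1) index_vec index_zero_vec(1))
    show "B *\<^sub>v vec N v = z \<cdot>\<^sub>v vec N v"
      using B by (intro eq_vecI)
        (auto simp: assms(1) B_def A_def scalar_prod_def atLeast0LessThan)
  qed
  hence "eigenvalue B z" unfolding eigenvalue_def by blast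
  hence root: "poly (char_poly B) z = 0"
    using eigenvalue_root_char_poly[OF B] by simp
  have "char_poly B = map_poly of_int (char_poly A)"
    unfolding B_def using A by (simp add: of_int_hom.char_poly_hom)
  moreover have "lead_coeff (char_poly A) = 1"
    using degree_monic_char_poly[OF A] by simp
  ultimately show ?thesis
    unfolding algebraic_int_altdef_ipoly using root by metis
qed

lemma algebraic_int_power_reduce:
  assumes "algebraic_int (x::complex)"
  obtains d and c :: "nat \<Rightarrow> int" where "d > 0" "x ^ d = (\<Sum>i<d. of_int (c i) * x ^ i)"
proof -
  obtain p :: "int poly" where p: "poly (map_poly of_int p) x = 0" "lead_coeff p = 1"
    using assms unfolding algebraic_int_altdef_ipoly by blast
  define d where "d = degree p"
  have "0 = (\<Sum>i\<le>d. of_int (coeff p i) * x ^ i)"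
    using p(1) by (simp add: poly_altdef d_def)
  also have "\<dots> = (\<Sum>i<d. of_int (coeff p i) * x ^ i) + x ^ d"
    using p(2) by (simp add: lessThan_Suc_atMost[symmetric] d_def)
  finally have eq: "x ^ d = (\<Sum>i<d. of_int (- coeff p i) * x ^ i)"
    by (simp add: sum_negf eq_neg_iff_add_eq_0 add.commute)
  have "d > 0"
  proof (rule ccontr)
    assume "\<not> d > 0"
    with eq show False by simp
  qed
  then show thesis using that[of d "\<lambda>i. - coeff p i"] eq by simp
qed

text \<open>The finitely many monomials \<open>x ^ i * y ^ j\<close> span a module stable under
  multiplication by \<open>x\<close> and by \<open>y\<close>; sum and product of the two
  multiplication matrices handle \<open>x + y\<close> and \<open>x * y\<close>.\<close>

lemma algebraic_int_plus_times:
  assumes "algebraic_int (x::complex)" "algebraic_int y"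
  shows "algebraic_int (x + y)" "algebraic_int (x * y)"
proof -
  obtain d c where d: "d > 0" and c: "x ^ d = (\<Sum>i<d. of_int (c i) * x ^ i)"
    using algebraic_int_power_reduce[OF assms(1)] by metis
  obtain d' c' where d': "d' > 0" and c': "y ^ d' = (\<Sum>i<d'. of_int (c' i) * y ^ i)"
    using algebraic_int_power_reduce[OF assms(2)] by metis
  define N where "N = d * d'"
  \<comment> \<open>The monomials are listed by \<open>k = i * d' + j\<close>, so that
    \<open>div\<close> and \<open>mod\<close> recover the exponents.\<close>
  define v where "v k = x ^ (k div d') * y ^ (k mod d')" for k
  \<comment> \<open>\<open>A\<close> and \<open>B\<close> are companion matrices: every row shifts
    the exponent, except the last one, which holds the monic relation.\<close>
  define A where "A i j = (if Suc i < d then if j = Suc i then 1 else 0 else c j)" for i j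
  define B where "B i j = (if Suc i < d' then if j = Suc i then 1 else 0 else c' j)" for i j
  have X: "x * x ^ i = (\<Sum>j<d. of_int (A i j) * x ^ j)" if "i < d" for i
  proof (cases "Suc i < d")
    case False
    hence "d = Suc i" using that by simp
    hence "x * x ^ i = x ^ d" by simp
    with False c show ?thesis by (simp add: A_def)
  qed (simp add: A_def if_distrib[of of_int] if_distrib[of "\<lambda>t. t * _"] cong: if_cong)
  have Y: "y * y ^ i = (\<Sum>j<d'. of_int (B i j) * y ^ j)" if "i < d'" for i
  proof (cases "Suc i < d'")
    case False
    hence "d' = Suc i" using that by simp
    hence "y * y ^ i = y ^ d'" by simp
    with False c' show ?thesis by (simp add: B_def)
  qed (simp add: B_def if_distrib[of of_int] if_distrib[of "\<lambda>t. t * _"] cong: if_cong)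
  have sum_split: "(\<Sum>k<N. g k) = (\<Sum>i<d. \<Sum>j<d'. g (i * d' + j))" for g :: "nat \<Rightarrow> complex"
  proof -
    have "(\<Sum>k<N. g k) = (\<Sum>i<d. sum g {i * d'..<i * d' + d'})"
      unfolding N_def by (rule sum.nat_group[symmetric])
    also have "\<dots> = (\<Sum>i<d. \<Sum>j<d'. g (i * d' + j))"
    proof (rule sum.cong[OF refl])
      fix i
      show "sum g {i * d'..<i * d' + d'} = (\<Sum>j<d'. g (i * d' + j))"
        using sum.shift_bounds_nat_ivl[of g 0 "i * d'" d']
        by (simp add: lessThan_atLeast0 add.commute)
    qed
    finally show ?thesis .
  qed
  have v0: "0 < N" "v 0 \<noteq> 0" using d d' by (auto simp: N_def v_def)
  have bounds: "k div d' < d" "k mod d' < d'" if "k < N" for k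
    using that d d' by (auto simp: N_def less_mult_imp_div_less)
  have dm: "(i * d' + j) div d' = i" "(i * d' + j) mod d' = j" if "j < d'" for i j
    using that by auto
  have xv: "x * v k = (\<Sum>l<N. of_int (A (k div d') (l div d') * of_bool (l mod d' = k mod d')) * v l)"
    if "k < N" for k
  proof -
    have "(\<Sum>l<N. of_int (A (k div d') (l div d') * of_bool (l mod d' = k mod d')) * v l)
        = (\<Sum>i<d. \<Sum>j<d'. of_int (A (k div d') i) * x ^ i * (if j = k mod d' then y ^ j else 0))"
      unfolding sum_split v_def by (intro sum.cong refl) (auto simp: dm)
    also have "\<dots> = (\<Sum>i<d. of_int (A (k div d') i) * x ^ i * y ^ (k mod d'))"
      using bounds(2)[OF that] by (simp add: sum_distrib_left[symmetric])
    also have "\<dots> = x * v k"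
      unfolding sum_distrib_right[symmetric] X[OF bounds(1)[OF that], symmetric] by (simp add: v_def)
    finally show ?thesis by simp
  qed
  have yv: "y * v k = (\<Sum>l<N. of_int (B (k mod d') (l mod d') * of_bool (l div d' = k div d')) * v l)"
    if "k < N" for k
  proof -
    have "(\<Sum>l<N. of_int (B (k mod d') (l mod d') * of_bool (l div d' = k div d')) * v l)
        = (\<Sum>i<d. if i = k div d' then x ^ i * (\<Sum>j<d'. of_int (B (k mod d') j) * y ^ j) else 0)"
      unfolding sum_split v_def by (intro sum.cong refl) (auto simp: dm sum_distrib_left mult_ac)
    also have "\<dots> = y * v k"
      using bounds(1)[OF that] by (simp add: Y[OF bounds(2)[OF that], symmetric] v_def)
    finally show ?thesis by simp
  qed
  define MX where "MX k l = A (k div d') (l div d') * of_bool (l mod d' = k mod d')" for k l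
  define MY where "MY k l = B (k mod d') (l mod d') * of_bool (l div d' = k div d')" for k l
  have xv': "x * v k = (\<Sum>l<N. of_int (MX k l) * v l)" if "k < N" for k
    using xv[OF that] unfolding MX_def .
  have yv': "y * v k = (\<Sum>l<N. of_int (MY k l) * v l)" if "k < N" for k
    using yv[OF that] unfolding MY_def .
  show "algebraic_int (x + y)"
  proof (rule algebraic_int_eigenvalue[where v = v and N = N and M = "\<lambda>k l. MX k l + MY k l", OF _ v0])
    fix k assume "k < N"
    then show "(x + y) * v k = (\<Sum>l<N. of_int (MX k l + MY k l) * v l)"
      by (simp add: distrib_right xv' yv' sum.distrib)
  qed
  show "algebraic_int (x * y)"
  proof (rule algebraic_int_eigenvalue[where v = v and N = N and M = "\<lambda>k l. \<Sum>m<N. MY k m * MX m l", OF _ v0])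
    fix k assume k: "k < N"
    have "(x * y) * v k = (\<Sum>m<N. of_int (MY k m) * (x * v m))"
      by (simp add: yv'[OF k] mult.assoc sum_distrib_left mult.left_commute)
    also have "\<dots> = (\<Sum>m<N. \<Sum>l<N. of_int (MY k m) * (of_int (MX m l) * v l))"
      by (intro sum.cong refl) (simp add: xv' sum_distrib_left)
    also have "\<dots> = (\<Sum>l<N. \<Sum>m<N. of_int (MY k m) * (of_int (MX m l) * v l))"
      by (rule sum.swap)
    finally show "(x * y) * v k = (\<Sum>l<N. of_int (\<Sum>m<N. MY k m * MX m l) * v l)"
      by (simp add: sum_distrib_right mult.assoc)
  qed
qed

hide_const (open) Divisibility.prime

section \<open>Subfields of the complex numbers\<close>

lemma complex_field_simps [simp]:
  "carrier \<CC> = UNIV" "x \<otimes>\<^bsub>\<CC>\<^esub> y = x * y" "x \<oplus>\<^bsub>\<CC>\<^esub> y = x + y" "\<one>\<^bsub>\<CC>\<^esub> = 1" "\<zero>\<^bsub>\<CC>\<^esub> = 0"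
  by (simp_all add: ring_of_type_algebra_def)

lemma field_complex: "field \<CC>"
  by (rule field_from_type_algebra)

lemma a_inv_complex [simp]: "\<ominus>\<^bsub>\<CC>\<^esub> x = - x"
proof -
  interpret field \<CC> by (rule field_complex)
  show ?thesis by (rule minus_equality) auto
qed

lemma m_inv_complex [simp]: "x \<noteq> 0 \<Longrightarrow> inv\<^bsub>\<CC>\<^esub> x = inverse x"
proof -
  interpret field \<CC> by (rule field_complex)
  assume "x \<noteq> 0"
  thus ?thesis by (intro comm_inv_char) auto
qed

locale complex_subfield =
  fixes F :: "complex set"
  assumes subfield: "subfield F \<CC>"
begin

lemma zero [simp, intro]: "0 \<in> F" and one [simp, intro]: "1 \<in> F"
  and add [intro]: "x \<in> F \<Longrightarrow> y \<in> F \<Longrightarrow> x + y \<in> F"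
  and mult [intro]: "x \<in> F \<Longrightarrow> y \<in> F \<Longrightarrow> x * y \<in> F"
  and uminus [intro]: "x \<in> F \<Longrightarrow> - x \<in> F"
  using subringE[OF subfieldE(1)[OF subfield]] by auto

lemma inverse [intro]: assumes "x \<in> F" shows "inverse x \<in> F"
proof (cases "x = 0")
  case False
  interpret field \<CC> by (rule field_complex)
  from subfield_m_inv(1)[OF subfield, of x] assms False show ?thesis by auto
qed auto

lemma diff [intro]: "x \<in> F \<Longrightarrow> y \<in> F \<Longrightarrow> x - y \<in> F"
  using add[OF _ uminus] by fastforce

lemma divide [intro]: "x \<in> F \<Longrightarrow> y \<in> F \<Longrightarrow> x / y \<in> F"
  using mult[OF _ inverse] by (simp add: divide_inverse)

lemma power [intro]: "x \<in> F \<Longrightarrow> x ^ k \<in> F"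
  by (induction k) auto

lemma sum [intro]: "(\<And>i. i \<in> I \<Longrightarrow> g i \<in> F) \<Longrightarrow> sum g I \<in> F"
  by (induction I rule: infinite_finite_induct) auto

lemma prod [intro]: "(\<And>i. i \<in> I \<Longrightarrow> g i \<in> F) \<Longrightarrow> prod g I \<in> F"
  by (induction I rule: infinite_finite_induct) auto

lemma of_nat [simp, intro]: "of_nat k \<in> F"
  by (induction k) auto

lemma of_int [simp, intro]: "of_int k \<in> F"
  by (cases k) (auto simp del: of_nat_Suc)

lemma numeral [simp, intro]: "numeral k \<in> F"
  using of_nat[of "numeral k"] by simp

lemma Rats_subset: "\<rat> \<subseteq> F"
  by (auto elim!: Rats_cases' )

lemma of_rat [simp, intro]: "of_rat q \<in> F"
  using Rats_subset by auto

end

lemma complex_subfieldI: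
  assumes "1 \<in> F" "\<And>x y. x \<in> F \<Longrightarrow> y \<in> F \<Longrightarrow> x + y \<in> F"
    "\<And>x y. x \<in> F \<Longrightarrow> y \<in> F \<Longrightarrow> x * y \<in> F"
    "\<And>x. x \<in> F \<Longrightarrow> - x \<in> F" "\<And>x. x \<in> F \<Longrightarrow> inverse x \<in> F"
  shows "complex_subfield F"
proof (rule complex_subfield.intro)
  interpret field \<CC> by (rule field_complex)
  have "0 \<in> F" using assms(1,2,4) by (metis add.right_inverse)
  have "subcring F \<CC>"
    by (rule subcringI', rule subringI) (use assms in auto)
  thus "subfield F \<CC>"
    by (rule subfieldI'[OF subcring.axioms(1)]) (use assms in auto)
qed

lemma complex_subfield_Rats: "complex_subfield \<rat>"
  by (rule complex_subfieldI) auto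


section \<open>Polynomials over a subfield\<close>

text \<open>Subfields are sets, so \<open>F[X]\<close> is carved out of the complex polynomials;
  \<open>adjoin F z\<close> is then the ring \<open>F[z]\<close>, a field once \<open>z\<close> is
  algebraic over \<open>F\<close>.\<close>

definition polys_over :: "complex set \<Rightarrow> complex poly set"
  where "polys_over F = {p. \<forall>i. coeff p i \<in> F}"

definition adjoin :: "complex set \<Rightarrow> complex \<Rightarrow> complex set"
  where "adjoin F z = {poly p z |p. p \<in> polys_over F}"

context complex_subfield
begin

lemma polys_over_simps [simp, intro]: "0 \<in> polys_over F" "1 \<in> polys_over F"
  by (auto simp: polys_over_def coeff_1)

lemma coeff_polys_over [intro]: "p \<in> polys_over F \<Longrightarrow> coeff p i \<in> F"
  by (simp add: polys_over_def)

lemma pCons_polys_over [simp]: "pCons c p \<in> polys_over F \<longleftrightarrow> c \<in> F \<and> p \<in> polys_over F"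
  by (auto simp: polys_over_def coeff_pCons split: nat.splits)

lemma monom_polys_over [simp, intro]: "c \<in> F \<Longrightarrow> monom c k \<in> polys_over F"
  by (auto simp: polys_over_def)

lemma polys_over_add [intro]: "p \<in> polys_over F \<Longrightarrow> q \<in> polys_over F \<Longrightarrow> p + q \<in> polys_over F"
  and polys_over_diff [intro]: "p \<in> polys_over F \<Longrightarrow> q \<in> polys_over F \<Longrightarrow> p - q \<in> polys_over F"
  and polys_over_uminus [intro]: "p \<in> polys_over F \<Longrightarrow> - p \<in> polys_over F"
  and polys_over_smult [intro]: "c \<in> F \<Longrightarrow> p \<in> polys_over F \<Longrightarrow> smult c p \<in> polys_over F"
  and polys_over_mult [intro]: "p \<in> polys_over F \<Longrightarrow> q \<in> polys_over F \<Longrightarrow> p * q \<in> polys_over F"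
  by (simp_all add: polys_over_def coeff_mult add diff uminus mult sum)

text \<open>Horner's scheme: if \<open>p = a * q + r\<close>, then \<open>pCons c r\<close> has
  degree at most that of \<open>q\<close>, and subtracting one multiple of \<open>q\<close>
  completes the division without leaving \<open>F\<close>.\<close>

lemma polys_over_division:
  assumes "p \<in> polys_over F" "q \<in> polys_over F" "q \<noteq> 0"
  obtains a r where "a \<in> polys_over F" "r \<in> polys_over F" "p = a * q + r" "r = 0 \<or> degree r < degree q"
proof -
  have "\<exists>a r. a \<in> polys_over F \<and> r \<in> polys_over F \<and> p = a * q + r \<and> (r = 0 \<or> degree r < degree q)"
    using assms(1)
  proof (induction p)
    case 0
    show ?case by (rule exI[of _ 0], rule exI[of _ 0]) auto
  next
    case (pCons c p)
    then obtain a r where ar: "a \<in> polys_over F" "r \<in> polys_over F" "p = a * q + r"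
      "r = 0 \<or> degree r < degree q" by auto
    define r0 where "r0 = pCons c r"
    define k where "k = coeff r0 (degree q) / lead_coeff q"
    define r' where "r' = r0 - smult k q"
    have r0: "r0 \<in> polys_over F" using pCons ar by (auto simp: r0_def)
    have k: "k \<in> F" using r0 assms by (auto simp: k_def)
    have r': "r' \<in> polys_over F" using r0 k assms by (auto simp: r'_def)
    have deg: "degree r0 \<le> degree q"
      using ar(4) by (auto simp: r0_def degree_pCons_eq_if)
    have "degree r' \<le> degree q" unfolding r'_def
      using deg by (metis degree_diff_le degree_smult_le order.trans)
    moreover have "coeff r' (degree q) = 0"
      using assms(3) by (simp add: r'_def k_def)
    ultimately have "r' = 0 \<or> degree r' < degree q"
      by (metis leading_coeff_0_iff le_neq_implies_less)
    moreover have "pCons c p = (pCons 0 a + [:k:]) * q + r'"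
      by (simp add: r'_def r0_def ar(3) algebra_simps)
    moreover have "pCons 0 a + [:k:] \<in> polys_over F" using ar k by (intro polys_over_add) auto
    ultimately show ?case using r' by blast
  qed
  thus thesis using that by blast
qed

lemma minimal_polynomial:
  assumes "p0 \<in> polys_over F" "p0 \<noteq> 0" "poly p0 z = 0"
  obtains f where "f \<in> polys_over F" "lead_coeff f = 1" "poly f z = 0"
    "\<And>p. p \<in> polys_over F \<Longrightarrow> poly p z = 0 \<Longrightarrow> f dvd p"
    "\<And>p. p \<in> polys_over F \<Longrightarrow> p \<noteq> 0 \<Longrightarrow> degree p < degree f \<Longrightarrow> poly p z \<noteq> 0"
proof -
  define A where "A = (\<lambda>p. p \<in> polys_over F \<and> p \<noteq> 0 \<and> poly p z = 0)"
  obtain g where g: "A g" and min: "\<And>p. A p \<Longrightarrow> degree g \<le> degree p"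
    using assms ex_has_least_nat[of A p0 degree] by (auto simp: A_def)
  define f where "f = smult (inverse (lead_coeff g)) g"
  have f: "f \<in> polys_over F" "lead_coeff f = 1" "poly f z = 0" "degree f = degree g" "f \<noteq> 0"
    using g by (auto simp: f_def A_def)
  have "f dvd p" if p: "p \<in> polys_over F" "poly p z = 0" for p
  proof -
    obtain a r where ar: "a \<in> polys_over F" "r \<in> polys_over F" "p = a * f + r" "r = 0 \<or> degree r < degree f"
      using polys_over_division[OF p(1) f(1) f(5)] by blast
    have "poly r z = 0" using p(2) ar(3) f(3) by simp
    hence "A r" if "r \<noteq> 0" using that ar(2) by (simp add: A_def)
    hence "r = 0" using min[of r] ar(4) f(4) by fastforce
    thus ?thesis using ar(3) by simp
  qed
  moreover have "poly p z \<noteq> 0" if "p \<in> polys_over F" "p \<noteq> 0" "degree p < degree f" for p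
    using min[of p] that f(4) by (auto simp: A_def)
  ultimately show thesis using that f(1-3) by blast
qed

lemma adjoin_reduce:
  assumes "f \<in> polys_over F" "f \<noteq> 0" "poly f z = 0" "x \<in> adjoin F z"
  obtains p where "p \<in> polys_over F" "x = poly p z" "p = 0 \<or> degree p < degree f"
proof -
  obtain p where p: "p \<in> polys_over F" "x = poly p z" using assms(4) by (auto simp: adjoin_def)
  obtain a r where "a \<in> polys_over F" "r \<in> polys_over F" "p = a * f + r" "r = 0 \<or> degree r < degree f"
    using polys_over_division[OF p(1) assms(1,2)] by blast
  thus thesis using that[of r] p assms(3) by simp
qed

lemma adjoin_incl [intro]: "x \<in> F \<Longrightarrow> x \<in> adjoin F z"
  unfolding adjoin_def by (rule CollectI, rule exI[of _ "[:x:]"]) auto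

lemma adjoin_gen [simp, intro]: "z \<in> adjoin F z"
  unfolding adjoin_def by (rule CollectI, rule exI[of _ "[:0,1:]"]) auto

text \<open>Inverses come from a Bezout identity in \<open>F[X]\<close> between a polynomial
  representing \<open>x\<close> and the minimal polynomial of \<open>z\<close>.\<close>

lemma complex_subfield_adjoin:
  assumes "p0 \<in> polys_over F" "p0 \<noteq> 0" "poly p0 z = 0"
  shows "complex_subfield (adjoin F z)"
proof (rule complex_subfieldI)
  show "1 \<in> adjoin F z" by auto
  show "x + y \<in> adjoin F z" "x * y \<in> adjoin F z" if "x \<in> adjoin F z" "y \<in> adjoin F z" for x y
    using that unfolding adjoin_def by (auto intro: poly_add[symmetric] poly_mult[symmetric])
  show "- x \<in> adjoin F z" if "x \<in> adjoin F z" for x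
    using that unfolding adjoin_def by (auto intro: poly_minus[symmetric])
next
  fix x assume "x \<in> adjoin F z"
  then obtain p where p: "p \<in> polys_over F" "x = poly p z" by (auto simp: adjoin_def)
  show "inverse x \<in> adjoin F z"
  proof (cases "x = 0")
    case False
    obtain f where f: "f \<in> polys_over F" "lead_coeff f = 1" "poly f z = 0"
      and fmin: "\<And>p. p \<in> polys_over F \<Longrightarrow> p \<noteq> 0 \<Longrightarrow> degree p < degree f \<Longrightarrow> poly p z \<noteq> 0"
      by (rule minimal_polynomial[OF assms]) (rule that)
    \<comment> \<open>A nonzero element \<open>h\<close> of least degree in the ideal generated by
      \<open>p\<close> and \<open>f\<close> divides both of them.\<close>
    define A where "A = (\<lambda>h. h \<noteq> 0 \<and> (\<exists>a b. a \<in> polys_over F \<and> b \<in> polys_over F \<and> h = a * p + b * f))"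
    have "f = 0 * p + 1 * f" by simp
    hence "A f" using f(2) unfolding A_def by (metis leading_coeff_0_iff polys_over_simps zero_neq_one)
    then obtain h where h: "A h" and min: "\<And>q. A q \<Longrightarrow> degree h \<le> degree q"
      using ex_has_least_nat[of A f degree] by auto
    obtain a b where ab: "a \<in> polys_over F" "b \<in> polys_over F" "h = a * p + b * f" "h \<noteq> 0"
      using h by (auto simp: A_def)
    have hF: "h \<in> polys_over F" using ab p f by auto
    have div: "\<exists>u. u \<in> polys_over F \<and> q = u * h"
      if q: "q = c * p + d * f" "c \<in> polys_over F" "d \<in> polys_over F" for q c d
    proof -
      have "q \<in> polys_over F" using q p f by auto
      then obtain u r where ur: "u \<in> polys_over F" "r \<in> polys_over F" "q = u * h + r" "r = 0 \<or> degree r < degree h"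
        using polys_over_division[OF _ hF ab(4)] by blast
      have "r = (c - u * a) * p + (d - u * b) * f"
        using ur(3) q(1) ab(3) by (simp add: algebra_simps)
      moreover have "c - u * a \<in> polys_over F" "d - u * b \<in> polys_over F" using q ur ab by auto
      ultimately have "r \<noteq> 0 \<Longrightarrow> A r" unfolding A_def by blast
      hence "r = 0" using min[of r] ur(4) by fastforce
      thus ?thesis using ur by auto
    qed
    obtain k where k: "k \<in> polys_over F" "p = k * h" using div[of p 1 0] by auto
    obtain l where l: "l \<in> polys_over F" "f = l * h" using div[of f 0 1] by auto
    have hz: "poly h z = poly a z * x" using ab(3) f(3) p(2) by simp
    have "poly h z \<noteq> 0" using False k(2) p(2) by auto
    \<comment> \<open>\<open>h\<close> does not vanish at \<open>z\<close>, so the cofactor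
      \<open>l\<close> of \<open>f\<close> does; minimality of \<open>f\<close> then leaves degree 0
      for \<open>h\<close>.\<close>
    hence "poly l z = 0" using f(3) l(2) by simp
    moreover have "l \<noteq> 0" using f(2) l(2) by auto
    ultimately have "\<not> degree l < degree f" using fmin[OF l(1)] by auto
    hence "degree h = 0" using l(2) \<open>l \<noteq> 0\<close> ab(4) by (simp add: degree_mult_eq)
    then obtain c where c: "h = [:c:]" by (auto elim: degree_eq_zeroE)
    have "inverse x = poly (smult (inverse c) a) z"
      using hz False c ab(4) by (simp add: field_simps)
    moreover have "smult (inverse c) a \<in> polys_over F" using ab(1) hF c by auto
    ultimately show ?thesis unfolding adjoin_def by blast
  qed (use adjoin_incl[of 0] in auto)
qed

end

section \<open>Roots of unity\<close>

lemma zeta_power: "zeta n ^ k = cis (2 * pi * real k / real n)"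
  unfolding zeta_def DeMoivre by (simp add: mult_ac)

lemma zeta_power_n [simp]: "n > 0 \<Longrightarrow> zeta n ^ n = 1"
  by (simp add: zeta_power)

lemma zeta_nonzero [simp]: "zeta n \<noteq> 0"
  by (simp add: zeta_def)

lemma zeta_1 [simp]: "zeta 1 = 1" "zeta (Suc 0) = 1"
  by (simp_all add: zeta_def)

lemma zeta_power_mod: "n > 0 \<Longrightarrow> zeta n ^ (k mod n) = zeta n ^ k"
proof -
  assume "n > 0"
  have "zeta n ^ k = zeta n ^ (n * (k div n) + k mod n)" by simp
  also have "\<dots> = zeta n ^ (k mod n)" using \<open>n > 0\<close> by (simp only: power_add power_mult) simp
  finally show ?thesis ..
qed

lemma inj_zeta_power: "n > 0 \<Longrightarrow> inj_on (\<lambda>k. zeta n ^ k) {..<n}"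
  using bij_betw_roots_unity[of n] by (simp add: zeta_power bij_betw_def)

lemma zeta_power_eq_iff:
  assumes "n > 0"
  shows "zeta n ^ j = zeta n ^ k \<longleftrightarrow> [j = k] (mod n)"
proof
  assume "zeta n ^ j = zeta n ^ k"
  hence "zeta n ^ (j mod n) = zeta n ^ (k mod n)" using assms by (simp add: zeta_power_mod)
  thus "[j = k] (mod n)"
    using inj_onD[OF inj_zeta_power[OF assms]] assms by (auto simp: cong_def)
next
  assume "[j = k] (mod n)"
  thus "zeta n ^ j = zeta n ^ k" by (metis assms cong_def zeta_power_mod)
qed

lemma zeta_power_eq_1_iff: "n > 0 \<Longrightarrow> zeta n ^ k = 1 \<longleftrightarrow> n dvd k"
  using zeta_power_eq_iff[of n k 0] by (simp add: cong_0_iff)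

lemma zeta_mult_power: "d > 0 \<Longrightarrow> zeta (m * d) ^ d = zeta m"
  unfolding zeta_power by (simp add: zeta_def field_simps)

lemma root_of_unity_iff: "n > 0 \<Longrightarrow> z ^ n = 1 \<longleftrightarrow> (\<exists>k<n. z = zeta n ^ k)"
  using bij_betw_roots_unity[of n] by (auto simp: zeta_power bij_betw_def image_def)

lemma algebraic_int_power: "algebraic_int (x::complex) \<Longrightarrow> algebraic_int (x ^ k)"
  by (induction k) (auto intro: algebraic_int_plus_times)

lemma algebraic_int_sum: "(\<And>i. i \<in> I \<Longrightarrow> algebraic_int (g i :: complex)) \<Longrightarrow> algebraic_int (sum g I)"
  by (induction I rule: infinite_finite_induct) (auto intro: algebraic_int_plus_times)

lemma algebraic_int_prod: "(\<And>i. i \<in> I \<Longrightarrow> algebraic_int (g i :: complex)) \<Longrightarrow> algebraic_int (prod g I)"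
  by (induction I rule: infinite_finite_induct) (auto intro: algebraic_int_plus_times)

lemma algebraic_int_diff: "algebraic_int (x::complex) \<Longrightarrow> algebraic_int y \<Longrightarrow> algebraic_int (x - y)"
  using algebraic_int_plus_times(1)[of x "- y"] by auto

lemma algebraic_int_zeta [simp, intro]: "algebraic_int (zeta n)"
proof (cases "n > 0")
  case True
  show ?thesis
    by (rule algebraic_int_root[of 1 "monom 1 n"]) (use True in \<open>auto simp: poly_monom degree_monom_eq\<close>)
qed (auto simp: zeta_def)

lemma sum_zeta_power:
  assumes "n > 0"
  shows "(\<Sum>k<n. (zeta n ^ j) ^ k) = (if n dvd j then of_nat n else 0)"
proof (cases "zeta n ^ j = 1")
  case True
  thus ?thesis using zeta_power_eq_1_iff[OF assms, of j] by simp
next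
  case False
  have "(zeta n ^ j) ^ n = 1" using assms by (metis power_mult mult.commute power_one zeta_power_n)
  thus ?thesis using False zeta_power_eq_1_iff[OF assms] by (simp add: geometric_sum)
qed

text \<open>The \<open>n\<close> roots of \<open>X ^ n - 1\<close> are distributed between
  \<open>f\<close> and its cofactor, neither of which has more roots than its degree; so there is no
  loss on either side, and \<open>f\<close> is separable.\<close>

lemma cyclotomic_poly_roots:
  assumes "n > 0" "f dvd monom 1 n - (1 :: complex poly)" "f \<noteq> 0"
  shows "card {z. poly f z = 0} = degree f" "finite {z. poly f z = 0}"
    "poly f z = 0 \<Longrightarrow> z ^ n = 1"
proof -
  define g where "g = monom 1 n - (1 :: complex poly)"
  have deg: "degree g = n"
    unfolding g_def diff_conv_add_uminus using assms(1)
    by (subst degree_add_eq_left) (auto simp: degree_monom_eq)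
  hence g0: "g \<noteq> 0" using assms(1) by auto
  have roots: "{z. poly g z = 0} = {z. z ^ n = 1}" by (simp add: g_def poly_monom)
  obtain h where h: "g = f * h" using assms(2) by (auto simp: g_def)
  have h0: "h \<noteq> 0" using h g0 by auto
  have sum: "degree f + degree h = n" using h deg assms(3) h0 by (simp add: degree_mult_eq)
  have "n = card {z. poly g z = 0}" using assms(1) by (simp add: roots card_roots_unity_eq)
  also have "{z. poly g z = 0} = {z. poly f z = 0} \<union> {z. poly h z = 0}" using h by auto
  also have "card \<dots> \<le> card {z. poly f z = 0} + card {z. poly h z = 0}" by (rule card_Un_le)
  finally have "n \<le> card {z. poly f z = 0} + card {z. poly h z = 0}" .
  moreover have "card {z. poly f z = 0} \<le> degree f" "card {z. poly h z = 0} \<le> degree h"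
    using assms(3) h0 by (auto intro: card_poly_roots_bound)
  ultimately show "card {z. poly f z = 0} = degree f" using sum by linarith
  show "finite {z. poly f z = 0}" using assms(3) by (rule poly_roots_finite)
  show "z ^ n = 1" if "poly f z = 0" for z
  proof -
    have "poly g z = 0" using that h by simp
    thus ?thesis using roots by blast
  qed
qed


section \<open>Automorphisms\<close>

abbreviation auts :: "complex set \<Rightarrow> complex set \<Rightarrow> (complex \<Rightarrow> complex) set"
  where "auts L F \<equiv> carrier (Gal L F)"

lemma auts_iff:
  "\<sigma> \<in> auts L F \<longleftrightarrow> \<sigma> \<in> extensional L \<and> bij_betw \<sigma> L L \<and>
     (\<forall>x\<in>L. \<forall>y\<in>L. \<sigma> (x + y) = \<sigma> x + \<sigma> y \<and> \<sigma> (x * y) = \<sigma> x * \<sigma> y) \<and> \<sigma> 1 = 1 \<and> (\<forall>x\<in>F. \<sigma> x = x)"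
proof -
  have "bij_betw \<sigma> L L \<Longrightarrow> \<sigma> \<in> L \<rightarrow> L" by (auto simp: bij_betw_def)
  thus ?thesis unfolding Gal_def Bij_def Ring.ring_hom_def by auto
qed

lemma Gal_mult: "\<sigma> \<in> auts L F \<Longrightarrow> \<tau> \<in> auts L F \<Longrightarrow> \<sigma> \<otimes>\<^bsub>Gal L F\<^esub> \<tau> = compose L \<sigma> \<tau>"
  by (simp add: Gal_def BijGroup_def)

lemma auts_mono: "F \<subseteq> F' \<Longrightarrow> auts L F' \<subseteq> auts L F"
  by (auto simp: auts_iff subset_iff)

context complex_subfield
begin

context
  fixes \<sigma> E assumes \<sigma>: "\<sigma> \<in> auts F E"
begin

lemma aut_add: "x \<in> F \<Longrightarrow> y \<in> F \<Longrightarrow> \<sigma> (x + y) = \<sigma> x + \<sigma> y"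
  and aut_mult: "x \<in> F \<Longrightarrow> y \<in> F \<Longrightarrow> \<sigma> (x * y) = \<sigma> x * \<sigma> y"
  and aut_one: "\<sigma> 1 = 1"
  and aut_fix: "x \<in> E \<Longrightarrow> \<sigma> x = x"
  and aut_bij: "bij_betw \<sigma> F F"
  and aut_ext: "\<sigma> \<in> extensional F"
  using \<sigma> by (simp_all add: auts_iff)

lemma aut_closed: "x \<in> F \<Longrightarrow> \<sigma> x \<in> F"
  using aut_bij by (auto simp: bij_betw_def)

lemma aut_zero: "\<sigma> 0 = 0"
  using aut_add[of 0 0] by simp

lemma aut_uminus: "x \<in> F \<Longrightarrow> \<sigma> (- x) = - \<sigma> x"
  using aut_add[of x "- x"] by (simp add: aut_zero eq_neg_iff_add_eq_0 add.commute uminus)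

lemma aut_diff: "x \<in> F \<Longrightarrow> y \<in> F \<Longrightarrow> \<sigma> (x - y) = \<sigma> x - \<sigma> y"
  using aut_add[of x "- y"] by (simp add: aut_uminus uminus)

lemma aut_power: "x \<in> F \<Longrightarrow> \<sigma> (x ^ k) = \<sigma> x ^ k"
  by (induction k) (auto simp: aut_one aut_mult power)

lemma aut_sum: "(\<And>i. i \<in> I \<Longrightarrow> g i \<in> F) \<Longrightarrow> \<sigma> (sum g I) = (\<Sum>i\<in>I. \<sigma> (g i))"
  by (induction I rule: infinite_finite_induct) (auto simp: aut_zero aut_add sum)

lemma aut_prod: "(\<And>i. i \<in> I \<Longrightarrow> g i \<in> F) \<Longrightarrow> \<sigma> (prod g I) = (\<Prod>i\<in>I. \<sigma> (g i))"
  by (induction I rule: infinite_finite_induct) (auto simp: aut_one aut_mult prod)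

lemma aut_of_nat: "\<sigma> (of_nat k) = of_nat k"
  by (induction k) (simp_all add: aut_zero aut_one aut_add)

lemma aut_of_int: "\<sigma> (of_int k) = of_int k"
  by (cases k) (simp_all add: aut_of_nat aut_uminus del: of_nat_Suc)

lemma aut_eq_iff: "x \<in> F \<Longrightarrow> y \<in> F \<Longrightarrow> \<sigma> x = \<sigma> y \<longleftrightarrow> x = y"
  using aut_bij by (auto simp: bij_betw_def inj_on_def)

lemma aut_eq_0_iff: "x \<in> F \<Longrightarrow> \<sigma> x = 0 \<longleftrightarrow> x = 0"
  using aut_eq_iff[of x 0] by (simp add: aut_zero)

lemma aut_divide: "x \<in> F \<Longrightarrow> y \<in> F \<Longrightarrow> \<sigma> (x / y) = \<sigma> x / \<sigma> y"
proof (cases "y = 0")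
  case False
  assume xy: "x \<in> F" "y \<in> F"
  have "\<sigma> (x / y) * \<sigma> y = \<sigma> x" using aut_mult[of "x / y" y] xy False by (auto simp: divide)
  thus ?thesis using False xy by (simp add: field_simps aut_eq_0_iff)
qed (simp add: aut_zero)

lemma aut_poly:
  assumes "p \<in> polys_over F" "x \<in> F"
  shows "\<sigma> (poly p x) = (\<Sum>i\<le>degree p. \<sigma> (coeff p i) * \<sigma> x ^ i)"
  unfolding poly_altdef
  by (subst aut_sum) (use assms in \<open>auto simp: aut_mult aut_power coeff_polys_over power intro: mult\<close>)

lemma aut_poly_fix:
  assumes "p \<in> polys_over E" "E \<subseteq> F" "x \<in> F"
  shows "\<sigma> (poly p x) = poly p (\<sigma> x)"
proof -
  have "p \<in> polys_over F" using assms by (auto simp: polys_over_def)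
  thus ?thesis using assms
    by (subst aut_poly) (auto simp: poly_altdef aut_fix polys_over_def)
qed

lemma aut_algebraic_int:
  assumes "x \<in> F" "algebraic_int x"
  shows "algebraic_int (\<sigma> x)"
proof -
  obtain p :: "int poly" where p: "poly (map_poly of_int p) x = 0" "lead_coeff p = 1"
    using assms(2) unfolding algebraic_int_altdef_ipoly by blast
  have "map_poly of_int p \<in> polys_over F" by (auto simp: polys_over_def)
  hence "poly (map_poly of_int p) (\<sigma> x) = \<sigma> (poly (map_poly of_int p) x)"
    using assms by (subst aut_poly) (auto simp: poly_altdef aut_of_int)
  thus ?thesis using p unfolding algebraic_int_altdef_ipoly by (metis aut_zero)
qed

end

lemma auts_one: "E \<subseteq> F \<Longrightarrow> (\<lambda>x\<in>F. x) \<in> auts F E"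
  unfolding auts_iff by (auto simp: add mult bij_betw_def inj_on_def)

lemma auts_compose:
  assumes "\<sigma> \<in> auts F E" "\<tau> \<in> auts F E" "E \<subseteq> F"
  shows "compose F \<sigma> \<tau> \<in> auts F E"
proof -
  have "bij_betw (compose F \<sigma> \<tau>) F F"
    using bij_betw_compose[OF aut_bij[OF assms(2)] aut_bij[OF assms(1)]] .
  moreover have "compose F \<sigma> \<tau> x = \<sigma> (\<tau> x)" if "x \<in> F" for x using that by (simp add: compose_def)
  ultimately show ?thesis
    unfolding auts_iff[of "compose F \<sigma> \<tau>"] using assms(3)
    by (auto simp: compose_extensional aut_add[OF assms(1)] aut_add[OF assms(2)] aut_mult[OF assms(1)] add mult
        aut_mult[OF assms(2)] aut_closed[OF assms(2)] aut_one[OF assms(1)] aut_one[OF assms(2)]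
        aut_fix[OF assms(1)] aut_fix[OF assms(2)] subset_iff)
qed

lemma auts_inverse:
  assumes "\<sigma> \<in> auts F E" "E \<subseteq> F"
  obtains \<tau> where "\<tau> \<in> auts F E" "\<And>x. x \<in> F \<Longrightarrow> \<tau> (\<sigma> x) = x" "\<And>x. x \<in> F \<Longrightarrow> \<sigma> (\<tau> x) = x"
proof -
  define \<tau> where "\<tau> = restrict (inv_into F \<sigma>) F"
  note bij = aut_bij[OF assms(1)]
  have 1: "\<tau> (\<sigma> x) = x" if "x \<in> F" for x
    using bij that by (simp add: \<tau>_def aut_closed[OF assms(1)] bij_betw_inv_into_left)
  have 2: "\<sigma> (\<tau> x) = x" if "x \<in> F" for x
    using bij that by (simp add: \<tau>_def bij_betw_inv_into_right)
  have b: "bij_betw \<tau> F F" unfolding \<tau>_def using bij by (simp add: bij_betw_inv_into)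
  have cl: "\<tau> x \<in> F" if "x \<in> F" for x using b that by (auto simp: bij_betw_def)
  have "\<tau> (x + y) = \<tau> x + \<tau> y" "\<tau> (x * y) = \<tau> x * \<tau> y" if "x \<in> F" "y \<in> F" for x y
    using 1[of "\<tau> x + \<tau> y"] 1[of "\<tau> x * \<tau> y"] that
    by (simp_all add: aut_add[OF assms(1)] aut_mult[OF assms(1)] 2 cl add mult)
  moreover have "\<tau> 1 = 1" using 1[of 1] by (simp add: aut_one[OF assms(1)])
  moreover have "\<tau> x = x" if "x \<in> E" for x
    using 1[of x] that assms by (auto simp: aut_fix[OF assms(1)])
  ultimately have "\<tau> \<in> auts F E" unfolding auts_iff using b by (auto simp: \<tau>_def)
  thus thesis using 1 2 by (rule that)
qed

lemma auts_translate:
  assumes "\<sigma> \<in> auts F E" "E \<subseteq> F"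
  shows "bij_betw (compose F \<sigma>) (auts F E) (auts F E)"
proof -
  obtain \<tau> where \<tau>: "\<tau> \<in> auts F E" "\<And>x. x \<in> F \<Longrightarrow> \<tau> (\<sigma> x) = x" "\<And>x. x \<in> F \<Longrightarrow> \<sigma> (\<tau> x) = x"
    by (rule auts_inverse[OF assms]) (rule that)
  have "compose F \<tau> (compose F \<sigma> \<rho>) = \<rho>" "compose F \<sigma> (compose F \<tau> \<rho>) = \<rho>" if "\<rho> \<in> auts F E" for \<rho>
    using aut_ext[OF that] aut_closed[OF that]
    by (auto simp: compose_def fun_eq_iff \<tau> extensional_def)
  moreover have "compose F \<sigma> ` auts F E \<subseteq> auts F E" "compose F \<tau> ` auts F E \<subseteq> auts F E"
    using auts_compose[OF assms(1) _ assms(2)] auts_compose[OF \<tau>(1) _ assms(2)] by blast+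
  ultimately show ?thesis
    by (intro bij_betw_byWitness[where f' = "compose F \<tau>"]) blast+
qed

end

section \<open>Cyclotomic fields\<close>

lemma polys_over_unity: "complex_subfield F \<Longrightarrow> monom 1 n - 1 \<in> polys_over F"
  by (rule complex_subfield.polys_over_diff) (auto intro: complex_subfield.monom_polys_over
      complex_subfield.one simp: complex_subfield.polys_over_simps)

text \<open>Applied to \<open>b\<close> with \<open>\<sigma> \<zeta> = \<zeta> ^ b\<close>, where
  the hypothesis expresses injectivity of \<open>\<sigma>\<close> on the powers of
  \<open>\<zeta>\<close>. The decisive instance is \<open>k = n div gcd b n\<close>.\<close>

lemma coprime_if_dvd_cancel:
  fixes b n :: nat
  assumes "n > 0" "\<And>k. n dvd b * k \<Longrightarrow> n dvd k"
  shows "coprime b n"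
proof -
  define g where "g = gcd b n"
  obtain b' k where k: "b = g * b'" "n = g * k" unfolding g_def by (meson dvdE gcd_dvd1 gcd_dvd2)
  have "b * k = n * b'" unfolding k by simp
  hence "n dvd k" using assms(2)[of k] by simp
  moreover have "k > 0" "g > 0" using k(2) assms(1) by auto
  ultimately have "g * k \<le> k" using k(2) dvd_imp_le by metis
  hence "g = 1" using \<open>k > 0\<close> \<open>g > 0\<close> by simp
  thus ?thesis unfolding g_def coprime_iff_gcd_eq_1 .
qed

lemma unity_poly_nonzero: "n > 0 \<Longrightarrow> monom 1 n - (1 :: complex poly) \<noteq> 0"
proof
  assume "n > 0" "monom 1 n - (1 :: complex poly) = 0"
  hence "coeff (monom 1 n - (1 :: complex poly)) n = 0" by simp
  thus False using \<open>n > 0\<close> by (simp add: coeff_1)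
qed

lemma cyclotomic_field_eq_adjoin:
  assumes "n > 0"
  shows "cyclotomic_field n = adjoin \<rat> (zeta n)" "complex_subfield (cyclotomic_field n)"
proof -
  interpret Q: complex_subfield "\<rat>" by (rule complex_subfield_Rats)
  interpret C: field \<CC> by (rule field_complex)
  have A: "complex_subfield (adjoin \<rat> (zeta n))"
    by (rule Q.complex_subfield_adjoin[OF polys_over_unity unity_poly_nonzero])
      (use assms in \<open>auto simp: poly_monom complex_subfield_Rats\<close>)
  show sub: "complex_subfield (cyclotomic_field n)"
    unfolding cyclotomic_field_def complex_subfield_def
    by (rule C.generate_field_is_subfield) auto
  show "cyclotomic_field n = adjoin \<rat> (zeta n)"
  proof
    show "cyclotomic_field n \<subseteq> adjoin \<rat> (zeta n)"
      unfolding cyclotomic_field_def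
      by (rule C.generate_field_min_subfield1) (use A in \<open>auto simp: complex_subfield_def\<close>)
  next
    interpret L: complex_subfield "cyclotomic_field n" by (rule sub)
    have "zeta n \<in> cyclotomic_field n"
      unfolding cyclotomic_field_def by (rule generate_field.incl) simp
    moreover have "coeff p i \<in> cyclotomic_field n" if "p \<in> polys_over \<rat>" for p i
      using that L.Rats_subset by (auto simp: polys_over_def)
    ultimately show "adjoin \<rat> (zeta n) \<subseteq> cyclotomic_field n"
      by (auto simp: adjoin_def poly_altdef intro!: L.sum L.mult L.power)
  qed
qed

text \<open>The base field stays a parameter because the theory is applied over the rationals, over
  \<open>K\<close>, and over the field of \<open>m\<close>-th roots of unity.\<close>

locale sub_cyclotomic = complex_subfield F for F +
  fixes n :: nat
  assumes n_pos [simp]: "n > 0" and F_subset: "F \<subseteq> cyclotomic_field n"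
begin

abbreviation L where "L \<equiv> cyclotomic_field n"
abbreviation \<zeta> where "\<zeta> \<equiv> zeta n"

sublocale L: complex_subfield L
  using cyclotomic_field_eq_adjoin[OF n_pos] by blast

sublocale Q: complex_subfield "\<rat>"
  by (rule complex_subfield_Rats)

lemma L_eq: "L = adjoin F \<zeta>"
proof
  show "L \<subseteq> adjoin F \<zeta>"
  proof -
    have "polys_over \<rat> \<subseteq> polys_over F" using Rats_subset by (auto simp: polys_over_def)
    thus ?thesis unfolding cyclotomic_field_eq_adjoin(1)[OF n_pos] by (auto simp: adjoin_def)
  qed
  have "\<zeta> \<in> L" unfolding cyclotomic_field_eq_adjoin(1)[OF n_pos] by (rule Q.adjoin_gen)
  thus "adjoin F \<zeta> \<subseteq> L"
    using F_subset by (auto simp: adjoin_def poly_altdef polys_over_def intro!: L.sum L.mult L.power)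
qed

lemma zeta_in_L [simp, intro]: "\<zeta> \<in> L"
  by (subst L_eq) (rule adjoin_gen)

lemma zeta_power_in_L [simp, intro]: "\<zeta> ^ k \<in> L"
  by (rule L.power) simp

lemma F_in_L: "x \<in> F \<Longrightarrow> x \<in> L"
  using F_subset by auto

lemma poly_in_L: "p \<in> polys_over F \<Longrightarrow> poly p \<zeta> \<in> L"
  by (auto simp: L_eq adjoin_def)

lemma in_LE:
  assumes "x \<in> L" obtains p where "p \<in> polys_over F" "x = poly p \<zeta>"
  using assms by (auto simp: L_eq adjoin_def)

lemma aut_eqI:
  assumes "\<sigma> \<in> auts L F" "\<tau> \<in> auts L F" "\<sigma> \<zeta> = \<tau> \<zeta>"
  shows "\<sigma> = \<tau>"
proof
  fix x
  show "\<sigma> x = \<tau> x"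
  proof (cases "x \<in> L")
    case True
    then obtain p where "p \<in> polys_over F" "x = poly p \<zeta>" by (rule in_LE)
    thus ?thesis
      using L.aut_poly_fix[OF assms(1) _ F_subset zeta_in_L] L.aut_poly_fix[OF assms(2) _ F_subset zeta_in_L]
        assms(3) by simp
  next
    case False
    thus ?thesis using L.aut_ext[OF assms(1)] L.aut_ext[OF assms(2)] by (simp add: extensional_def)
  qed
qed

lemma aut_zeta:
  assumes "\<sigma> \<in> auts L F"
  obtains b where "coprime b n" "\<sigma> \<zeta> = \<zeta> ^ b"
proof -
  have "\<sigma> \<zeta> ^ n = 1"
    using L.aut_power[OF assms zeta_in_L, of n] L.aut_one[OF assms] by simp
  then obtain b where b: "\<sigma> \<zeta> = \<zeta> ^ b" using root_of_unity_iff[OF n_pos] by auto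
  have "coprime b n"
  proof (rule coprime_if_dvd_cancel[OF n_pos])
    fix k assume "n dvd b * k"
    hence "\<sigma> (\<zeta> ^ k) = 1"
      using zeta_power_eq_1_iff[OF n_pos] by (simp add: L.aut_power[OF assms zeta_in_L] b power_mult[symmetric])
    hence "\<zeta> ^ k = 1"
      using L.aut_eq_iff[OF assms zeta_power_in_L[of k] L.one] L.aut_one[OF assms] by simp
    thus "n dvd k" using zeta_power_eq_1_iff[OF n_pos] by simp
  qed
  thus thesis using that b by blast
qed

lemma finite_auts [simp]: "finite (auts L F)"
proof (rule finite_imageD)
  show "finite ((\<lambda>\<sigma>. \<sigma> \<zeta>) ` auts L F)"
  proof (rule finite_subset)
    show "(\<lambda>\<sigma>. \<sigma> \<zeta>) ` auts L F \<subseteq> {z. z ^ n = 1}"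
      by (auto elim!: aut_zeta simp: power_mult[symmetric] mult.commute[of _ n])
        (simp add: power_mult)
    show "finite {z::complex. z ^ n = 1}" by (rule finite_roots_unity) (use n_pos in linarith)
  qed
  show "inj_on (\<lambda>\<sigma>. \<sigma> \<zeta>) (auts L F)" by (auto intro!: inj_onI aut_eqI)
qed

text \<open>The map sends \<open>p(\<zeta>)\<close> to \<open>p(\<rho>)\<close>; the hypothesis says
  exactly that the choice of \<open>p\<close> is immaterial.\<close>

lemma aut_of_root:
  assumes root: "\<And>p. p \<in> polys_over F \<Longrightarrow> poly p \<zeta> = 0 \<Longrightarrow> poly p \<rho> = 0"
  obtains \<sigma> where "\<sigma> \<in> auts L F" "\<sigma> \<zeta> = \<rho>"
proof -
  have "\<rho> ^ n = 1"
    using root[OF polys_over_unity[OF complex_subfield_axioms], of n] by (simp add: poly_monom)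
  then obtain b where b: "\<rho> = \<zeta> ^ b" using root_of_unity_iff[OF n_pos] by auto
  have rL: "\<rho> \<in> L" by (simp add: b)
  define rep where "rep x = (SOME p. p \<in> polys_over F \<and> x = poly p \<zeta>)" for x
  define \<sigma> where "\<sigma> = (\<lambda>x\<in>L. poly (rep x) \<rho>)"
  have \<sigma>_poly: "\<sigma> (poly p \<zeta>) = poly p \<rho>" if p: "p \<in> polys_over F" for p
  proof -
    have "rep (poly p \<zeta>) \<in> polys_over F \<and> poly p \<zeta> = poly (rep (poly p \<zeta>)) \<zeta>"
      unfolding rep_def by (rule someI[of _ p]) (use p in auto)
    hence "poly (rep (poly p \<zeta>)) \<rho> = poly p \<rho>"
      using root[of "rep (poly p \<zeta>) - p"] p by auto
    thus ?thesis using poly_in_L[OF p] by (simp add: \<sigma>_def)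
  qed
  have add: "\<sigma> (x + y) = \<sigma> x + \<sigma> y" and mult: "\<sigma> (x * y) = \<sigma> x * \<sigma> y" and closed: "\<sigma> x \<in> L"
    if xy: "x \<in> L" "y \<in> L" for x y
  proof -
    obtain p q where pq: "p \<in> polys_over F" "x = poly p \<zeta>" "q \<in> polys_over F" "y = poly q \<zeta>"
      using xy by (auto elim!: in_LE)
    show "\<sigma> (x + y) = \<sigma> x + \<sigma> y" "\<sigma> (x * y) = \<sigma> x * \<sigma> y"
      using \<sigma>_poly[of "p + q"] \<sigma>_poly[of "p * q"] pq by (auto simp: \<sigma>_poly)
    have "poly p \<rho> \<in> L" unfolding poly_altdef
      using pq(1) F_in_L rL by (auto simp: polys_over_def intro!: L.sum L.mult L.power)
    thus "\<sigma> x \<in> L" using pq by (simp add: \<sigma>_poly)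
  qed
  have fixF: "\<sigma> x = x" if "x \<in> F" for x using \<sigma>_poly[of "[:x:]"] that by simp
  have \<sigma>\<zeta>: "\<sigma> \<zeta> = \<rho>" using \<sigma>_poly[of "[:0,1:]"] by simp
  have pow: "\<sigma> (x ^ k) = \<sigma> x ^ k" if "x \<in> L" for x k
    using that by (induction k) (auto simp: mult fixF L.power)
  have "inj_on \<sigma> L"
  proof (rule inj_onI, rule ccontr)
    fix x y assume xy: "x \<in> L" "y \<in> L" "\<sigma> x = \<sigma> y" "x \<noteq> y"
    define d where "d = x - y"
    have d: "d \<in> L" "d \<noteq> 0" using xy by (auto simp: d_def)
    have "\<sigma> d + \<sigma> y = \<sigma> x" using add[of d y] d xy by (simp add: d_def)
    hence "\<sigma> d = 0" using xy by simp
    hence "\<sigma> (d * inverse d) = 0" using mult[of d "inverse d"] d by auto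
    thus False using d fixF[of 1] by simp
  qed
  \<comment> \<open>Surjectivity without a dimension count: injectivity makes \<open>b\<close> prime
    to \<open>n\<close>, so \<open>\<zeta>\<close> is the image of some
    \<open>\<zeta> ^ c\<close>.\<close>
  have "\<zeta> \<in> \<sigma> ` L"
  proof -
    have "coprime b n"
    proof (rule coprime_if_dvd_cancel[OF n_pos])
      fix k assume "n dvd b * k"
      hence "\<sigma> (\<zeta> ^ k) = 1"
        using zeta_power_eq_1_iff[OF n_pos] by (simp add: pow \<sigma>\<zeta> b power_mult[symmetric])
      hence "\<zeta> ^ k = 1" using inj_onD[OF \<open>inj_on \<sigma> L\<close>, of "\<zeta> ^ k" 1] fixF[of 1] by auto
      thus "n dvd k" using zeta_power_eq_1_iff[OF n_pos] by simp
    qed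
    then obtain c where "[b * c = 1] (mod n)" using cong_solve_coprime_nat[of b n] by auto
    hence "\<zeta> ^ (b * c) = \<zeta>" using zeta_power_eq_iff[OF n_pos, of "b * c" 1] by simp
    hence "\<sigma> (\<zeta> ^ c) = \<zeta>" by (simp add: pow \<sigma>\<zeta> b power_mult)
    thus ?thesis by (metis image_eqI zeta_power_in_L)
  qed
  moreover have "poly p (\<sigma> u) \<in> \<sigma> ` L" if p: "p \<in> polys_over F" and u: "u \<in> L" for p u
    using p
  proof (induction p)
    case (pCons c p)
    then obtain v where v: "v \<in> L" "poly p (\<sigma> u) = \<sigma> v" by auto
    have "\<sigma> (c + u * v) = poly (pCons c p) (\<sigma> u)"
      using pCons v u F_in_L by (simp add: add mult fixF L.mult)
    moreover have "c + u * v \<in> L" using pCons v u F_in_L by auto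
    ultimately show ?case by (metis image_eqI)
  qed (use fixF[of 0] in \<open>auto simp: image_iff intro: bexI[of _ 0]\<close>)
  ultimately have "poly p \<zeta> \<in> \<sigma> ` L" if "p \<in> polys_over F" for p
    using that by (metis imageE)
  hence "L \<subseteq> \<sigma> ` L" by (auto elim!: in_LE)
  hence "bij_betw \<sigma> L L" using \<open>inj_on \<sigma> L\<close> closed by (auto simp: bij_betw_def)
  moreover have ext: "\<sigma> \<in> extensional L" by (simp add: \<sigma>_def)
  ultimately have "\<sigma> \<in> auts L F"
    unfolding auts_iff using add mult fixF[of 1] fixF ext by simp
  thus thesis using that \<sigma>\<zeta> by blast
qed

text \<open>Write \<open>x = p(\<zeta>)\<close> with \<open>p\<close> of smaller degree than the minimal polynomial \<open>f\<close> of \<open>\<zeta>\<close> over \<open>F\<close>. All roots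
  of \<open>f\<close> are images of \<open>\<zeta>\<close> and \<open>f\<close> is separable, so \<open>p - x\<close> has too many roots.\<close>

lemma fixed_in_base:
  assumes "x \<in> L" "\<And>\<sigma>. \<sigma> \<in> auts L F \<Longrightarrow> \<sigma> x = x"
  shows "x \<in> F"
proof -
  have *: "poly (monom 1 n - 1) \<zeta> = 0" by (simp add: poly_monom)
  obtain f where f: "f \<in> polys_over F" "lead_coeff f = 1" "poly f \<zeta> = 0"
    and dvd: "\<And>p. p \<in> polys_over F \<Longrightarrow> poly p \<zeta> = 0 \<Longrightarrow> f dvd p"
    by (rule minimal_polynomial[OF polys_over_unity[OF complex_subfield_axioms] unity_poly_nonzero[OF n_pos] *]) (rule that)
  have f0: "f \<noteq> 0" using f(2) by auto
  have card: "card {z. poly f z = 0} = degree f"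
    by (rule cyclotomic_poly_roots[OF n_pos dvd[OF polys_over_unity[OF complex_subfield_axioms] *] f0])
  obtain p where p: "p \<in> polys_over F" "x = poly p \<zeta>" "p = 0 \<or> degree p < degree f"
    by (rule adjoin_reduce[OF f(1) f0 f(3) assms(1)[unfolded L_eq]])
  define q where "q = p - [:x:]"
  have "poly q \<rho> = 0" if \<rho>: "poly f \<rho> = 0" for \<rho>
  proof -
    obtain \<sigma> where \<sigma>: "\<sigma> \<in> auts L F" "\<sigma> \<zeta> = \<rho>"
    proof (rule aut_of_root[of \<rho>])
      fix p assume "p \<in> polys_over F" "poly p \<zeta> = 0"
      hence "f dvd p" by (rule dvd)
      thus "poly p \<rho> = 0" using \<rho> by (auto elim!: dvdE)
    qed
    have "\<sigma> x = poly p \<rho>" using L.aut_poly_fix[OF \<sigma>(1) p(1) F_subset zeta_in_L] \<sigma>(2) p(2) by simp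
    thus ?thesis using assms(2)[OF \<sigma>(1)] by (simp add: q_def)
  qed
  hence sub: "{z. poly f z = 0} \<subseteq> {z. poly q z = 0}" by auto
  have "degree f \<noteq> 0"
  proof
    assume "degree f = 0"
    then obtain c where "f = [:c:]" by (rule degree_eq_zeroE)
    thus False using f(2,3) by simp
  qed
  have "q = 0"
  proof (rule ccontr)
    assume q: "q \<noteq> 0"
    have "degree q < degree f"
      using p(3) \<open>degree f \<noteq> 0\<close> by (auto simp: q_def intro!: degree_diff_less)
    moreover have "degree f \<le> card {z. poly q z = 0}"
      unfolding card[symmetric] by (rule card_mono[OF poly_roots_finite[OF q] sub])
    ultimately show False using card_poly_roots_bound[OF q] by linarith
  qed
  hence "p = [:x:]" by (simp add: q_def)
  thus ?thesis using p(1) by simp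
qed

end

section \<open>Traces and Fourier inversion\<close>

text \<open>The working form of the trace; \<open>field_trace_eq\<close> identifies it with the
  trace of a multiplication matrix.\<close>

definition aut_trace :: "complex set \<Rightarrow> complex set \<Rightarrow> complex \<Rightarrow> complex"
  where "aut_trace L F x = (\<Sum>\<sigma>\<in>auts L F. \<sigma> x)"

context sub_cyclotomic
begin

abbreviation Tr where "Tr \<equiv> aut_trace L F"

lemma Tr_in_L: "x \<in> L \<Longrightarrow> Tr x \<in> L"
  unfolding aut_trace_def by (rule L.sum) (rule L.aut_closed)

lemma Tr_add: "x \<in> L \<Longrightarrow> y \<in> L \<Longrightarrow> Tr (x + y) = Tr x + Tr y"
  unfolding aut_trace_def by (simp add: L.aut_add sum.distrib cong: sum.cong)

lemma Tr_0 [simp]: "Tr 0 = 0"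
  unfolding aut_trace_def by (simp add: L.aut_zero cong: sum.cong)

lemma Tr_mult: "c \<in> F \<Longrightarrow> x \<in> L \<Longrightarrow> Tr (c * x) = c * Tr x"
  unfolding aut_trace_def by (simp add: L.aut_mult F_in_L L.aut_fix sum_distrib_left cong: sum.cong)

lemma Tr_sum: "(\<And>i. i \<in> I \<Longrightarrow> g i \<in> L) \<Longrightarrow> Tr (sum g I) = (\<Sum>i\<in>I. Tr (g i))"
  by (induction I rule: infinite_finite_induct) (auto simp: Tr_add L.sum)

lemma Tr_aut: 
  assumes "\<sigma> \<in> auts L F" "x \<in> L"
  shows "\<sigma> (Tr x) = Tr x"
proof -
  have "\<sigma> (Tr x) = (\<Sum>\<tau>\<in>auts L F. \<sigma> (\<tau> x))"
    unfolding aut_trace_def by (rule L.aut_sum[OF assms(1)]) (use assms L.aut_closed in auto)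
  also have "\<dots> = (\<Sum>\<tau>\<in>auts L F. compose L \<sigma> \<tau> x)"
    using assms(2) by (simp add: compose_def)
  also have "\<dots> = Tr x"
    unfolding aut_trace_def
    by (rule sum.reindex_bij_betw[OF L.auts_translate[OF assms(1) F_subset], of "\<lambda>\<tau>. \<tau> x"])
  finally show ?thesis .
qed

lemma Tr_in_F: "x \<in> L \<Longrightarrow> Tr x \<in> F"
  by (rule fixed_in_base) (auto simp: Tr_in_L Tr_aut)

lemma Tr_algebraic_int: "x \<in> L \<Longrightarrow> algebraic_int x \<Longrightarrow> algebraic_int (Tr x)"
  unfolding aut_trace_def by (rule algebraic_int_sum) (rule L.aut_algebraic_int)

text \<open>Orthogonality: for \<open>\<sigma>\<close> other than the identity,
  \<open>\<zeta> / \<sigma> \<zeta>\<close> is an \<open>n\<close>-th root of unity different from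
  1, so its powers sum to 0. Up to the factor \<open>n\<close> this yields coefficients in
  \<open>F\<close> with respect to the powers of \<open>\<zeta>\<close>, which are in general
  linearly dependent.\<close>

lemma fourier_inversion:
  assumes "x \<in> L"
  shows "of_nat n * x = (\<Sum>k<n. Tr (x / \<zeta> ^ k) * \<zeta> ^ k)"
proof -
  have "(\<Sum>k<n. Tr (x / \<zeta> ^ k) * \<zeta> ^ k) = (\<Sum>k<n. \<Sum>\<sigma>\<in>auts L F. \<sigma> x * (\<zeta> / \<sigma> \<zeta>) ^ k)"
    unfolding aut_trace_def using assms
    by (simp add: L.aut_divide L.aut_power sum_distrib_right power_divide cong: sum.cong)
  also have "\<dots> = (\<Sum>\<sigma>\<in>auts L F. \<sigma> x * (\<Sum>k<n. (\<zeta> / \<sigma> \<zeta>) ^ k))"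
    by (subst sum.swap) (simp add: sum_distrib_left)
  also have "\<dots> = (\<Sum>\<sigma>\<in>auts L F. if \<sigma> = (\<lambda>x\<in>L. x) then of_nat n * x else 0)"
  proof (rule sum.cong[OF refl])
    fix \<sigma> assume \<sigma>: "\<sigma> \<in> auts L F"
    show "\<sigma> x * (\<Sum>k<n. (\<zeta> / \<sigma> \<zeta>) ^ k) = (if \<sigma> = (\<lambda>x\<in>L. x) then of_nat n * x else 0)"
    proof (cases "\<sigma> = (\<lambda>x\<in>L. x)")
      case False
      have "\<sigma> \<zeta> \<noteq> \<zeta>"
        using aut_eqI[OF \<sigma> L.auts_one[OF F_subset]] False by auto
      moreover have "\<sigma> \<zeta> \<noteq> 0" using L.aut_eq_0_iff[OF \<sigma> zeta_in_L] by simp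
      ultimately have "\<zeta> / \<sigma> \<zeta> \<noteq> 1" by simp
      moreover have "(\<zeta> / \<sigma> \<zeta>) ^ n = 1"
        using L.aut_power[OF \<sigma> zeta_in_L, of n] L.aut_one[OF \<sigma>] by (simp add: power_divide)
      ultimately show ?thesis using False by (simp add: geometric_sum)
    qed (use assms in simp)
  qed
  also have "\<dots> = of_nat n * x" using L.auts_one[OF F_subset] by simp
  finally show ?thesis ..
qed

end


section \<open>The rings generated by roots of unity\<close>

definition int_adjoin :: "complex \<Rightarrow> complex set"
  where "int_adjoin z = {poly (map_poly of_int p) z |p :: int poly. True}"

lemma int_adjoinI: "x = poly (map_poly of_int p) z \<Longrightarrow> x \<in> int_adjoin z"
  by (auto simp: int_adjoin_def)

lemma int_adjoin_add [intro]: "x \<in> int_adjoin z \<Longrightarrow> y \<in> int_adjoin z \<Longrightarrow> x + y \<in> int_adjoin z"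
  unfolding int_adjoin_def by clarsimp (metis of_int_poly_hom.hom_add poly_add)

lemma int_adjoin_mult [intro]: "x \<in> int_adjoin z \<Longrightarrow> y \<in> int_adjoin z \<Longrightarrow> x * y \<in> int_adjoin z"
  unfolding int_adjoin_def by clarsimp (metis of_int_poly_hom.hom_mult poly_mult)

lemma int_adjoin_of_int [simp, intro]: "of_int c \<in> int_adjoin z"
  by (rule int_adjoinI[of _ "[:c:]"]) (simp add: of_int_hom.map_poly_pCons_hom)

lemma int_adjoin_of_nat [simp, intro]: "of_nat c \<in> int_adjoin z"
  using int_adjoin_of_int[of "int c"] by simp

lemma int_adjoin_0 [simp, intro]: "0 \<in> int_adjoin z" and int_adjoin_1 [simp, intro]: "1 \<in> int_adjoin z"
  using int_adjoin_of_int[of 0] int_adjoin_of_int[of 1] by simp_all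

lemma int_adjoin_uminus [intro]: "x \<in> int_adjoin z \<Longrightarrow> - x \<in> int_adjoin z"
  using int_adjoin_mult[OF int_adjoin_of_int[of "-1"]] by simp

lemma int_adjoin_diff [intro]: "x \<in> int_adjoin z \<Longrightarrow> y \<in> int_adjoin z \<Longrightarrow> x - y \<in> int_adjoin z"
  using int_adjoin_add[OF _ int_adjoin_uminus] by fastforce

lemma int_adjoin_power [intro]: "x \<in> int_adjoin z \<Longrightarrow> x ^ k \<in> int_adjoin z"
  by (induction k) auto

lemma int_adjoin_gen [simp, intro]: "z \<in> int_adjoin z"
  by (rule int_adjoinI[of _ "[:0,1:]"]) simp

lemma int_adjoin_sum [intro]: "(\<And>i. i \<in> I \<Longrightarrow> g i \<in> int_adjoin z) \<Longrightarrow> sum g I \<in> int_adjoin z"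
  by (induction I rule: infinite_finite_induct) auto

lemma int_adjoin_poly: "u \<in> int_adjoin z \<Longrightarrow> poly (map_poly of_int p) u \<in> int_adjoin z"
  by (induction p) (auto simp: map_poly_pCons)

lemma int_adjoin_trans: "u \<in> int_adjoin z \<Longrightarrow> x \<in> int_adjoin u \<Longrightarrow> x \<in> int_adjoin z"
  using int_adjoin_poly by (auto simp: int_adjoin_def[of u])

lemma int_adjoin_algebraic_int: "algebraic_int z \<Longrightarrow> x \<in> int_adjoin z \<Longrightarrow> algebraic_int x"
proof -
  assume z: "algebraic_int z" and "x \<in> int_adjoin z"
  then obtain p :: "int poly" where "x = poly (map_poly of_int p) z" by (auto simp: int_adjoin_def)
  thus "algebraic_int x"
    using z by (auto simp: poly_altdef intro!: algebraic_int_sum algebraic_int_plus_times algebraic_int_power)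
qed

lemma power_prime_add_mod:
  assumes "prime l" "a \<in> int_adjoin z" "b \<in> int_adjoin z"
  shows "\<exists>w\<in>int_adjoin z. (a + b) ^ l = a ^ l + b ^ l + of_nat l * w"
proof -
  define w where "w = (\<Sum>k\<in>{1..<l}. of_nat ((l choose k) div l) * a ^ k * b ^ (l - k))"
  have l: "l > 0" using assms(1) by (simp add: prime_gt_0_nat)
  have "(a + b) ^ l = (\<Sum>k\<le>l. of_nat (l choose k) * a ^ k * b ^ (l - k))"
    by (rule binomial_ring)
  also have "{..l} = insert 0 (insert l {1..<l})" using l by auto
  also have "(\<Sum>k\<in>\<dots>. of_nat (l choose k) * a ^ k * b ^ (l - k)) =
      b ^ l + (a ^ l + (\<Sum>k\<in>{1..<l}. of_nat (l choose k) * a ^ k * b ^ (l - k)))"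
    using l by simp
  also have "(\<Sum>k\<in>{1..<l}. of_nat (l choose k) * a ^ k * b ^ (l - k)) = of_nat l * w"
    unfolding w_def sum_distrib_left
  proof (rule sum.cong[OF refl])
    fix k assume "k \<in> {1..<l}"
    hence "l dvd l choose k" using assms(1) by (intro dvd_choose_prime) auto
    hence "of_nat (l choose k) = (of_nat l * of_nat ((l choose k) div l) :: complex)"
      by (metis dvd_mult_div_cancel of_nat_mult)
    thus "of_nat (l choose k) * a ^ k * b ^ (l - k) = of_nat l * (of_nat ((l choose k) div l) * a ^ k * b ^ (l - k))"
      by simp
  qed
  finally have "(a + b) ^ l = a ^ l + b ^ l + of_nat l * w" by simp
  moreover have "w \<in> int_adjoin z" using assms unfolding w_def by auto
  ultimately show ?thesis by blast
qed

lemma int_power_prime_mod: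
  assumes "prime l"
  shows "int l dvd c ^ l - c"
proof -
  define m where "m = nat (c mod int l)"
  have l: "l > 0" using assms by (simp add: prime_gt_0_nat)
  have c: "[c = int m] (mod int l)" using l by (simp add: m_def cong_def)
  have "[m ^ l = m] (mod l)"
  proof (cases "l dvd m")
    case True
    hence "l dvd m ^ l" using l by (simp add: dvd_power dvd_trans)
    thus ?thesis using True by (simp add: cong_def mod_eq_0_iff_dvd)
  next
    case False
    hence "[m ^ (l - 1) * m = 1 * m] (mod l)"
      by (intro cong_scalar_right fermat_theorem) (use assms False in auto)
    thus ?thesis using l by (simp add: power_Suc2[symmetric] del: power_Suc)
  qed
  hence "[int m ^ l = int m] (mod int l)" using cong_int_iff by (metis of_nat_power)
  hence "[c ^ l = c] (mod int l)" using cong_pow[OF c, of l] c by (meson cong_sym cong_trans)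
  thus ?thesis by (simp add: cong_iff_dvd_diff)
qed

text \<open>Horner induction: integer coefficients are fixed by Fermat, and the mixed terms of an
  \<open>l\<close>-th power are divisible by \<open>l\<close>. The explicit error term
  \<open>w\<close> keeps the congruence inside \<open>int_adjoin z\<close>, so that no quotient ring
  is formed.\<close>

lemma frobenius_int_poly:
  fixes p :: "int poly"
  assumes "prime l"
  shows "\<exists>w\<in>int_adjoin z. poly (map_poly of_int p) z ^ l = poly (map_poly of_int p) (z ^ l) + of_nat l * w"
proof (induction p)
  case 0
  show ?case using assms by (intro bexI[of _ 0]) (auto simp: prime_gt_0_nat power_0_left)
next
  case (pCons c p)
  let ?P = "\<lambda>z :: complex. poly (map_poly of_int p) z"
  obtain w where w: "w \<in> int_adjoin z" "?P z ^ l = ?P (z ^ l) + of_nat l * w" using pCons.IH by blast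
  have "z * ?P z \<in> int_adjoin z" by (auto intro: int_adjoin_poly)
  then obtain w' where w': "w' \<in> int_adjoin z"
    "(of_int c + z * ?P z) ^ l = of_int c ^ l + (z * ?P z) ^ l + of_nat l * w'"
    using power_prime_add_mod[OF assms int_adjoin_of_int] by blast
  obtain d where "c ^ l - c = int l * d" using int_power_prime_mod[OF assms] by (auto elim: dvdE)
  hence "c ^ l = c + int l * d" by simp
  hence d: "of_int c ^ l = (of_int c + of_nat l * of_int d :: complex)"
    by (metis of_int_add of_int_mult of_int_of_nat_eq of_int_power)
  have "poly (map_poly of_int (pCons c p)) z ^ l =
      poly (map_poly of_int (pCons c p)) (z ^ l) + of_nat l * (of_int d + z ^ l * w + w')"
    using w w' d by (simp add: of_int_hom.map_poly_pCons_hom power_mult_distrib algebra_simps)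
  moreover have "of_int d + z ^ l * w + w' \<in> int_adjoin z"
    using w(1) w'(1) by (intro int_adjoin_add int_adjoin_mult int_adjoin_power) auto
  ultimately show ?case by blast
qed


section \<open>The Galois group of a cyclotomic field\<close>

lemma diff_one_mult_sum:
  fixes u :: complex
  shows "(u - 1) * (\<Sum>k<m. of_nat k * u ^ k) = of_nat m * u ^ m - (\<Sum>k<m. u ^ Suc k)"
  by (induction m) (simp_all add: algebra_simps)

text \<open>Summation by parts gives an explicit cofactor by which \<open>u - 1\<close> divides
  \<open>n\<close>. Hence differences of distinct \<open>n\<close>-th roots of unity divide
  \<open>n\<close> among the algebraic integers.\<close>

lemma root_of_unity_diff_dvd:
  fixes u :: complex
  assumes "u ^ n = 1" "u \<noteq> 1"
  shows "(u - 1) * (\<Sum>k<n. of_nat k * u ^ k) = of_nat n"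
proof -
  have "(\<Sum>k<n. u ^ Suc k) = 0"
    using assms by (simp add: sum_distrib_left[symmetric] geometric_sum)
  thus ?thesis using diff_one_mult_sum[of u n] assms by simp
qed

lemma algebraic_int_of_nat_divide:
  assumes "l > 0" "algebraic_int (w :: complex)" "of_nat m = of_nat l * w"
  shows "l dvd m"
proof -
  have "w = of_nat m / of_nat l" using assms by (simp add: field_simps)
  hence "w \<in> \<rat>" by auto
  hence "w \<in> \<int>" using rational_algebraic_int_is_int assms(2) by blast
  then obtain k where "w = of_int k" by (auto elim: Ints_cases)
  hence "(of_int (int m) :: complex) = of_int (int l * k)" using assms(3) by simp
  hence "int m = int l * k" by (simp only: of_int_eq_iff)
  thus ?thesis by (metis dvdI int_dvd_int_iff)
qed

locale cyclotomic = fixes n :: nat assumes n_positive: "n > 0"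

sublocale cyclotomic \<subseteq> sub_cyclotomic "\<rat>" n
proof (rule sub_cyclotomic.intro)
  show "complex_subfield \<rat>" by (rule complex_subfield_Rats)
  show "sub_cyclotomic_axioms \<rat> n"
    using n_positive complex_subfield.Rats_subset[OF cyclotomic_field_eq_adjoin(2)]
    by (simp add: sub_cyclotomic_axioms_def)
qed

lemma complex_poly_eq_prod_roots:
  fixes f :: "complex poly"
  assumes "lead_coeff f = 1" "card {z. poly f z = 0} = degree f"
  shows "f = (\<Prod>z | poly f z = 0. [:- z, 1:])"
proof -
  have f0: "f \<noteq> 0" using assms(1) by auto
  define A where "A = {z. poly f z = 0}"
  have fin: "finite A" unfolding A_def by (rule poly_roots_finite[OF f0])
  define g where "g = (\<Prod>z\<in>A. [:- z, 1:])"
  have deg_g: "degree g = card A" unfolding g_def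
    by (subst degree_prod_eq_sum_degree) auto
  have lead_g: "lead_coeff g = 1" unfolding g_def by (simp add: lead_coeff_prod)
  have "f = g"
  proof (rule ccontr)
    assume "f \<noteq> g"
    hence "f - g \<noteq> 0" by simp
    have "degree f > 0"
    proof (rule ccontr)
      assume "\<not> degree f > 0"
      hence d: "degree f = 0" "degree g = 0" using deg_g assms(2) by (auto simp: A_def)
      then obtain a b where "f = [:a:]" "g = [:b:]" by (metis degree_eq_zeroE)
      thus False using assms(1) lead_g \<open>f \<noteq> g\<close> by simp
    qed
    moreover have "degree (f - g) \<le> degree f"
      using deg_g assms(2) by (intro degree_diff_le) (auto simp: A_def)
    moreover have "coeff (f - g) (degree f) = 0"
      using assms lead_g deg_g by (simp add: A_def)
    ultimately have "degree (f - g) < degree f"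
      by (metis \<open>f - g \<noteq> 0\<close> leading_coeff_0_iff le_neq_implies_less)
    moreover have "A \<subseteq> {z. poly (f - g) z = 0}"
      using fin by (auto simp: A_def g_def poly_prod)
    hence "card A \<le> card {z. poly (f - g) z = 0}"
      by (intro card_mono poly_roots_finite \<open>f - g \<noteq> 0\<close>)
    ultimately show False
      using card_poly_roots_bound[OF \<open>f - g \<noteq> 0\<close>] assms(2) by (simp add: A_def)
  qed
  thus ?thesis by (simp add: g_def A_def)
qed

lemma algebraic_int_coeff_prod:
  assumes "\<And>z. z \<in> A \<Longrightarrow> algebraic_int (z :: complex)"
  shows "algebraic_int (coeff (\<Prod>z\<in>A. [:- z, 1:]) i)"
  using assms
proof (induction A arbitrary: i rule: infinite_finite_induct)
  case (insert x A)
  have "algebraic_int (coeff (\<Prod>z\<in>A. [:- z, 1:]) j)" for j using insert by auto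
  thus ?case using insert by (auto simp: coeff_pCons intro!: algebraic_int_plus_times algebraic_int_diff split: nat.splits)
qed (auto simp: coeff_1)

context cyclotomic
begin

text \<open>Irreducibility of the cyclotomic polynomial: if the minimal polynomial \<open>f\<close> of \<open>\<zeta>\<close> did not vanish
  at \<open>\<zeta> ^ l\<close>, then \<open>f(\<zeta> ^ l)\<close>, a product of differences of roots of unity, would divide a power of \<open>n\<close>;
  but it is congruent to \<open>f(\<zeta>) ^ l = 0\<close> modulo \<open>l\<close>.\<close>

lemma exists_aut_prime:
  assumes "prime l" "\<not> l dvd n"
  obtains \<sigma> where "\<sigma> \<in> auts L \<rat>" "\<sigma> \<zeta> = \<zeta> ^ l"
proof -
  have l: "l > 0" using assms(1) by (simp add: prime_gt_0_nat)
  have *: "poly (monom 1 n - 1) \<zeta> = 0" by (simp add: poly_monom)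
  obtain f where f: "f \<in> polys_over \<rat>" "lead_coeff f = 1" "poly f \<zeta> = 0"
    and dvd: "\<And>p. p \<in> polys_over \<rat> \<Longrightarrow> poly p \<zeta> = 0 \<Longrightarrow> f dvd p"
    by (rule minimal_polynomial[OF polys_over_unity[OF complex_subfield_axioms] unity_poly_nonzero[OF n_pos] *]) (rule that)
  have f0: "f \<noteq> 0" using f(2) by auto
  note roots = cyclotomic_poly_roots[OF n_pos dvd[OF polys_over_unity[OF complex_subfield_axioms] *] f0]
  note f_prod = complex_poly_eq_prod_roots[OF f(2) roots(1)]
  have root_pow: "\<exists>k. z = \<zeta> ^ k" if "poly f z = 0" for z
    using roots(3)[OF that] root_of_unity_iff[OF n_pos] by auto
  \<comment> \<open>The coefficients are rational and, as symmetric functions of roots of unity,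
    algebraic integers.\<close>
  have "coeff f i \<in> \<int>" for i
  proof -
    have "algebraic_int (coeff f i)"
      by (subst f_prod) (auto intro!: algebraic_int_coeff_prod algebraic_int_power dest!: root_pow)
    moreover have "coeff f i \<in> \<rat>" using f(1) by (auto simp: polys_over_def)
    ultimately show ?thesis by (rule rational_algebraic_int_is_int)
  qed
  then obtain g :: "int poly" where g: "f = map_poly of_int g"
    by (metis intpolyE)
  have "poly f (\<zeta> ^ l) = 0"
  proof (rule ccontr)
    assume nz: "poly f (\<zeta> ^ l) \<noteq> 0"
    obtain w where w: "w \<in> int_adjoin \<zeta>" "poly f \<zeta> ^ l = poly f (\<zeta> ^ l) + of_nat l * w"
      using frobenius_int_poly[OF assms(1), of \<zeta> g] g by auto
    define A where "A = {z. poly f z = 0}"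
    have fin: "finite A" unfolding A_def by (rule roots(2))
    have "\<exists>c. algebraic_int c \<and> (\<zeta> ^ l - z) * c = of_nat n" if zA: "z \<in> A" for z
    proof -
      obtain k where k: "z = \<zeta> ^ k" using root_pow zA by (auto simp: A_def)
      define u where "u = \<zeta> ^ l / z"
      have "u ^ n = 1" unfolding u_def k power_divide power_mult[symmetric]
        by (simp add: mult.commute[of _ n] power_mult)
      moreover have "u \<noteq> 1" using nz zA by (auto simp: u_def A_def)
      ultimately have e: "(u - 1) * (\<Sum>i<n. of_nat i * u ^ i) = of_nat n"
        by (rule root_of_unity_diff_dvd)
      obtain i where "u = \<zeta> ^ i" using \<open>u ^ n = 1\<close> root_of_unity_iff[OF n_pos] by auto
      moreover obtain j where j: "inverse z = \<zeta> ^ j"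
      proof -
        have "inverse z ^ n = 1" using roots(3)[of z] zA by (simp add: A_def power_inverse)
        thus ?thesis using root_of_unity_iff[OF n_pos] that by auto
      qed
      ultimately have "algebraic_int (\<zeta> ^ j * (\<Sum>i<n. of_nat i * u ^ i))"
        by (auto intro!: algebraic_int_plus_times algebraic_int_power algebraic_int_sum)
      moreover have "(\<zeta> ^ l - z) * (\<zeta> ^ j * (\<Sum>i<n. of_nat i * u ^ i)) = of_nat n"
        using e unfolding j[symmetric] u_def k by (simp add: field_simps)
      ultimately show ?thesis by blast
    qed
    then obtain c where c: "\<And>z. z \<in> A \<Longrightarrow> algebraic_int (c z) \<and> (\<zeta> ^ l - z) * c z = of_nat n" by metis
    have "poly f (\<zeta> ^ l) * prod c A = (\<Prod>z\<in>A. (\<zeta> ^ l - z) * c z)"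
      by (subst f_prod) (simp add: poly_prod prod.distrib A_def)
    also have "\<dots> = of_nat (n ^ card A)" using c by simp
    finally have prod_eq: "poly f (\<zeta> ^ l) * prod c A = of_nat (n ^ card A)" .
    have "of_nat (n ^ card A) = of_nat l * (- w * prod c A)"
    proof -
      have "poly f (\<zeta> ^ l) = - (of_nat l * w)"
        using w(2) f(3) l by (simp add: power_0_left eq_neg_iff_add_eq_0)
      thus ?thesis unfolding prod_eq[symmetric] by simp
    qed
    moreover have "algebraic_int (- w * prod c A)"
      using w(1) c by (intro algebraic_int_plus_times algebraic_int_minus algebraic_int_prod)
        (auto intro: int_adjoin_algebraic_int)
    ultimately have "l dvd n ^ card A" using algebraic_int_of_nat_divide[OF l] by blast
    thus False using assms prime_dvd_power by blast
  qed
  hence root: "poly p (\<zeta> ^ l) = 0" if "f dvd p" for p using that by (auto elim!: dvdE)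
  show thesis by (rule aut_of_root[of "\<zeta> ^ l"]) (blast intro: root dvd, rule that)
qed

text \<open>The automorphisms belonging to the prime factors of \<open>b\<close>, none of which
  divides \<open>n\<close>, are composed.\<close>

lemma exists_aut:
  assumes "coprime b n"
  obtains \<sigma> where "\<sigma> \<in> auts L \<rat>" "\<sigma> \<zeta> = \<zeta> ^ b"
proof -
  have "b > 0 \<Longrightarrow> \<exists>\<sigma>\<in>auts L \<rat>. \<sigma> \<zeta> = \<zeta> ^ b"
    using assms
  proof (induction b rule: less_induct)
    case (less b)
    show ?case
    proof (cases "b = 1")
      case True
      thus ?thesis using L.auts_one[OF F_subset] by (intro bexI[of _ "\<lambda>x\<in>L. x"]) auto
    next
      case False
      then obtain l where l: "prime l" "l dvd b" using prime_factor_nat by blast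
      then obtain c where c: "b = l * c" by (auto elim: dvdE)
      have c': "c < b" "c > 0" "coprime c n" "coprime l n"
        using c less.prems l(1) prime_gt_1_nat[of l] by auto
      then obtain \<sigma> where \<sigma>: "\<sigma> \<in> auts L \<rat>" "\<sigma> \<zeta> = \<zeta> ^ c" using less.IH by blast
      have "\<not> l dvd n" using c'(4) l(1) by (metis coprime_common_divisor dvd_refl not_prime_unit)
      then obtain \<tau> where \<tau>: "\<tau> \<in> auts L \<rat>" "\<tau> \<zeta> = \<zeta> ^ l" using exists_aut_prime[OF l(1)] by blast
      have "compose L \<tau> \<sigma> \<zeta> = \<zeta> ^ b"
        using \<sigma> \<tau> by (simp add: compose_def c L.aut_power[OF \<tau>(1)] power_mult)
      thus ?thesis using L.auts_compose[OF \<tau>(1) \<sigma>(1) F_subset] by blast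
    qed
  qed
  \<comment> \<open>\<open>coprime 0 n\<close> forces \<open>n = 1\<close>, where
    \<open>\<zeta> = 1\<close>.\<close>
  moreover have "\<exists>\<sigma>\<in>auts L \<rat>. \<sigma> \<zeta> = \<zeta> ^ b" if "b = 0"
    using assms that L.auts_one[OF F_subset] L.one by (intro bexI[of _ "\<lambda>x\<in>L. x"]) auto
  ultimately show thesis using that by blast
qed

lemma auts_commute:
  assumes "\<sigma> \<in> auts L \<rat>" "\<tau> \<in> auts L \<rat>" "x \<in> L"
  shows "\<sigma> (\<tau> x) = \<tau> (\<sigma> x)"
proof -
  obtain b c where bc: "\<sigma> \<zeta> = \<zeta> ^ b" "\<tau> \<zeta> = \<zeta> ^ c" using aut_zeta assms(1,2) by metis
  have "compose L \<sigma> \<tau> = compose L \<tau> \<sigma>"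
  proof (rule aut_eqI)
    show "compose L \<sigma> \<tau> \<zeta> = compose L \<tau> \<sigma> \<zeta>"
      by (simp add: compose_eq bc L.aut_power[OF assms(1)] L.aut_power[OF assms(2)]
          power_mult[symmetric] mult.commute)
  qed (rule L.auts_compose[OF _ _ F_subset]; fact)+
  thus ?thesis using assms(3) by (metis compose_eq)
qed

text \<open>The Fourier coefficients of an algebraic integer are rational algebraic integers. So
  \<open>n\<close> is a common denominator, and only saturation at primes is left for the ring of
  integers.\<close>

lemma n_mult_integer:
  assumes "x \<in> L" "algebraic_int x"
  shows "of_nat n * x \<in> int_adjoin \<zeta>"
proof -
  have "Tr (x / \<zeta> ^ k) \<in> \<int>" for k
  proof (rule rational_algebraic_int_is_int)
    have "(1 / \<zeta> ^ k) ^ n = 1" by (simp add: power_divide power_mult[symmetric] mult.commute[of k])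
        (simp add: power_mult)
    then obtain j where "1 / \<zeta> ^ k = \<zeta> ^ j" using root_of_unity_iff[OF n_pos] by auto
    hence "x / \<zeta> ^ k = x * \<zeta> ^ j" by (metis mult.right_neutral times_divide_eq_right)
    thus "algebraic_int (Tr (x / \<zeta> ^ k))"
      using assms by (auto intro!: Tr_algebraic_int algebraic_int_plus_times algebraic_int_power)
    show "Tr (x / \<zeta> ^ k) \<in> \<rat>" using assms by (auto intro: Tr_in_F)
  qed
  thus ?thesis unfolding fourier_inversion[OF assms(1)]
    by (intro int_adjoin_sum int_adjoin_mult int_adjoin_power int_adjoin_gen) (metis Ints_cases int_adjoin_of_int)
qed

end

section \<open>The ring of integers of a cyclotomic field\<close>

lemma cyclotomic_intro: "n > 0 \<Longrightarrow> cyclotomic n"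
  by (simp add: cyclotomic_def)

lemma frobenius_iterate:
  fixes P :: "int poly"
  assumes "prime p"
  shows "\<exists>w\<in>int_adjoin z. poly (map_poly of_int P) z ^ (p ^ t) = poly (map_poly of_int P) (z ^ (p ^ t)) + of_nat p * w"
proof (induction t)
  case 0
  show ?case by (intro bexI[of _ 0]) auto
next
  case (Suc t)
  let ?P = "\<lambda>z :: complex. poly (map_poly of_int P) z"
  have p: "p > 0" using assms by (simp add: prime_gt_0_nat)
  from Suc obtain w where w: "w \<in> int_adjoin z" "?P z ^ (p ^ t) = ?P (z ^ (p ^ t)) + of_nat p * w" by blast
  have Pz: "?P (z ^ (p ^ t)) \<in> int_adjoin z" by (intro int_adjoin_poly int_adjoin_power int_adjoin_gen)
  have "of_nat p * w \<in> int_adjoin z" using w(1) by auto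
  then obtain w1 where w1: "w1 \<in> int_adjoin z"
    "(?P (z ^ (p ^ t)) + of_nat p * w) ^ p = ?P (z ^ (p ^ t)) ^ p + (of_nat p * w) ^ p + of_nat p * w1"
    using power_prime_add_mod[OF assms Pz] by blast
  obtain w2 where w2: "w2 \<in> int_adjoin (z ^ (p ^ t))"
    "?P (z ^ (p ^ t)) ^ p = ?P ((z ^ (p ^ t)) ^ p) + of_nat p * w2"
    using frobenius_int_poly[OF assms, of "z ^ (p ^ t)" P] by blast
  have w2z: "w2 \<in> int_adjoin z" by (rule int_adjoin_trans[OF _ w2(1)]) auto
  have e: "(of_nat p * w) ^ p = of_nat p * (w * (of_nat p * w) ^ (p - 1))"
    using p by (cases p) auto
  have "?P z ^ (p ^ Suc t) = (?P z ^ (p ^ t)) ^ p" by (simp add: power_mult[symmetric] mult.commute)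
  also have "\<dots> = ?P (z ^ (p ^ Suc t)) + of_nat p * (w2 + w * (of_nat p * w) ^ (p - 1) + w1)"
    unfolding w(2) w1(2) w2(2) e by (simp add: power_mult[symmetric] mult.commute algebra_simps)
  finally show ?case using w(1) w1(1) w2z
    by (intro bexI[of _ "w2 + w * (of_nat p * w) ^ (p - 1) + w1"]) (auto intro!: int_adjoin_add int_adjoin_mult int_adjoin_power)
qed

text \<open>By Euler's theorem the iterated Frobenius map fixes \<open>zeta m\<close>. The factor
  \<open>s\<close> makes the exponent as large as an estimate may need.\<close>

lemma frobenius_fixed:
  assumes "prime p" "\<not> p dvd m" "m > 0" "x \<in> int_adjoin (zeta m)"
  shows "\<exists>w\<in>int_adjoin (zeta m). x ^ (p ^ (totient m * s)) = x + of_nat p * w"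
proof -
  obtain P :: "int poly" where P: "x = poly (map_poly of_int P) (zeta m)" using assms(4) by (auto simp: int_adjoin_def)
  have "coprime p m" using assms by (simp add: prime_imp_coprime_nat)
  hence "[(p ^ totient m) ^ s = 1 ^ s] (mod m)" by (intro cong_pow euler_theorem)
  hence "zeta m ^ (p ^ (totient m * s)) = zeta m ^ 1"
    by (subst zeta_power_eq_iff[OF assms(3)]) (simp add: power_mult)
  thus ?thesis using frobenius_iterate[OF assms(1), of "zeta m" P "totient m * s"] P by simp
qed

text \<open>Cyclotomic units: the quotient is a geometric sum, and since \<open>zeta N\<close> is in
  turn a power of \<open>zeta N ^ k\<close>, so is its inverse.\<close>

lemma one_minus_zeta_power_unit:
  assumes "N > 1" "coprime k N"
  obtains u v where "u \<in> int_adjoin (zeta N)" "v \<in> int_adjoin (zeta N)" "u * v = 1"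
    "1 - zeta N ^ k = (1 - zeta N) * u"
proof -
  have N: "N > 0" using assms(1) by simp
  from cong_solve_coprime_nat[OF assms(2)] obtain k' where "[k * k' = 1] (mod N)" by auto
  hence k': "(zeta N ^ k) ^ k' = zeta N"
    unfolding power_mult[symmetric] using zeta_power_eq_iff[OF N, of "k * k'" 1] by simp
  have "zeta N \<noteq> 1" using zeta_power_eq_1_iff[OF N, of 1] assms(1) by simp
  define u where "u = (\<Sum>j<k. zeta N ^ j)"
  define v where "v = (\<Sum>j<k'. (zeta N ^ k) ^ j)"
  have u: "1 - zeta N ^ k = (1 - zeta N) * u" unfolding u_def by (rule one_diff_power_eq)
  have v: "1 - zeta N = (1 - zeta N ^ k) * v" using one_diff_power_eq[of "zeta N ^ k" k'] k' by (simp add: v_def)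
  have "(1 - zeta N) * (u * v) = (1 - zeta N) * 1" using v unfolding u by (metis mult.assoc mult.right_neutral)
  hence "u * v = 1" using \<open>zeta N \<noteq> 1\<close> by simp
  moreover have "u \<in> int_adjoin (zeta N)" "v \<in> int_adjoin (zeta N)"
    unfolding u_def v_def by (auto intro!: int_adjoin_sum int_adjoin_power)
  ultimately show thesis using that u by blast
qed

text \<open>Evaluating \<open>1 + X ^ M + ... + X ^ (M * (p - 1))\<close> at 1 writes
  \<open>p\<close> as the product of \<open>1 - z\<close> over the primitive roots of unity
  \<open>z\<close> of order \<open>p ^ a\<close>, and each factor is a unit times
  \<open>1 - \<xi>\<close>.\<close>

lemma prime_power_cyclotomic_factor:
  assumes "prime p" "a > 0"
  defines "\<xi> \<equiv> zeta (p ^ a)"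
  obtains U V where "U \<in> int_adjoin \<xi>" "V \<in> int_adjoin \<xi>" "U * V = 1"
    "of_nat p = (1 - \<xi>) ^ (totient (p ^ a)) * U"
proof -
  have p: "p > 1" "p > 0" using prime_gt_1_nat[OF assms(1)] by simp_all
  define M where "M = p ^ (a - 1)"
  have M: "p ^ a = p * M" "M > 0" using power_minus_mult[OF assms(2), of p] p by (simp_all add: M_def mult.commute)
  have N: "p ^ a > 0" using p by simp
  define \<Phi> where "\<Phi> = (\<Sum>j<p. monom (1::complex) (M * j))"
  have \<Phi>_poly: "poly \<Phi> z = (\<Sum>j<p. (z ^ M) ^ j)" for z
    by (simp add: \<Phi>_def poly_sum poly_monom power_mult)
  have "\<Phi> * (monom 1 M - 1) = monom 1 (p ^ a) - 1"
  proof -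
    have "\<Phi> = (\<Sum>j<p. monom 1 M ^ j)" by (simp add: \<Phi>_def monom_power)
    hence "monom 1 M ^ p - 1 = (monom 1 M - 1) * \<Phi>" by (metis power_diff_1_eq)
    thus ?thesis by (simp add: monom_power M(1) mult.commute)
  qed
  hence dvd: "\<Phi> dvd monom 1 (p ^ a) - 1" by (metis dvd_triv_left)
  have \<Phi>1: "poly \<Phi> 1 = of_nat p" by (simp add: \<Phi>_poly)
  hence \<Phi>0: "\<Phi> \<noteq> 0" using p by auto
  have cf: "coeff \<Phi> i = (\<Sum>j<p. if M * j = i then 1 else 0)" for i by (simp add: \<Phi>_def coeff_sum)
  have "coeff \<Phi> (M * (p - 1)) = (\<Sum>j<p. if j = p - 1 then 1 else 0)"
    unfolding cf using M(2) by (intro sum.cong refl) auto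
  hence top: "coeff \<Phi> (M * (p - 1)) = 1" using p by simp
  have "coeff \<Phi> i = 0" if "i > M * (p - 1)" for i
    unfolding cf
  proof (rule sum.neutral, rule ballI)
    fix j assume "j \<in> {..<p}"
    hence "M * j \<le> M * (p - 1)" by (intro mult_left_mono) auto
    thus "(if M * j = i then 1 else 0) = (0::complex)" using that by auto
  qed
  hence deg: "degree \<Phi> = M * (p - 1)"
    using top by (metis le_degree degree_le order_antisym zero_neq_one)
  hence tot: "degree \<Phi> = totient (p ^ a)" using assms(1,2) by (simp add: totient_prime_power M_def)
  note roots = cyclotomic_poly_roots[OF N dvd \<Phi>0]
  define A where "A = {z. poly \<Phi> z = 0}"
  have "lead_coeff \<Phi> = 1" using top deg by simp
  hence "poly \<Phi> 1 = poly (\<Prod>z\<in>A. [:- z, 1:]) 1"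
    unfolding A_def by (intro arg_cong[of _ _ "\<lambda>f. poly f 1"] complex_poly_eq_prod_roots roots(1))
  hence prod: "of_nat p = (\<Prod>z\<in>A. 1 - z)" by (simp add: \<Phi>1 poly_prod)
  have "\<exists>u v. u \<in> int_adjoin \<xi> \<and> v \<in> int_adjoin \<xi> \<and> u * v = 1 \<and> 1 - z = (1 - \<xi>) * u" if z: "z \<in> A" for z
  proof -
    have "z ^ (p ^ a) = 1" using roots(3) z by (simp add: A_def)
    then obtain k where k: "z = \<xi> ^ k" unfolding \<xi>_def using root_of_unity_iff[OF N] by auto
    \<comment> \<open>If \<open>z ^ M\<close> were 1, then \<open>\<Phi>\<close> would take the
      value \<open>p\<close> at \<open>z\<close> instead of 0.\<close>
    have "z ^ M \<noteq> 1" using z p by (auto simp: A_def \<Phi>_poly)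
    hence "\<not> p ^ a dvd k * M" unfolding k \<xi>_def power_mult[symmetric] by (simp add: zeta_power_eq_1_iff[OF N])
    hence "\<not> p dvd k" by (auto simp: M(1) M(2))
    hence "coprime k (p ^ a)" using assms(1) by (metis coprime_commute coprime_power_right_iff prime_imp_coprime_nat)
    thus ?thesis using one_minus_zeta_power_unit[of "p ^ a" k] p assms(2) unfolding k \<xi>_def
      by (metis one_less_power)
  qed
  then obtain u v where uv: "\<And>z. z \<in> A \<Longrightarrow> u z \<in> int_adjoin \<xi>" "\<And>z. z \<in> A \<Longrightarrow> v z \<in> int_adjoin \<xi>"
    "\<And>z. z \<in> A \<Longrightarrow> u z * v z = 1" "\<And>z. z \<in> A \<Longrightarrow> 1 - z = (1 - \<xi>) * u z" by metis
  have int_prod: "(\<And>z. z \<in> A \<Longrightarrow> g z \<in> int_adjoin \<xi>) \<Longrightarrow> prod g A \<in> int_adjoin \<xi>" for g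
    by (induction A rule: infinite_finite_induct) auto
  show thesis
  proof (rule that[of "prod u A" "prod v A"])
    show "prod u A * prod v A = 1" using uv(3) by (simp add: prod.distrib[symmetric])
    have "of_nat p = (\<Prod>z\<in>A. (1 - \<xi>) * u z)" unfolding prod using uv(4) by (intro prod.cong) auto
    thus "of_nat p = (1 - \<xi>) ^ totient (p ^ a) * prod u A"
      using roots(1) by (simp add: prod.distrib A_def[symmetric] tot)
  qed (use uv int_prod in auto)
qed

text \<open>The element \<open>\<theta>\<close> generates the product of the primes above \<open>p\<close> in the ring generated
  by \<open>zeta n\<close>; it is \<open>p\<close> itself in the unramified case \<open>a = 0\<close>.\<close>

locale prime_split =
  fixes n p a m :: nat
  assumes prime_p: "prime p" and n_eq: "n = p ^ a * m" and p_m: "\<not> p dvd m" and m_pos: "m > 0"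
begin

definition \<xi> where "\<xi> = zeta (p ^ a)"
definition \<theta> where "\<theta> = (if a = 0 then of_nat p else 1 - \<xi>)"
text \<open>The ramification index of \<open>p\<close> in \<open>L\<close>: by
  \<open>p_theta\<close>, \<open>p\<close> is a unit times \<open>\<theta> ^ q\<close>. It is 1 for
  \<open>a = 0\<close>.\<close>

definition q where "q = totient (p ^ a)"

lemma p_pos: "p > 0" "p > 1" using prime_gt_1_nat[OF prime_p] by simp_all

sublocale cyclotomic n
  by (rule cyclotomic_intro) (use p_pos m_pos in \<open>simp add: n_eq\<close>)

sublocale M: cyclotomic m by (rule cyclotomic_intro) (rule m_pos)

lemma q_pos: "q > 0" using p_pos by (simp add: q_def)

lemma xi_eq: "\<xi> = \<zeta> ^ m" unfolding \<xi>_def n_eq by (rule zeta_mult_power[OF m_pos, symmetric])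

lemma zeta_m_eq: "zeta m = \<zeta> ^ (p ^ a)"
  unfolding n_eq mult.commute[of _ m] by (rule zeta_mult_power[symmetric]) (use p_pos in simp)

lemma int_adjoin_zeta_m: "x \<in> int_adjoin (zeta m) \<Longrightarrow> x \<in> int_adjoin \<zeta>"
  by (rule int_adjoin_trans[of "zeta m"]) (auto simp: zeta_m_eq)

lemma int_adjoin_xi: "x \<in> int_adjoin \<xi> \<Longrightarrow> x \<in> int_adjoin \<zeta>"
  by (rule int_adjoin_trans[of \<xi>]) (auto simp: xi_eq)

lemma theta_int: "\<theta> \<in> int_adjoin \<zeta>"
  unfolding \<theta>_def by (auto intro!: int_adjoin_diff int_adjoin_xi)

lemma xi_neq_1: "a > 0 \<Longrightarrow> \<xi> \<noteq> 1"
  using zeta_power_eq_1_iff[of "p ^ a" 1] p_pos unfolding \<xi>_def by (simp add: nat_dvd_1_iff_1)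

lemma theta_nonzero: "\<theta> \<noteq> 0"
  using xi_neq_1 p_pos by (auto simp: \<theta>_def)

lemma p_theta:
  obtains U V where "U \<in> int_adjoin \<zeta>" "V \<in> int_adjoin \<zeta>" "U * V = 1" "of_nat p = \<theta> ^ q * U"
proof (cases "a = 0")
  case True
  hence "\<theta> = of_nat p" "q = 1" unfolding \<theta>_def q_def by simp_all
  thus ?thesis using that[of 1 1] by simp
next
  case False
  then obtain U V where "U \<in> int_adjoin \<xi>" "V \<in> int_adjoin \<xi>" "U * V = 1"
    "of_nat p = (1 - \<xi>) ^ totient (p ^ a) * U"
    using prime_power_cyclotomic_factor[OF prime_p, of a] unfolding \<xi>_def by blast
  thus ?thesis using that[of U V] False by (auto simp: \<theta>_def q_def int_adjoin_xi)
qed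

lemma zeta_decompose: obtains s t where "\<zeta> = zeta m ^ s * \<xi> ^ t"
proof -
  have cop: "coprime (p ^ a) m" using prime_p p_m by (simp add: prime_imp_coprime_nat)
  obtain s where s: "[p ^ a * s = 1] (mod m)" using cong_solve_coprime_nat[OF cop] by auto
  obtain t where t: "[m * t = 1] (mod p ^ a)" using cong_solve_coprime_nat[of m "p ^ a"] cop by (auto simp: coprime_commute)
  have "[p ^ a * s + m * t = 1 + 0] (mod m)" by (rule cong_add[OF s]) (simp add: cong_0_iff)
  moreover have "[p ^ a * s + m * t = 0 + 1] (mod p ^ a)" by (rule cong_add[OF _ t]) (simp add: cong_0_iff)
  ultimately have "[p ^ a * s + m * t = 1] (mod n)"
    unfolding n_eq using cop by (simp add: coprime_cong_mult_nat)
  hence "\<zeta> ^ (p ^ a * s + m * t) = \<zeta>" using zeta_power_eq_iff[OF n_pos, of _ 1] by simp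
  thus thesis using that[of s t] by (simp add: power_add power_mult zeta_m_eq xi_eq)
qed

text \<open>Modulo \<open>\<theta>\<close> the root \<open>\<xi>\<close> becomes 1, so
  \<open>\<zeta>\<close> can be replaced by its prime-to-\<open>p\<close> part
  \<open>zeta m ^ s\<close>. For \<open>a = 0\<close> there is nothing to split, as
  \<open>m = n\<close>.\<close>

lemma mod_theta_decompose:
  assumes "x \<in> int_adjoin \<zeta>"
  obtains b w where "b \<in> int_adjoin (zeta m)" "w \<in> int_adjoin \<zeta>" "x = b + \<theta> * w"
proof (cases "a = 0")
  case True
  thus ?thesis using that[of x 0] assms by (simp add: n_eq)
next
  case False
  obtain s t where st: "\<zeta> = zeta m ^ s * \<xi> ^ t" by (rule zeta_decompose)
  define w0 where "w0 = - (zeta m ^ s * (\<Sum>j<t. \<xi> ^ j))"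
  have w0: "w0 \<in> int_adjoin \<zeta>" unfolding w0_def
    by (intro int_adjoin_uminus int_adjoin_mult int_adjoin_sum int_adjoin_power) (auto simp: zeta_m_eq xi_eq)
  have "\<theta> * w0 = - (zeta m ^ s * (1 - \<xi> ^ t))"
    using False by (simp add: w0_def \<theta>_def one_diff_power_eq[of \<xi> t])
  hence z: "\<zeta> = zeta m ^ s + \<theta> * w0" by (subst st) (simp add: algebra_simps)
  have zs: "zeta m ^ s \<in> int_adjoin (zeta m)" by auto
  obtain P :: "int poly" where P: "x = poly (map_poly of_int P) \<zeta>" using assms by (auto simp: int_adjoin_def)
  have "\<exists>b\<in>int_adjoin (zeta m). \<exists>w\<in>int_adjoin \<zeta>. poly (map_poly of_int P) \<zeta> = b + \<theta> * w"
  proof (induction P)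
    case 0
    show ?case by (intro bexI[of _ 0]) auto
  next
    case (pCons c P)
    then obtain b w where bw: "b \<in> int_adjoin (zeta m)" "w \<in> int_adjoin \<zeta>"
      "poly (map_poly of_int P) \<zeta> = b + \<theta> * w" by blast
    have "poly (map_poly of_int (pCons c P)) \<zeta> = of_int c + \<zeta> * (b + \<theta> * w)"
      by (simp add: of_int_hom.map_poly_pCons_hom bw(3))
    also have "\<dots> = (of_int c + zeta m ^ s * b) + \<theta> * (w0 * b + \<zeta> * w)"
    proof -
      have "\<zeta> * b = zeta m ^ s * b + \<theta> * (w0 * b)" by (subst z) (simp add: algebra_simps)
      thus ?thesis by (simp add: algebra_simps)
    qed
    finally show ?case using bw w0 zs int_adjoin_zeta_m[OF bw(1)]
      by (intro bexI[of _ "of_int c + zeta m ^ s * b"] bexI[of _ "w0 * b + \<zeta> * w"]) auto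
  qed
  thus ?thesis using P that by blast
qed

lemma power_theta_mod:
  assumes "b \<in> int_adjoin \<zeta>" "w \<in> int_adjoin \<zeta>"
  shows "\<exists>w'\<in>int_adjoin \<zeta>. (b + \<theta> * w) ^ k = b ^ k + \<theta> * w'"
proof (induction k)
  case 0
  show ?case by (intro bexI[of _ 0]) auto
next
  case (Suc k)
  then obtain w' where "w' \<in> int_adjoin \<zeta>" "(b + \<theta> * w) ^ k = b ^ k + \<theta> * w'" by blast
  thus ?case using assms theta_int
    by (intro bexI[of _ "b * w' + w * (b ^ k + \<theta> * w')"]) (auto simp: algebra_simps)
qed

lemma p_theta_dvd: obtains p' where "p' \<in> int_adjoin \<zeta>" "of_nat p = \<theta> * p'"
proof -
  obtain U V where "U \<in> int_adjoin \<zeta>" "V \<in> int_adjoin \<zeta>" "U * V = 1" "of_nat p = \<theta> ^ q * U" by (rule p_theta)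
  thus thesis using that[of "\<theta> ^ (q - 1) * U"] power_minus_mult[OF q_pos, of \<theta>] theta_int
    by (auto simp: mult_ac)
qed

text \<open>Every element of the residue ring modulo \<open>\<theta>\<close> satisfies
  \<open>x ^ N = x\<close> for a suitable power \<open>N\<close> of \<open>p\<close>. This later
  supplies inverses modulo \<open>P\<close> and multipliers outside \<open>P\<close>.\<close>

lemma frobenius_theta:
  assumes "x \<in> int_adjoin \<zeta>"
  shows "\<exists>w\<in>int_adjoin \<zeta>. x ^ (p ^ (totient m * s)) = x + \<theta> * w"
proof -
  obtain b w where bw: "b \<in> int_adjoin (zeta m)" "w \<in> int_adjoin \<zeta>" "x = b + \<theta> * w"
    using mod_theta_decompose[OF assms] .
  note b = int_adjoin_zeta_m[OF bw(1)]
  obtain w1 where w1: "w1 \<in> int_adjoin \<zeta>" "x ^ (p ^ (totient m * s)) = b ^ (p ^ (totient m * s)) + \<theta> * w1"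
    using power_theta_mod[OF b bw(2)] bw(3) by blast
  obtain w2 where w2: "w2 \<in> int_adjoin (zeta m)" "b ^ (p ^ (totient m * s)) = b + of_nat p * w2"
    using frobenius_fixed[OF prime_p p_m m_pos bw(1)] by blast
  obtain p' where p': "p' \<in> int_adjoin \<zeta>" "of_nat p = \<theta> * p'" by (rule p_theta_dvd)
  show ?thesis using w1 w2 p' bw int_adjoin_zeta_m[OF w2(1)]
    by (intro bexI[of _ "w1 + p' * w2 - w"]) (auto simp: algebra_simps)
qed

text \<open>\<open>m * y\<close> lies in the ring because \<open>m\<close> is a common denominator,
  \<open>p * y\<close> by hypothesis, and \<open>m\<close> and \<open>p\<close> are coprime.\<close>

lemma saturated_zeta_m:
  assumes "of_nat p * y \<in> int_adjoin (zeta m)" "algebraic_int y"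
  shows "y \<in> int_adjoin (zeta m)"
proof -
  have int_L: "int_adjoin (zeta m) \<subseteq> M.L"
    by (auto simp: int_adjoin_def poly_altdef intro!: M.L.sum M.L.mult M.L.power)
  have "y = (of_nat p * y) / of_nat p" using p_pos by simp
  also have "\<dots> \<in> M.L" using assms(1) int_L by blast
  finally have my: "of_nat m * y \<in> int_adjoin (zeta m)" by (intro M.n_mult_integer assms(2))
  have "coprime (int m) (int p)" using prime_imp_coprime_nat[OF prime_p p_m] by (simp add: coprime_commute)
  then obtain u v where "u * int m + v * int p = 1" using bezout_int[of "int m" "int p"] by auto
  hence "(of_int (u * int m + v * int p) :: complex) = 1" by simp
  hence "y = of_int u * (of_nat m * y) + of_int v * (of_nat p * y)" by (simp add: algebra_simps) (metis distrib_left mult.commute mult.right_neutral)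
  also have "\<dots> \<in> int_adjoin (zeta m)" using my assms(1) by auto
  finally show ?thesis .
qed

text \<open>Modulo \<open>\<theta>\<close> every element comes from the prime-to-\<open>p\<close> part, where a power of the Frobenius map is
  the identity modulo \<open>p\<close>; so an element divisible by \<open>\<theta>\<close> there is divisible by \<open>p\<close>.\<close>

lemma saturated_theta:
  assumes "\<theta> * y \<in> int_adjoin \<zeta>" "algebraic_int y"
  shows "y \<in> int_adjoin \<zeta>"
proof -
  obtain b w where bw: "b \<in> int_adjoin (zeta m)" "w \<in> int_adjoin \<zeta>" "\<theta> * y = b + \<theta> * w"
    using mod_theta_decompose[OF assms(1)] .
  obtain U V where UV: "U \<in> int_adjoin \<zeta>" "V \<in> int_adjoin \<zeta>" "U * V = 1" "of_nat p = \<theta> ^ q * U" by (rule p_theta)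
  \<comment> \<open>A Frobenius power that is at least \<open>q\<close>, so that
    \<open>\<theta> ^ q\<close>, and with it \<open>p\<close>, divides \<open>b ^ N\<close>.\<close>
  define N where "N = p ^ (totient m * q)"
  have "q \<le> p ^ q" using p_pos(2) by (simp add: order.strict_implies_order)
  also have "p ^ q \<le> N" unfolding N_def using p_pos(2) m_pos
    by (intro power_increasing) (simp_all add: Suc_le_eq)
  finally have qN: "q \<le> N" .
  obtain w2 where w2: "w2 \<in> int_adjoin (zeta m)" "b ^ N = b + of_nat p * w2"
    unfolding N_def using frobenius_fixed[OF prime_p p_m m_pos bw(1)] by blast
  have b: "b = \<theta> * (y - w)" using bw(3) by (simp add: algebra_simps)
  have int: "algebraic_int x" if "x \<in> int_adjoin \<zeta>" for x using int_adjoin_algebraic_int that by blast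
  define c where "c = V * \<theta> ^ (N - q) * (y - w) ^ N - w2"
  have "b ^ N = of_nat p * (V * \<theta> ^ (N - q) * (y - w) ^ N)"
  proof -
    have "b ^ N = \<theta> ^ q * \<theta> ^ (N - q) * (y - w) ^ N" by (simp add: b power_mult_distrib power_add[symmetric] qN)
    also have "\<theta> ^ q = of_nat p * V" using UV(3,4) by (simp add: mult.assoc)
    finally show ?thesis by (simp add: mult_ac)
  qed
  hence bc: "b = of_nat p * c" using w2(2) by (simp add: c_def algebra_simps)
  have "algebraic_int c" unfolding c_def using UV(2) bw(2) assms(2) theta_int int_adjoin_zeta_m[OF w2(1)] int
    by (intro algebraic_int_diff algebraic_int_plus_times algebraic_int_power) blast+
  moreover have "of_nat p * c \<in> int_adjoin (zeta m)" using bw(1) bc by metis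
  ultimately have c: "c \<in> int_adjoin (zeta m)" by (rule saturated_zeta_m[rotated])
  have "\<theta> * (y - w) = \<theta> * (\<theta> ^ (q - 1) * U * c)"
    using b bc UV(4) power_minus_mult[OF q_pos, of \<theta>] by (simp add: mult_ac)
  hence "y - w = \<theta> ^ (q - 1) * U * c" using theta_nonzero by simp
  hence "y = \<theta> ^ (q - 1) * U * c + w" by (simp add: algebra_simps)
  thus ?thesis using UV(1) bw(2) theta_int int_adjoin_zeta_m[OF c] by auto
qed

text \<open>\<open>p\<close> is a unit times \<open>\<theta> ^ q\<close>, and the factors
  \<open>\<theta>\<close> are removed one at a time.\<close>

lemma saturated_p:
  assumes "of_nat p * y \<in> int_adjoin \<zeta>" "algebraic_int y"
  shows "y \<in> int_adjoin \<zeta>"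
proof -
  obtain U V where UV: "U \<in> int_adjoin \<zeta>" "V \<in> int_adjoin \<zeta>" "U * V = 1" "of_nat p = \<theta> ^ q * U" by (rule p_theta)
  have int: "algebraic_int x" if "x \<in> int_adjoin \<zeta>" for x using int_adjoin_algebraic_int that by blast
  have *: "z \<in> int_adjoin \<zeta>" if "\<theta> ^ k * z \<in> int_adjoin \<zeta>" "algebraic_int z" for k z
    using that(1)
  proof (induction k)
    case (Suc k)
    have "algebraic_int (\<theta> ^ k * z)" using theta_int int that(2) by (intro algebraic_int_plus_times algebraic_int_power) auto
    hence "\<theta> ^ k * z \<in> int_adjoin \<zeta>" using Suc.prems saturated_theta[of "\<theta> ^ k * z"] by (simp add: mult.assoc)
    thus ?case by (rule Suc.IH)
  qed simp
  have "V * (of_nat p * y) = \<theta> ^ q * y" using UV(3,4) by (simp add: mult_ac)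
  hence "\<theta> ^ q * y \<in> int_adjoin \<zeta>" using UV(2) assms(1) by (metis int_adjoin_mult)
  thus ?thesis using * assms(2) by blast
qed

end

lemma prime_split_exists:
  assumes "prime p" "n > 0"
  obtains m where "prime_split n p (multiplicity p n) m"
proof -
  obtain m where "n = p ^ multiplicity p n * m" "\<not> p dvd m"
    using multiplicity_decompose'[of n p] assms by (auto simp: prime_nat_iff)
  thus thesis using that[of m] assms by (auto simp: prime_split_def intro: gr0I)
qed

text \<open>The common denominator \<open>n\<close> is stripped of its prime factors one by one,
  each by saturation at that prime.\<close>

theorem cyclotomic_integers:
  assumes "n > 0"
  shows "\<O> (cyclotomic_field n) = int_adjoin (zeta n)"
proof
  interpret cyclotomic n by (rule cyclotomic_intro[OF assms])
  show "int_adjoin \<zeta> \<subseteq> \<O> L"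
    using int_adjoin_algebraic_int[of \<zeta>]
    by (auto simp: ring_of_integers_def int_adjoin_def poly_altdef intro!: L.sum L.mult L.power)
  have *: "y \<in> int_adjoin \<zeta>" if "k > 0" "of_nat k * y \<in> int_adjoin \<zeta>" "algebraic_int y" for k y
    using that
  proof (induction k rule: less_induct)
    case (less k)
    show ?case
    proof (cases "k = 1")
      case False
      then obtain l where l: "prime l" "l dvd k" using prime_factor_nat by blast
      then obtain c where c: "k = l * c" by (auto elim: dvdE)
      obtain m where "prime_split n l (multiplicity l n) m" using prime_split_exists[OF l(1) assms] .
      then interpret S: prime_split n l "multiplicity l n" m .
      have "of_nat c * y \<in> int_adjoin \<zeta>"
        using S.saturated_p[of "of_nat c * y"] less.prems by (simp add: c mult.assoc algebraic_int_plus_times(2))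
      moreover have "c < k" "c > 0" using c less.prems(1) l(1) prime_gt_1_nat[of l] by auto
      ultimately show ?thesis using less by blast
    qed (use less in simp)
  qed
  show "\<O> L \<subseteq> int_adjoin \<zeta>"
    using *[OF n_pos n_mult_integer] by (auto simp: ring_of_integers_def)
qed

section \<open>Prime ideals of rings of integers\<close>

context complex_subfield
begin

lemma integers_closed [intro]:
  "x \<in> \<O> F \<Longrightarrow> y \<in> \<O> F \<Longrightarrow> x + y \<in> \<O> F" "x \<in> \<O> F \<Longrightarrow> y \<in> \<O> F \<Longrightarrow> x * y \<in> \<O> F"
  "x \<in> \<O> F \<Longrightarrow> y \<in> \<O> F \<Longrightarrow> x - y \<in> \<O> F" "x \<in> \<O> F \<Longrightarrow> - x \<in> \<O> F" "x \<in> \<O> F \<Longrightarrow> x ^ k \<in> \<O> F"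
  by (auto simp: ring_of_integers_def algebraic_int_plus_times algebraic_int_diff algebraic_int_power)

lemma integers_nums [simp, intro]: "0 \<in> \<O> F" "1 \<in> \<O> F" "of_nat k \<in> \<O> F" "of_int i \<in> \<O> F"
  by (auto simp: ring_of_integers_def)

lemma integers_sum: "(\<And>i. i \<in> I \<Longrightarrow> g i \<in> \<O> F) \<Longrightarrow> sum g I \<in> \<O> F"
  by (induction I rule: infinite_finite_induct) auto

lemma cring_integer_ring: "cring (integer_ring F)"
proof -
  interpret C: field \<CC> by (rule field_complex)
  have "subring (\<O> F) \<CC>" by (rule C.subringI) auto
  hence "subcring (\<O> F) \<CC>" by (rule C.subcringI')
  thus ?thesis using C.subcring_iff by auto
qed

context
  fixes I assumes I: "ideal I (integer_ring F)"
begin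

lemma ideal_subset: "x \<in> I \<Longrightarrow> x \<in> \<O> F"
  using ideal.Icarr[OF I] by simp

lemma ideal_zero: "0 \<in> I"
  using additive_subgroup.zero_closed[OF ideal.axioms(1)[OF I]] by simp

lemma ideal_add: "x \<in> I \<Longrightarrow> y \<in> I \<Longrightarrow> x + y \<in> I"
  using additive_subgroup.a_closed[OF ideal.axioms(1)[OF I]] by simp

lemma ideal_mult: "x \<in> \<O> F \<Longrightarrow> y \<in> I \<Longrightarrow> x * y \<in> I"
  using ideal.I_l_closed[OF I, of y x] by simp

lemma ideal_diff: "x \<in> I \<Longrightarrow> y \<in> I \<Longrightarrow> x - y \<in> I"
  using ideal_add[of x "- y"] ideal_mult[of "- 1" y] by auto

lemma ideal_power_ideal: "ideal (I [^]\<^bsub>ideals_set (integer_ring F)\<^esub> (k::nat)) (integer_ring F)"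
proof (induction k)
  case 0
  interpret R: cring "integer_ring F" by (rule cring_integer_ring)
  show ?case using R.oneideal by (simp add: ideals_set_def)
next
  case (Suc k)
  interpret R: cring "integer_ring F" by (rule cring_integer_ring)
  show ?case using R.ideal_prod_is_ideal[OF Suc I] by (simp add: ideals_set_def)
qed

end

lemma ideal_power_Suc:
  "I [^]\<^bsub>ideals_set (integer_ring F)\<^esub> Suc k = ideal_prod (integer_ring F) (I [^]\<^bsub>ideals_set (integer_ring F)\<^esub> k) I"
  by (simp add: ideals_set_def)

lemma ideal_power_0: "I [^]\<^bsub>ideals_set (integer_ring F)\<^esub> (0::nat) = \<O> F"
  by (simp add: ideals_set_def)

lemma mult_power_in_ideal_power:
  assumes "ideal I (integer_ring F)" "t \<in> I" "y \<in> \<O> F"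
  shows "t ^ k * y \<in> I [^]\<^bsub>ideals_set (integer_ring F)\<^esub> k"
  using assms(3)
proof (induction k arbitrary: y)
  case 0
  thus ?case by (simp only: ideal_power_0) simp
next
  case (Suc k)
  have "t ^ k * y \<in> I [^]\<^bsub>ideals_set (integer_ring F)\<^esub> k" using Suc by blast
  from ideal_prod.prod[OF this assms(2), of "integer_ring F"] show ?case
    unfolding ideal_power_Suc by (simp add: mult_ac)
qed

text \<open>Zorn's lemma among the proper ideals containing \<open>t\<close>. It provides the prime
  above 2 that exhibits wild ramification.\<close>

lemma exists_prime_ideal:
  assumes t: "t \<in> \<O> F" "\<And>y. y \<in> \<O> F \<Longrightarrow> t * y \<noteq> 1"
  obtains P where "primeideal P (integer_ring F)" "t \<in> P"
proof -
  interpret R: cring "integer_ring F" by (rule cring_integer_ring)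
  define A where "A = {I. ideal I (integer_ring F) \<and> t \<in> I \<and> 1 \<notin> I}"
  have "1 \<notin> PIdl\<^bsub>integer_ring F\<^esub> t"
  proof
    assume "1 \<in> PIdl\<^bsub>integer_ring F\<^esub> t"
    then obtain y where y: "y \<in> \<O> F" "1 = y * t" by (auto simp: cgenideal_def)
    have "t * y = 1" using y(2) by (simp add: mult.commute)
    with t(2)[OF y(1)] show False by contradiction
  qed
  hence "PIdl\<^bsub>integer_ring F\<^esub> t \<in> A"
    using R.cgenideal_ideal[of t] R.cgenideal_self[of t] t(1) by (simp add: A_def)
  hence "A \<noteq> {}" by blast
  moreover have "\<Union>C \<in> A" if "C \<noteq> {}" "subset.chain A C" for C
  proof -
    have "subset.chain {I. ideal I (integer_ring F)} C"
      using that(2) by (auto simp: pred_on.chain_def A_def)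
    hence "ideal (\<Union>C) (integer_ring F)" using R.chain_Union_is_ideal[of C] that(1) by simp
    thus ?thesis using that by (auto simp: A_def pred_on.chain_def)
  qed
  ultimately obtain P where P: "P \<in> A" "\<And>J. J \<in> A \<Longrightarrow> P \<subseteq> J \<Longrightarrow> J = P"
    using subset_Zorn_nonempty[of A] by blast
  have "maximalideal P (integer_ring F)"
  proof (rule maximalidealI)
    show "ideal P (integer_ring F)" using P(1) by (simp add: A_def)
    show "carrier (integer_ring F) \<noteq> P" using P(1) integers_nums(2) by (auto simp: A_def)
    fix J assume J: "ideal J (integer_ring F)" "P \<subseteq> J" "J \<subseteq> carrier (integer_ring F)"
    show "J = P \<or> J = carrier (integer_ring F)"
    proof (cases "1 \<in> J")
      case True
      thus ?thesis using ideal_mult[OF J(1), of _ 1] J(3) by auto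
    next
      case False
      hence "J \<in> A" using J P(1) by (auto simp: A_def)
      thus ?thesis using P(2) J(2) by blast
    qed
  qed
  hence "primeideal P (integer_ring F)" by (rule R.maximalideal_prime)
  thus thesis using that P(1) by (auto simp: A_def)
qed

end

section \<open>Powers of a prime ideal above p, measured by the element \<theta>\<close>

locale prime_over = prime_split +
  fixes P :: "complex set"
  assumes prime_ideal: "primeideal P (integer_ring (cyclotomic_field n))" and p_in_P: "of_nat p \<in> P"
begin

lemma P_ideal: "ideal P (integer_ring L)"
  using prime_ideal by (simp add: primeideal_def)

lemmas P_subset = L.ideal_subset[OF P_ideal]
  and P_mult = L.ideal_mult[OF P_ideal]
  and P_diff = L.ideal_diff[OF P_ideal]
  and P_add = L.ideal_add[OF P_ideal]
  and P_zero = L.ideal_zero[OF P_ideal]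

lemma P_prime: "x \<in> \<O> L \<Longrightarrow> y \<in> \<O> L \<Longrightarrow> x * y \<in> P \<Longrightarrow> x \<in> P \<or> y \<in> P"
  using primeideal.I_prime[OF prime_ideal, of x y] by simp

lemma one_notin_P: "1 \<notin> P"
proof
  assume "1 \<in> P"
  hence "P = \<O> L" using P_mult[of _ 1] P_subset by auto
  thus False using primeideal.I_notcarr[OF prime_ideal] by simp
qed

lemma P_prime_power: "x \<in> \<O> L \<Longrightarrow> x ^ k \<in> P \<Longrightarrow> x \<in> P"
proof (induction k)
  case (Suc k)
  hence "x \<in> P \<or> x ^ k \<in> P" by (intro P_prime) auto
  thus ?case using Suc by blast
qed (use one_notin_P in simp)

lemma integers_L: "\<O> L = int_adjoin \<zeta>"
  by (rule cyclotomic_integers[OF n_pos])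

lemma unit_notin_P: "u \<in> \<O> L \<Longrightarrow> v \<in> \<O> L \<Longrightarrow> u * v = 1 \<Longrightarrow> u \<notin> P"
  using P_mult[of v u] one_notin_P by (auto simp: mult.commute)

lemma theta_integer: "\<theta> \<in> \<O> L"
  using theta_int by (simp add: integers_L)

lemma theta_in_P: "\<theta> \<in> P"
proof -
  obtain U V where UV: "U \<in> int_adjoin \<zeta>" "V \<in> int_adjoin \<zeta>" "U * V = 1" "of_nat p = \<theta> ^ q * U"
    by (rule p_theta)
  have "V * of_nat p \<in> P" using UV(2) p_in_P by (intro P_mult) (simp_all add: integers_L)
  also have "V * of_nat p = \<theta> ^ q" using UV(3,4) by (simp add: mult_ac)
  finally show ?thesis by (rule P_prime_power[OF theta_integer])
qed

lemma theta_mult_in_P: "y \<in> \<O> L \<Longrightarrow> \<theta> * y \<in> P"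
  using P_mult[OF _ theta_in_P] by (simp add: mult.commute)

abbreviation P_power :: "nat \<Rightarrow> complex set"
  where "P_power k \<equiv> P [^]\<^bsub>ideals_set (integer_ring (cyclotomic_field n))\<^esub> k"

text \<open>This expresses that \<open>\<theta>\<close> generates \<open>P\<close> after
  localization: a multiplier outside \<open>P\<close> turns membership in the \<open>k\<close>-th
  power into divisibility by \<open>\<theta> ^ k\<close>.\<close>

lemma P_power_cofactor:
  assumes "x \<in> P_power k"
  shows "\<exists>\<mu>\<in>\<O> L - P. \<exists>y\<in>\<O> L. \<mu> * x = \<theta> ^ k * y"
  using assms
proof (induction k arbitrary: x)
  case 0
  hence "x \<in> \<O> L" by (simp only: L.ideal_power_0)
  thus ?case using one_notin_P by (intro bexI[of _ 1] bexI[of _ x]) auto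
next
  case (Suc k)
  have "x \<in> ideal_prod (integer_ring L) (P_power k) P" using Suc.prems by (simp only: L.ideal_power_Suc)
  thus ?case
  proof (induction x rule: ideal_prod.induct)
    case (prod i j)
    obtain \<mu> y where \<mu>: "\<mu> \<in> \<O> L" "\<mu> \<notin> P" "y \<in> \<O> L" "\<mu> * i = \<theta> ^ k * y" using Suc.IH[OF prod(1)] by blast
    define N where "N = p ^ (totient m * 1)"
    have "p \<le> N" unfolding N_def using p_pos m_pos by (intro self_le_power) auto
    hence N: "N \<ge> 2" using p_pos(2) by simp
    have j: "j \<in> \<O> L" using prod(2) P_subset by blast
    obtain w where w: "w \<in> \<O> L" "j ^ N = j + \<theta> * w"
      using frobenius_theta[of j 1] j unfolding N_def integers_L by blast
    \<comment> \<open>Since \<open>j ^ N\<close> is \<open>j\<close> modulo \<open>\<theta>\<close>,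
      the factor \<open>1 - j ^ (N - 1)\<close> carries \<open>j\<close> to a multiple of
      \<open>\<theta>\<close>; it is 1 modulo \<open>P\<close> because
      \<open>N >= 2\<close>.\<close>
    define \<nu> where "\<nu> = 1 - j ^ (N - 1)"
    have \<nu>: "\<nu> \<in> \<O> L" using j by (auto simp: \<nu>_def)
    have pow: "j ^ (N - 1) * j = j ^ N" using N by (intro power_minus_mult) auto
    have "\<nu> \<notin> P"
    proof
      assume "\<nu> \<in> P"
      moreover have "j ^ (N - 1) \<in> P"
      proof -
        have "j ^ (N - 1) = j ^ (N - 2) * j" using power_minus_mult[of "N - 1" j] N
          by (simp add: numeral_2_eq_2)
        thus ?thesis using P_mult[OF _ prod(2)] j by auto
      qed
      ultimately have "\<nu> + j ^ (N - 1) \<in> P" by (rule P_add)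
      thus False using one_notin_P by (simp add: \<nu>_def)
    qed
    hence "\<mu> * \<nu> \<in> \<O> L - P" using \<mu> \<nu> P_prime by auto
    moreover have "\<nu> * j = \<theta> * (- w)" using w(2) pow by (simp add: \<nu>_def algebra_simps)
    hence "(\<mu> * i) * (\<nu> * j) = \<theta> ^ Suc k * (y * (- w))" unfolding \<mu>(4) by simp
    hence "\<mu> * \<nu> * (i * j) = \<theta> ^ Suc k * (y * (- w))" by (simp only: mult_ac)
    moreover have "y * (- w) \<in> \<O> L" using \<mu>(3) w(1) by auto
    ultimately have "\<exists>\<mu>\<in>\<O> L - P. \<exists>z\<in>\<O> L. \<mu> * (i * j) = \<theta> ^ Suc k * z" by blast
    thus ?case by simp
  next
    case (sum s1 s2)
    then obtain \<mu>1 y1 \<mu>2 y2 where *: "\<mu>1 \<in> \<O> L - P" "y1 \<in> \<O> L" "\<mu>1 * s1 = \<theta> ^ Suc k * y1"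
      "\<mu>2 \<in> \<O> L - P" "y2 \<in> \<O> L" "\<mu>2 * s2 = \<theta> ^ Suc k * y2" by blast
    have "\<mu>1 * \<mu>2 \<in> \<O> L - P" using * P_prime by auto
    moreover have "\<mu>1 * \<mu>2 * (s1 + s2) = \<mu>2 * (\<mu>1 * s1) + \<mu>1 * (\<mu>2 * s2)" by (simp add: algebra_simps)
    hence "\<mu>1 * \<mu>2 * (s1 + s2) = \<theta> ^ Suc k * (\<mu>2 * y1 + \<mu>1 * y2)" unfolding *(3,6)
      by (simp add: algebra_simps)
    moreover have "\<mu>2 * y1 + \<mu>1 * y2 \<in> \<O> L" using * by auto
    ultimately have "\<exists>\<mu>\<in>\<O> L - P. \<exists>z\<in>\<O> L. \<mu> * (s1 + s2) = \<theta> ^ Suc k * z" by blast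
    thus ?case by simp
  qed
qed

lemma theta_power_cancel:
  assumes "x \<in> \<O> L" "\<theta> ^ k * x \<in> P_power (Suc k)"
  shows "x \<in> P"
proof -
  obtain \<mu> y where \<mu>: "\<mu> \<in> \<O> L" "\<mu> \<notin> P" "y \<in> \<O> L" "\<mu> * (\<theta> ^ k * x) = \<theta> ^ Suc k * y"
    using P_power_cofactor[OF assms(2)] by blast
  have "\<theta> ^ k * (\<mu> * x) = \<theta> ^ k * (\<theta> * y)" using \<mu>(4) by (simp add: mult_ac)
  hence "\<mu> * x = \<theta> * y" using theta_nonzero by simp
  hence "\<mu> * x \<in> P" using theta_mult_in_P \<mu>(3) by simp
  thus ?thesis using P_prime \<mu>(1,2) assms(1) by blast
qed

lemma theta_power_in: "y \<in> \<O> L \<Longrightarrow> \<theta> ^ k * y \<in> P_power k"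
  by (rule L.mult_power_in_ideal_power[OF P_ideal theta_in_P])

lemma P_power_decseq: "j \<le> k \<Longrightarrow> P_power k \<subseteq> P_power j"
proof (induction k rule: dec_induct)
  case (step k)
  interpret R: cring "integer_ring L" by (rule L.cring_integer_ring)
  have "P_power (Suc k) \<subseteq> P_power k"
    using R.ideal_prod_inter[OF L.ideal_power_ideal[OF P_ideal] P_ideal, of k]
    by (simp only: L.ideal_power_Suc) blast
  with step show ?case by blast
qed simp

lemma P_power_1: "P_power 1 = P"
proof -
  interpret R: cring "integer_ring L" by (rule L.cring_integer_ring)
  have "ideal_prod (integer_ring L) (\<O> L) P = P"
    using R.ideal_prod_one[OF P_ideal] R.ideal_prod_commute[OF R.oneideal P_ideal] by simp
  thus ?thesis by (simp only: One_nat_def L.ideal_power_Suc L.ideal_power_0)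
qed

text \<open>An ideal contains a generated ideal iff it contains the generators, so the index can be
  tested on the integers of \<open>K\<close> in \<open>P\<close>.\<close>

lemma ramification_index_eq:
  "ramification_index L K P = (GREATEST k. P \<inter> \<O> K \<subseteq> P_power k)" if "P \<inter> \<O> K \<subseteq> \<O> L"
proof -
  interpret R: cring "integer_ring L" by (rule L.cring_integer_ring)
  have "Idl\<^bsub>integer_ring L\<^esub> (P \<inter> \<O> K) \<subseteq> P_power k \<longleftrightarrow> P \<inter> \<O> K \<subseteq> P_power k" for k
    using R.genideal_self[of "P \<inter> \<O> K"] R.genideal_minimal[OF L.ideal_power_ideal[OF P_ideal], of "P \<inter> \<O> K" k] that
    by auto
  thus ?thesis unfolding ramification_index_def by simp
qed

end

section \<open>The wild inertia of an abelian field in its conductor field\<close>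

lemma geometric_sum_cong:
  fixes b :: int
  assumes "[b = 1] (mod k)"
  shows "[(\<Sum>i<p. b ^ i) = int p] (mod k)"
proof -
  have "[(\<Sum>i<p. b ^ i) = (\<Sum>i<p. 1 ^ i)] (mod k)"
    by (rule cong_sum) (rule cong_pow[OF assms])
  thus ?thesis by simp
qed

text \<open>Write \<open>b = 1 + p * t\<close>. Modulo \<open>p ^ 2\<close> the sum is
  \<open>p + p * t * (p * (p - 1) / 2)\<close>, and for odd \<open>p\<close> the second term
  vanishes since \<open>(p - 1) / 2\<close> is an integer. For \<open>p = 2\<close> the sum is
  \<open>1 + b\<close>, whence the condition modulo 4.\<close>

lemma geometric_sum_not_dvd_square:
  fixes b :: int
  assumes "prime p" "[b = 1] (mod int p)" "p = 2 \<longrightarrow> [b = 1] (mod 4)"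
  shows "\<not> int (p ^ 2) dvd (\<Sum>i<p. b ^ i)"
proof (cases "p = 2")
  case True
  hence "[(\<Sum>i<p. b ^ i) = int p] (mod 4)" by (intro geometric_sum_cong) (use assms True in auto)
  thus ?thesis using True by (auto simp: cong_def dvd_eq_mod_eq_0)
next
  case False
  have "int p dvd b - 1" using assms(2) by (simp add: cong_iff_dvd_diff)
  then obtain t where "b - 1 = int p * t" by (auto elim: dvdE)
  hence t: "b = 1 + int p * t" by simp
  have "[b ^ i = 1 + int p * t * int i] (mod int (p ^ 2))" for i
  proof (induction i)
    case (Suc i)
    have "[b ^ Suc i = (1 + int p * t) * (1 + int p * t * int i)] (mod int (p ^ 2))"
      unfolding power_Suc by (rule cong_mult) (use t Suc in auto)
    also have "(1 + int p * t) * (1 + int p * t * int i) = 1 + int p * t * int (Suc i) + (t * t * int i) * int (p ^ 2)"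
      by (simp add: algebra_simps power2_eq_square)
    also have "[\<dots> = 1 + int p * t * int (Suc i)] (mod int (p ^ 2))" by (simp add: cong_def)
    finally show ?case .
  qed simp
  hence "[(\<Sum>i<p. b ^ i) = (\<Sum>i<p. 1 + int p * t * int i)] (mod int (p ^ 2))" by (intro cong_sum)
  also have "(\<Sum>i<p. 1 + int p * t * int i) = int p + int p * t * (\<Sum>i<p. int i)"
    by (simp add: sum.distrib sum_distrib_left)
  also have "(\<Sum>i<p. int i) = int p * ((int p - 1) div 2)"
  proof -
    have "odd p" using assms(1) False prime_odd_nat prime_ge_2_nat[OF assms(1)] by auto
    hence "2 * ((int p - 1) div 2) = int p - 1" by simp
    moreover have "2 * (\<Sum>i<p. int i) = int p * (int p - 1)"
      by (induction p) (simp_all add: algebra_simps)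
    ultimately show ?thesis by (metis mult.left_commute mult_cancel_left zero_neq_numeral)
  qed
  also have "[int p + int p * t * (int p * ((int p - 1) div 2)) = int p] (mod int (p ^ 2))"
    by (simp add: cong_iff_dvd_diff power2_eq_square)
  finally have "[(\<Sum>i<p. b ^ i) = int p] (mod int (p ^ 2))" .
  moreover have "\<not> int (p ^ 2) dvd int p"
    using prime_gt_1_nat[OF assms(1)] by (simp only: int_dvd_int_iff) (auto dest!: dvd_imp_le simp: power2_eq_square)
  ultimately show ?thesis by (metis cong_dvd_iff)
qed

text \<open>The core of the lifting-the-exponent argument: only the prime \<open>p\<close> can divide both \<open>n\<close> and
  \<open>1 + b + \<dots> + b ^ (p - 1)\<close>, and at most once.\<close>

lemma dvd_mult_prime_of_power_cong:
  assumes n: "n > 0" and p: "prime p" and b: "[b ^ p = 1] (mod n)"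
    and rad: "\<And>l. prime l \<Longrightarrow> l dvd n \<Longrightarrow> [b = 1] (mod l)"
    and two: "p = 2 \<Longrightarrow> even n \<Longrightarrow> [b = 1] (mod 4)"
  shows "int n dvd (int b - 1) * int p"
proof -
  define S where "S = (\<Sum>i<p. int b ^ i)"
  have "int n dvd int b ^ p - 1" using b by (metis cong_iff_dvd_diff cong_int_iff of_nat_1 of_nat_power)
  also have "int b ^ p - 1 = (int b - 1) * S" unfolding S_def by (rule power_diff_1_eq)
  finally have dvd: "int n dvd (int b - 1) * S" .
  define g where "g = gcd (int n) S"
  have g0: "g > 0" using n by (simp add: g_def)
  have rad': "[int b = 1] (mod int l)" if "prime l" "l dvd n" for l
    using rad[OF that] by (metis cong_int_iff of_nat_1)
  have only_p: "l = p" if l: "prime l" "int l dvd g" for l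
  proof (rule ccontr)
    assume "l \<noteq> p"
    have ln: "l dvd n" "int l dvd S" using l(2) by (auto simp: g_def)
    have "[S = int p] (mod int l)" unfolding S_def by (rule geometric_sum_cong[OF rad'[OF l(1) ln(1)]])
    hence "int l dvd int p" using ln(2) by (metis cong_dvd_iff)
    hence "l dvd p" by simp
    thus False using \<open>l \<noteq> p\<close> l(1) p primes_dvd_imp_eq by blast
  qed
  have "g dvd int p"
  proof (cases "g = 1")
    case False
    define g' where "g' = nat g"
    have g': "g = int g'" "g' \<noteq> 1" "g' > 0" using g0 False by (auto simp: g'_def)
    obtain l where l: "prime l" "l dvd g'" using g'(2) prime_factor_nat by blast
    hence "l = p" using only_p[of l] g'(1) by simp
    then obtain h where h: "g' = p * h" using l(2) by (auto elim: dvdE)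
    have "h = 1"
    proof (rule ccontr)
      assume "h \<noteq> 1"
      then obtain l' where l': "prime l'" "l' dvd h" using prime_factor_nat by blast
      hence "l' = p" using only_p[of l'] g'(1) h by simp
      hence "p ^ 2 dvd g'" using l'(2) h by (simp add: power2_eq_square mult_dvd_mono)
      hence "int (p ^ 2) dvd g" unfolding g'(1) int_dvd_int_iff .
      hence "int (p ^ 2) dvd S" by (simp only: g_def) simp
      moreover have "int p dvd g" unfolding g'(1) h by simp
      hence pn: "p dvd n" unfolding g_def by simp
      have "\<not> int (p ^ 2) dvd S" unfolding S_def
        by (rule geometric_sum_not_dvd_square[OF p rad'[OF p pn]])
          (use two pn in \<open>auto simp: cong_int_iff[symmetric] simp del: cong_int_iff\<close>)
      ultimately show False by blast
    qed
    thus ?thesis using g'(1) h by simp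
  qed simp
  obtain n' S' where ns: "int n = g * n'" "S = g * S'" "coprime n' S'"
  proof -
    have "coprime (int n div g) (S div g)" using n unfolding g_def by (intro div_gcd_coprime) simp
    thus ?thesis using that[of "int n div g" "S div g"] by (simp add: g_def)
  qed
  have "g * n' dvd g * ((int b - 1) * S')" using dvd ns(1,2) by (simp add: mult.left_commute)
  hence "n' dvd (int b - 1) * S'" using g0 by simp
  hence "n' dvd int b - 1" using ns(3) by (simp add: coprime_dvd_mult_left_iff)
  hence "n' * g dvd (int b - 1) * int p" using \<open>g dvd int p\<close> by (rule mult_dvd_mono)
  thus ?thesis using ns(1) by (simp add: mult.commute)
qed

section \<open>What minimality of the conductor says about the Galois group H\<close>

locale conductor = cyclotomic +
  fixes K :: "complex set"
  assumes K_subfield: "complex_subfield K" and conductor: "is_conductor K n"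

sublocale conductor \<subseteq> K: sub_cyclotomic K n
proof (rule sub_cyclotomic.intro[OF K_subfield])
  show "sub_cyclotomic_axioms K n"
    using conductor by (simp add: sub_cyclotomic_axioms_def is_conductor_def)
qed

context conductor
begin

definition H where "H = auts L K"

lemma H_finite [simp]: "finite H" unfolding H_def by simp

lemma H_subset: "H \<subseteq> auts L \<rat>"
  unfolding H_def by (rule auts_mono) (rule K.Rats_subset)

lemma H_compose: "\<sigma> \<in> H \<Longrightarrow> \<tau> \<in> H \<Longrightarrow> compose L \<sigma> \<tau> \<in> H"
  unfolding H_def by (rule L.auts_compose[OF _ _ K.F_subset])

lemma H_id: "(\<lambda>x\<in>L. x) \<in> H"
  unfolding H_def by (rule L.auts_one[OF K.F_subset])

text \<open>\<open>H\<close> as a subgroup of the units modulo \<open>n\<close>, whose elements are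
  represented by natural exponents.\<close>

definition H_exp :: "nat \<Rightarrow> bool" where "H_exp b \<longleftrightarrow> (\<exists>\<sigma>\<in>H. \<sigma> \<zeta> = \<zeta> ^ b)"

lemma H_exp_mult: "H_exp b \<Longrightarrow> H_exp c \<Longrightarrow> H_exp (b * c)"
proof -
  assume "H_exp b" "H_exp c"
  then obtain \<sigma> \<tau> where *: "\<sigma> \<in> H" "\<sigma> \<zeta> = \<zeta> ^ b" "\<tau> \<in> H" "\<tau> \<zeta> = \<zeta> ^ c" by (auto simp: H_exp_def)
  have "compose L \<sigma> \<tau> \<zeta> = \<zeta> ^ (b * c)"
    using * H_subset L.aut_power[of \<sigma> \<rat> \<zeta> c] by (auto simp: compose_eq power_mult)
  thus ?thesis using H_compose[OF *(1,3)] by (auto simp: H_exp_def)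
qed

lemma H_exp_1: "H_exp 1"
  using H_id by (auto simp: H_exp_def intro!: bexI[of _ "\<lambda>x\<in>L. x"])

lemma H_exp_power: "H_exp b \<Longrightarrow> H_exp (b ^ k)"
  by (induction k) (auto intro: H_exp_mult H_exp_1[simplified])

lemma H_exp_coprime: "H_exp b \<Longrightarrow> coprime b n"
proof -
  assume "H_exp b"
  then obtain \<sigma> where s: "\<sigma> \<in> H" "\<sigma> \<zeta> = \<zeta> ^ b" by (auto simp: H_exp_def)
  obtain c where c: "coprime c n" "\<sigma> \<zeta> = \<zeta> ^ c" using aut_zeta s(1) H_subset by blast
  hence "[c = b] (mod n)" using s(2) zeta_power_eq_iff[OF n_pos, of c b] by simp
  thus "coprime b n" using c(1) by (metis cong_imp_coprime)
qed

text \<open>An element of \<open>H\<close> violating this would multiply \<open>\<zeta>\<close> by a primitive \<open>p\<close>-th root of unity; averaging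
  over its powers shows that \<open>K\<close> is contained in the field of \<open>n / p\<close>-th roots of unity.\<close>

lemma conductor_minimal:
  assumes "prime p" "p ^ 2 dvd n" "H_exp b" "[b = 1] (mod n div p)"
  shows "[b = 1] (mod n)"
proof (rule ccontr)
  assume b1: "\<not> [b = 1] (mod n)"
  define M where "M = n div p"
  have p: "p > 1" "p > 0" using prime_gt_1_nat[OF assms(1)] by simp_all
  have pM: "p dvd M" "n = M * p"
    using assms(2) by (auto simp: M_def power2_eq_square elim!: dvdE)
  have M0: "M > 0" using pM(2) n_pos by (metis gr0I mult_0)
  obtain \<sigma> where \<sigma>: "\<sigma> \<in> H" "\<sigma> \<zeta> = \<zeta> ^ b" using assms(3) by (auto simp: H_exp_def)
  have \<sigma>Q: "\<sigma> \<in> auts L \<rat>" using \<sigma>(1) H_subset by blast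
  define \<omega> where "\<omega> = \<zeta> ^ b / \<zeta>"
  have "[b = 1] (mod M)" using assms(4) by (simp only: M_def)
  hence "[b * p = 1 * p] (mod M * p)" unfolding cong_def mod_mult_mult2 by simp
  hence bp: "[b * p = p] (mod n)" using pM(2) by simp
  have \<omega>p: "\<omega> ^ p = 1"
    using zeta_power_eq_iff[OF n_pos, of "b * p" p] bp by (simp add: \<omega>_def power_divide power_mult)
  have \<omega>1: "\<omega> \<noteq> 1" using b1 zeta_power_eq_iff[OF n_pos, of b 1] by (auto simp: \<omega>_def)
  have \<omega>L: "\<omega> \<in> L" unfolding \<omega>_def by (intro L.divide) auto
  \<comment> \<open>Here \<open>p ^ 2 dvd n\<close> enters: \<open>p\<close> still divides
    \<open>M\<close>, so \<open>\<sigma>\<close> fixes the root of unity \<open>\<omega>\<close> of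
    order \<open>p\<close>.\<close>
  have "[b = 1] (mod p)" using assms(4) pM(1) M_def by (metis cong_dvd_modulus_nat)
  have \<omega>b: "\<omega> ^ b = \<omega>"
  proof -
    obtain r where r: "\<omega> = zeta p ^ r" using \<omega>p root_of_unity_iff[OF p(2)] by auto
    have "[r * b = r * 1] (mod p)" using \<open>[b = 1] (mod p)\<close> by (rule cong_scalar_left)
    thus ?thesis unfolding r power_mult[symmetric] using zeta_power_eq_iff[OF p(2)] by simp
  qed
  have \<sigma>\<omega>: "\<sigma> \<omega> = \<omega>"
  proof -
    have "\<sigma> \<omega> = (\<zeta> ^ b) ^ b / \<zeta> ^ b" unfolding \<omega>_def
      by (simp add: L.aut_divide[OF \<sigma>Q] L.aut_power[OF \<sigma>Q] \<sigma>(2))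
    also have "\<dots> = \<omega> ^ b" by (simp add: \<omega>_def power_divide)
    finally show ?thesis using \<omega>b by simp
  qed
  have \<omega>_power: "\<omega> ^ i = 1 \<longleftrightarrow> p dvd i" for i
  proof
    obtain r where r: "r < p" "\<omega> = zeta p ^ r" using \<omega>p root_of_unity_iff[OF p(2)] by auto
    have "r \<noteq> 0" using \<omega>1 r(2) by (metis power_0)
    hence "\<not> p dvd r" using r(1) by (auto dest: dvd_imp_le)
    assume "\<omega> ^ i = 1"
    hence "p dvd r * i" using zeta_power_eq_1_iff[OF p(2)] by (simp add: r(2) power_mult[symmetric])
    thus "p dvd i" using \<open>\<not> p dvd r\<close> prime_dvd_mult_iff assms(1) by blast
  qed (auto elim!: dvdE simp: power_mult \<omega>p)
  have "K \<subseteq> cyclotomic_field M"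
  proof
    fix x assume x: "x \<in> K"
    interpret M: cyclotomic M by (rule cyclotomic_intro[OF M0])
    obtain P where P: "P \<in> polys_over \<rat>" "x = poly P \<zeta>" using K.F_in_L[OF x] by (rule in_LE)
    have xj: "x = poly P (\<zeta> * \<omega> ^ j)" for j
    proof (induction j)
      case (Suc j)
      have "\<sigma> x = x" using \<sigma>(1) x L.aut_fix unfolding H_def by blast
      also have "\<sigma> x = \<sigma> (poly P (\<zeta> * \<omega> ^ j))" by (rule arg_cong[OF Suc])
      also have "\<dots> = poly P (\<sigma> (\<zeta> * \<omega> ^ j))"
        by (rule L.aut_poly_fix[OF \<sigma>Q P(1) F_subset]) (auto intro: L.mult L.power \<omega>L)
      also have "\<sigma> (\<zeta> * \<omega> ^ j) = \<zeta> * \<omega> ^ Suc j"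
        using \<omega>L by (simp add: L.aut_mult[OF \<sigma>Q] L.power L.aut_power[OF \<sigma>Q] \<sigma>\<omega> \<sigma>(2)) (simp add: \<omega>_def)
      finally show ?case ..
    qed (use P in simp)
    \<comment> \<open>In the sum over \<open>j\<close> only the powers of \<open>\<zeta>\<close>
      with exponent divisible by \<open>p\<close> survive, and these are powers of
      \<open>zeta M\<close>.\<close>
    have "of_nat p * x = (\<Sum>j<p. poly P (\<zeta> * \<omega> ^ j))" using xj by simp
    also have "\<dots> = (\<Sum>j<p. \<Sum>i\<le>degree P. coeff P i * \<zeta> ^ i * (\<omega> ^ i) ^ j)"
      by (simp add: poly_altdef power_mult_distrib power_mult[symmetric] mult.commute mult.left_commute)
    also have "\<dots> = (\<Sum>i\<le>degree P. coeff P i * \<zeta> ^ i * (\<Sum>j<p. (\<omega> ^ i) ^ j))"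
      by (subst sum.swap) (simp add: sum_distrib_left)
    also have "\<dots> \<in> cyclotomic_field M"
    proof (rule M.L.sum)
      fix i
      show "coeff P i * \<zeta> ^ i * (\<Sum>j<p. (\<omega> ^ i) ^ j) \<in> M.L"
      proof (cases "p dvd i")
        case True
        then obtain k where k: "i = p * k" by (auto elim: dvdE)
        have "\<zeta> ^ i = zeta M ^ k" unfolding k power_mult pM(2) using zeta_mult_power[OF p(2)] by simp
        moreover have "coeff P i \<in> M.L" using P(1) M.L.Rats_subset by (auto simp: polys_over_def)
        moreover have "\<omega> ^ i = 1" using True \<omega>_power by blast
        hence "(\<Sum>j<p. (\<omega> ^ i) ^ j) = of_nat p" by simp
        ultimately show ?thesis by (auto intro!: M.L.mult)
      next
        case False
        hence "\<omega> ^ i \<noteq> 1" using \<omega>_power by blast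
        moreover have "(\<omega> ^ i) ^ p = 1" by (metis \<omega>p power_mult mult.commute power_one)
        ultimately show ?thesis by (simp add: geometric_sum)
      qed
    qed
    finally have "of_nat p * x / of_nat p \<in> M.L" by (rule M.L.divide) simp
    thus "x \<in> M.L" using p by simp
  qed
  hence "n \<le> M" using conductor M0 by (simp add: is_conductor_def)
  thus False using pM(2) M0 p by simp
qed

text \<open>These are the exponents that act trivially on all roots of unity of squarefree order
  dividing \<open>n\<close>.\<close>

definition rad_one :: "nat \<Rightarrow> bool"
  where "rad_one b \<longleftrightarrow> (\<forall>l. prime l \<longrightarrow> l dvd n \<longrightarrow> [b = 1] (mod l))"

lemma rad_one_mult: "rad_one b \<Longrightarrow> rad_one c \<Longrightarrow> rad_one (b * c)"
  unfolding rad_one_def using cong_mult[of b 1 _ c 1] by simp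

lemma rad_one_power: "rad_one b \<Longrightarrow> rad_one (b ^ k)"
  unfolding rad_one_def using cong_pow[of b 1 _ k] by simp

text \<open>If \<open>p\<close> divides \<open>n\<close>, lifting the exponent gives
  \<open>b = 1\<close> modulo \<open>n / p\<close>. When \<open>p ^ 2\<close> divides
  \<open>n\<close>, minimality of the conductor finishes; when \<open>p\<close> divides
  \<open>n\<close> only once, \<open>rad_one\<close> supplies the missing congruence modulo
  \<open>p\<close>.\<close>

lemma rad_one_power_trivial:
  assumes "H_exp b" "rad_one b" "prime p" "[b ^ p = 1] (mod n)"
    "p = 2 \<Longrightarrow> even n \<Longrightarrow> [b = 1] (mod 4)"
  shows "[b = 1] (mod n)"
proof -
  have p: "p > 0" using prime_gt_1_nat[OF assms(3)] by simp
  have dvd: "int n dvd (int b - 1) * int p"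
    using assms by (intro dvd_mult_prime_of_power_cong) (auto simp: rad_one_def n_positive)
  have to_cong: "int k dvd int b - 1 \<Longrightarrow> [b = 1] (mod k)" for k
    by (metis cong_iff_dvd_diff cong_int_iff of_nat_1)
  show ?thesis
  proof (cases "p dvd n")
    case False
    hence "coprime (int n) (int p)" using prime_imp_coprime_nat[OF assms(3)] by (simp add: coprime_commute)
    hence "int n dvd int b - 1" using dvd by (simp add: coprime_dvd_mult_left_iff)
    thus ?thesis by (rule to_cong)
  next
    case True
    then obtain n1 where n1: "n = p * n1" by (auto elim: dvdE)
    have "int n1 dvd int b - 1" using dvd p by (simp add: n1 mult.commute)
    hence c1: "[b = 1] (mod n1)" by (rule to_cong)
    show ?thesis
    proof (cases "p dvd n1")
      case True
      hence "p ^ 2 dvd n" by (simp add: n1 power2_eq_square mult_dvd_mono)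
      thus ?thesis using conductor_minimal[OF assms(3) _ assms(1)] c1 p by (simp add: n1)
    next
      case False
      hence "coprime p n1" using prime_imp_coprime_nat[OF assms(3)] by simp
      moreover have "[b = 1] (mod p)" using assms(2,3) True by (auto simp: rad_one_def)
      ultimately show ?thesis using c1 unfolding n1 by (simp add: coprime_cong_mult_nat)
    qed
  qed
qed

text \<open>Let \<open>d\<close> be the order of \<open>b\<close>. For a prime \<open>p\<close>
  dividing \<open>d\<close>, the power \<open>b ^ (d / p)\<close> has order \<open>p\<close>. This
  is excluded for odd \<open>p\<close>, and also for \<open>p = 2\<close> if \<open>4 dvd d\<close>,
  because an odd square is 1 modulo 4.\<close>

lemma rad_one_square:
  assumes "H_exp b" "rad_one b"
  shows "[b ^ 2 = 1] (mod n)"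
proof -
  have cop: "coprime n b" using H_exp_coprime[OF assms(1)] by (simp add: coprime_commute)
  define d where "d = ord n b"
  have d: "[b ^ d = 1] (mod n)" unfolding d_def by (rule ord)
  have d0: "d > 0" using cop by (simp add: d_def)
  have minimal: "\<not> [b ^ k = 1] (mod n)" if "k < d" "k > 0" for k
    using ord_minimal[of k n b] that by (auto simp: d_def)
  have not_dvd: False if kp: "prime p" "d = p * k" "p = 2 \<Longrightarrow> even n \<Longrightarrow> [b ^ k = 1] (mod 4)" for p k
  proof -
    have "[(b ^ k) ^ p = 1] (mod n)" using d kp(2) by (simp add: power_mult[symmetric] mult.commute)
    hence "[b ^ k = 1] (mod n)"
      using kp by (intro rad_one_power_trivial[of "b ^ k" p] H_exp_power rad_one_power assms)
    moreover have "k < d" "k > 0" using kp(2) d0 prime_gt_1_nat[OF kp(1)] by auto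
    ultimately show False using minimal by blast
  qed
  have "d dvd 2"
  proof -
    have "p = 2" if "prime p" "p dvd d" for p
      using not_dvd[of p "d div p"] that by auto
    moreover have "\<not> 4 dvd d"
    proof
      assume "4 dvd d"
      then obtain k where k: "d = 4 * k" by (auto elim: dvdE)
      show False
      proof (rule not_dvd[of 2 "2 * k"])
        assume "even n"
        hence "odd b" using cop by (metis coprime_common_divisor odd_one)
        hence "odd (b ^ k)" by simp
        then obtain t where t: "b ^ k = 2 * t + 1" by (rule oddE)
        have "b ^ (2 * k) = 4 * (t * t + t) + 1" unfolding power_mult mult.commute[of 2 k] t
          by (simp add: power2_eq_square algebra_simps)
        thus "[b ^ (2 * k) = 1] (mod 4)" by (simp add: cong_def mod_mult_self4)
      qed (use k in auto)
    qed
    ultimately show ?thesis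
    proof (cases "d = 1")
      case False
      then obtain l where "prime l" "l dvd d" using prime_factor_nat by blast
      hence "2 dvd d" using \<open>\<And>p. prime p \<Longrightarrow> p dvd d \<Longrightarrow> p = 2\<close> by blast
      then obtain k where k: "d = 2 * k" by (auto elim: dvdE)
      have "k = 1"
      proof (rule ccontr)
        assume "k \<noteq> 1"
        then obtain l where l: "prime l" "l dvd k" using prime_factor_nat by blast
        hence "l = 2" using \<open>\<And>p. prime p \<Longrightarrow> p dvd d \<Longrightarrow> p = 2\<close> k by auto
        hence "4 dvd d" using l(2) k by auto
        thus False using \<open>\<not> 4 dvd d\<close> by blast
      qed
      thus ?thesis using k by simp
    qed simp
  qed
  then obtain k where k: "2 = d * k" by (rule dvdE)
  have "[(b ^ d) ^ k = 1 ^ k] (mod n)" by (rule cong_pow[OF d])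
  thus ?thesis by (simp add: power_mult[symmetric] k[symmetric])
qed

text \<open>Start from \<open>n dvd (b - 1) * (b + 1)\<close>. An odd prime factor of
  \<open>n\<close> divides \<open>b - 1\<close>, hence not \<open>b + 1\<close>, so
  \<open>b = 1\<close> modulo the odd part; and \<open>b - 1\<close> is twice an odd number, so
  \<open>2 ^ (e - 1)\<close> divides \<open>b + 1\<close>. For \<open>e = 1\<close> such a
  \<open>b\<close> is 1 modulo \<open>n\<close>; for \<open>e = 2\<close> it is 1 modulo
  \<open>n / 2\<close>, hence modulo \<open>n\<close> by minimality.\<close>

lemma rad_one_trivial_or_wild:
  assumes "H_exp b" "rad_one b" "\<not> [b = 1] (mod n)"
  defines "e \<equiv> multiplicity 2 n"
  shows "[b = 3] (mod 4)" "e \<ge> 3" "[b = 1] (mod n div 2 ^ e)" "[b + 1 = 0] (mod 2 ^ (e - 1))"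
proof -
  note sq = rad_one_square[OF assms(1,2)]
  have ne: "even n \<and> \<not> [b = 1] (mod 4)"
    using rad_one_power_trivial[OF assms(1,2), of 2] sq assms(3) by auto
  obtain m where m: "n = 2 ^ e * m" "\<not> 2 dvd m"
    using multiplicity_decompose'[of n 2] n_positive unfolding e_def by auto
  have "odd b" using H_exp_coprime[OF assms(1)] ne by (metis coprime_common_divisor odd_one)
  hence b4: "b mod 4 = 3" using ne by (simp add: cong_def) presburger
  thus "[b = 3] (mod 4)" by (simp add: cong_def)
  have "int n dvd (int b) ^ 2 - 1" using sq by (metis cong_iff_dvd_diff cong_int_iff of_nat_1 of_nat_power)
  hence dvd: "int n dvd (int b - 1) * (int b + 1)" by (simp add: power2_eq_square algebra_simps)
  have bm: "[b = 1] (mod m)"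
  proof -
    have "coprime (int b + 1) (int m)"
    proof (rule ccontr)
      assume "\<not> coprime (int b + 1) (int m)"
      hence "\<not> coprime (b + 1) m" by (metis coprime_int_iff of_nat_1 of_nat_add)
      hence "gcd (b + 1) m \<noteq> 1" unfolding coprime_iff_gcd_eq_1 .
      then obtain l where "prime l" "l dvd gcd (b + 1) m" using prime_factor_nat by blast
      hence l: "prime l" "l dvd b + 1" "l dvd m" using dvd_trans by blast+
      have "l dvd n" using l(3) m(1) by (metis dvd_mult)
      hence "[b = 1] (mod l)" using assms(2) l(1) unfolding rad_one_def by blast
      hence "[b + 1 = 1 + 1] (mod l)" by (rule cong_add) simp
      hence "l dvd 2" using l(2) by (metis cong_dvd_iff one_add_one)
      hence "l = 2" using l(1) primes_dvd_imp_eq two_is_prime_nat by blast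
      thus False using l(3) m(2) by simp
    qed
    moreover have "int m dvd (int b - 1) * (int b + 1)" using dvd m(1) by (auto intro: dvd_trans)
    ultimately have "int m dvd int b - 1" by (simp add: coprime_dvd_mult_left_iff coprime_commute)
    thus ?thesis by (metis cong_iff_dvd_diff cong_int_iff of_nat_1)
  qed
  have nm: "n div 2 ^ e = m" using m(1) by simp
  show "[b = 1] (mod n div 2 ^ e)" using bm nm by simp
  have e1: "e \<noteq> 0" using ne m by (metis power_0 mult_1)
  have e2: "e \<noteq> 1"
  proof
    assume "e = 1"
    moreover have "[b = 1] (mod 2)" using \<open>odd b\<close> by (simp add: cong_def odd_iff_mod_2_eq_one)
    moreover have "coprime 2 m" using m(2) by simp
    ultimately have "[b = 1] (mod n)" using bm m(1) by (simp add: coprime_cong_mult_nat)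
    thus False using assms(3) by blast
  qed
  have e3: "e \<noteq> 2"
  proof
    assume e: "e = 2"
    hence n: "n = 4 * m" using m(1) by simp
    have "[b = 1] (mod 2)" using \<open>odd b\<close> by (simp add: cong_def odd_iff_mod_2_eq_one)
    moreover have "coprime 2 m" using m(2) by simp
    ultimately have "[b = 1] (mod 2 * m)" using bm by (simp add: coprime_cong_mult_nat)
    moreover have "n div 2 = 2 * m" "2 ^ 2 dvd n" using n by auto
    ultimately show False using conductor_minimal[of 2 b] assms(1,3) by simp
  qed
  show "e \<ge> 3" using e1 e2 e3 by simp
  obtain t where t: "b = 4 * t + 3" using b4 by (metis mult_div_mod_eq)
  have "int (2 ^ e) dvd (int b - 1) * (int b + 1)" using dvd m(1) by (auto intro: dvd_trans)
  moreover have "(int b - 1) * (int b + 1) = 2 * ((2 * int t + 1) * (int b + 1))" by (simp add: t algebra_simps)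
  moreover have "int (2 ^ e) = 2 * 2 ^ (e - 1)" using e1 by (cases e) auto
  ultimately have "2 ^ (e - 1) dvd (2 * int t + 1) * (int b + 1)" by simp
  moreover have "coprime (2 ^ (e - 1)) (2 * int t + 1)" by simp
  ultimately have "2 ^ (e - 1) dvd int b + 1" by (simp add: coprime_dvd_mult_right_iff)
  hence "int (2 ^ (e - 1)) dvd int (b + 1)" by (simp add: add.commute)
  hence "2 ^ (e - 1) dvd b + 1" by (simp only: int_dvd_int_iff)
  thus "[b + 1 = 0] (mod 2 ^ (e - 1))" by (simp add: cong_0_iff)
qed

end

section \<open>An element of minimal trace\<close>

text \<open>One element is chosen from each pair \<open>{x, f x}\<close>. Applied to composition
  with \<open>\<tau>\<close>, this halves a trace without introducing a denominator.\<close>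

lemma sum_fixed_point_free_involution:
  fixes g :: "'a \<Rightarrow> complex"
  assumes "finite A" "\<And>x. x \<in> A \<Longrightarrow> f x \<in> A" "\<And>x. x \<in> A \<Longrightarrow> f (f x) = x"
    "\<And>x. x \<in> A \<Longrightarrow> f x \<noteq> x" "\<And>x. x \<in> A \<Longrightarrow> g (f x) = g x"
  obtains B where "B \<subseteq> A" "sum g A = 2 * sum g B"
proof -
  have "\<exists>B\<subseteq>A. sum g A = 2 * sum g B"
    using assms
  proof (induction A rule: finite_psubset_induct)
    case (psubset A)
    show ?case
    proof (cases "A = {}")
      case False
      then obtain x where x: "x \<in> A" by blast
      define A' where "A' = A - {x, f x}"
      have "A' \<subset> A" using x by (auto simp: A'_def)
      moreover have "f y \<in> A'" if "y \<in> A'" for y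
        using psubset.prems(1,2) that x unfolding A'_def by (metis DiffD1 DiffD2 DiffI insertCI insertE singletonD)
      ultimately obtain B where B: "B \<subseteq> A'" "sum g A' = 2 * sum g B"
        using psubset.IH[of A'] psubset.prems by (metis psubsetD)
      have fx: "f x \<in> A" "f x \<noteq> x" using psubset.prems x by blast+
      have "A = insert x (insert (f x) A')" using x fx by (auto simp: A'_def)
      moreover have "finite A'" "x \<notin> A'" "f x \<notin> A'" using psubset.hyps by (auto simp: A'_def)
      ultimately have "sum g A = g x + (g (f x) + sum g A')"
        using fx(2) by (metis (no_types, lifting) finite_insert insertE sum.insert)
      also have "\<dots> = 2 * (g x + sum g B)" using psubset.prems(4)[OF x] B by simp
      also have "g x + sum g B = sum g (insert x B)"
        using B(1) \<open>finite A'\<close> \<open>x \<notin> A'\<close> by (subst sum.insert) (auto intro: finite_subset)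
      finally show ?thesis using B(1) x \<open>A' \<subset> A\<close> by (intro exI[of _ "insert x B"]) auto
    qed auto
  qed
  thus thesis using that by blast
qed

context sub_cyclotomic
begin

text \<open>The automorphisms taking \<open>y\<close> to a given conjugate form a translate of its
  stabilizer, so there are \<open>s\<close> of them.\<close>

lemma sum_orbit:
  assumes y: "y \<in> L" and s: "card {\<sigma> \<in> auts L F. \<sigma> y = y} = s"
  shows "Tr y = of_nat s * \<Sum>((\<lambda>\<sigma>. \<sigma> y) ` auts L F)"
proof -
  have fib: "card {\<sigma> \<in> auts L F. \<sigma> y = z} = s" if "z \<in> (\<lambda>\<sigma>. \<sigma> y) ` auts L F" for z
  proof -
    obtain \<sigma> where \<sigma>: "\<sigma> \<in> auts L F" "z = \<sigma> y" using \<open>z \<in> (\<lambda>\<sigma>. \<sigma> y) ` auts L F\<close> by blast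
    note bij = L.auts_translate[OF \<sigma>(1) F_subset]
    have "compose L \<sigma> ` {\<rho> \<in> auts L F. \<rho> y = y} = {\<rho> \<in> auts L F. \<rho> y = z}"
    proof (intro equalityI subsetI)
      fix \<rho> assume "\<rho> \<in> compose L \<sigma> ` {\<rho> \<in> auts L F. \<rho> y = y}"
      then obtain \<rho>' where \<rho>': "\<rho>' \<in> auts L F" "\<rho>' y = y" "\<rho> = compose L \<sigma> \<rho>'" by blast
      thus "\<rho> \<in> {\<rho> \<in> auts L F. \<rho> y = z}"
        using bij_betw_apply[OF bij \<rho>'(1)] y by (simp add: compose_eq \<sigma>(2))
    next
      fix \<rho> assume \<rho>: "\<rho> \<in> {\<rho> \<in> auts L F. \<rho> y = z}"
      then obtain \<rho>' where \<rho>': "\<rho>' \<in> auts L F" "\<rho> = compose L \<sigma> \<rho>'"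
        using bij by (auto simp: bij_betw_def)
      have "\<sigma> (\<rho>' y) = \<sigma> y" using \<rho> \<rho>'(2) y \<sigma>(2) by (simp add: compose_eq)
      hence "\<rho>' y = y" using L.aut_eq_iff[OF \<sigma>(1)] L.aut_closed[OF \<rho>'(1)] y by blast
      thus "\<rho> \<in> compose L \<sigma> ` {\<rho> \<in> auts L F. \<rho> y = y}" using \<rho>' by blast
    qed
    moreover have "inj_on (compose L \<sigma>) {\<rho> \<in> auts L F. \<rho> y = y}"
      using bij by (auto simp: bij_betw_def intro: inj_on_subset)
    ultimately show ?thesis using s card_image[of "compose L \<sigma>" "{\<rho> \<in> auts L F. \<rho> y = y}"] by simp
  qed
  have "Tr y = (\<Sum>z\<in>(\<lambda>\<sigma>. \<sigma> y) ` auts L F. \<Sum>\<sigma> | \<sigma> \<in> auts L F \<and> \<sigma> y = z. \<sigma> y)"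
    unfolding aut_trace_def by (rule sum.image_gen) simp
  also have "\<dots> = (\<Sum>z\<in>(\<lambda>\<sigma>. \<sigma> y) ` auts L F. of_nat s * z)"
    by (rule sum.cong[OF refl]) (use fib in simp)
  finally show ?thesis by (simp add: sum_distrib_left)
qed

text \<open>\<open>R\<close> takes one element from each orbit; the stabilizers have a common size,
  so the orbit sums carry a common factor.\<close>

lemma orbit_transversal:
  assumes "finite W" "W \<subseteq> L" "\<And>\<sigma> y. \<sigma> \<in> auts L F \<Longrightarrow> y \<in> W \<Longrightarrow> \<sigma> y \<in> W"
    "\<And>y. y \<in> W \<Longrightarrow> card {\<sigma> \<in> auts L F. \<sigma> y = y} = s"
  shows "\<exists>R\<subseteq>W. Tr (\<Sum>R) = of_nat s * \<Sum>W"
  using assms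
proof (induction W rule: finite_psubset_induct)
  case (psubset W)
  show ?case
  proof (cases "W = {}")
    case False
    then obtain y where y: "y \<in> W" by blast
    define Orb where "Orb = (\<lambda>\<sigma>. \<sigma> y) ` auts L F"
    have sub: "Orb \<subseteq> W" using psubset.prems(2) y by (auto simp: Orb_def)
    have yO: "y \<in> Orb" unfolding Orb_def using L.auts_one[OF F_subset] y psubset.prems(1)
      by (intro image_eqI[of _ _ "\<lambda>x\<in>L. x"]) auto
    have "\<sigma> z \<in> W - Orb" if "\<sigma> \<in> auts L F" "z \<in> W - Orb" for \<sigma> z
    proof -
      have "z \<in> Orb" if zO: "\<sigma> z \<in> Orb"
      proof -
        obtain \<rho> where \<rho>: "\<rho> \<in> auts L F" "\<sigma> z = \<rho> y" using zO by (auto simp: Orb_def)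
        obtain \<tau> where \<tau>: "\<tau> \<in> auts L F" "\<And>x. x \<in> L \<Longrightarrow> \<tau> (\<sigma> x) = x"
          by (rule L.auts_inverse[OF \<open>\<sigma> \<in> auts L F\<close> F_subset]) blast
        have zy: "z \<in> L" "y \<in> L" using \<open>z \<in> W - Orb\<close> psubset.prems(1) y by blast+
        have "z = compose L \<tau> \<rho> y" using \<tau>(2)[OF zy(1)] \<rho>(2) zy(2) by (simp add: compose_eq)
        thus ?thesis unfolding Orb_def using L.auts_compose[OF \<tau>(1) \<rho>(1) F_subset] by blast
      qed
      thus ?thesis using that psubset.prems(2) by blast
    qed
    hence "\<exists>R\<subseteq>W - Orb. Tr (\<Sum>R) = of_nat s * \<Sum>(W - Orb)"
    proof (intro psubset.IH)
      show "W - Orb \<subset> W" using y yO by blast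
      show "W - Orb \<subseteq> L" using psubset.prems(1) by blast
    qed (use psubset.prems(3) in auto)
    then obtain R where R: "R \<subseteq> W - Orb" "Tr (\<Sum>R) = of_nat s * \<Sum>(W - Orb)" by blast
    have yR: "finite R" "y \<notin> R" "R \<subseteq> L" using R(1) yO psubset.hyps psubset.prems(1) by (auto intro: finite_subset)
    have "Tr (\<Sum>(insert y R)) = Tr y + Tr (\<Sum>R)"
      using yR y psubset.prems(1) by (simp add: Tr_add L.sum subset_iff)
    also have "Tr y = of_nat s * \<Sum>Orb"
      unfolding Orb_def using sum_orbit[OF _ psubset.prems(3)[OF y]] y psubset.prems(1) by blast
    also have "of_nat s * \<Sum>Orb + Tr (\<Sum>R) = of_nat s * (\<Sum>Orb + \<Sum>(W - Orb))"
      using R(2) by (simp add: algebra_simps)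
    also have "\<Sum>Orb + \<Sum>(W - Orb) = \<Sum>W" using sum.subset_diff[OF sub psubset.hyps(1), of "\<lambda>x. x"] by simp
    finally show ?thesis using R(1) y by (intro exI[of _ "insert y R"]) auto
  qed auto
qed

end

context cyclotomic
begin

definition n_primes where "n_primes = {l. prime l \<and> l dvd n}"

lemma finite_n_primes [simp]: "finite n_primes"
  unfolding n_primes_def by (rule finite_subset[of _ "{..n}"]) (auto intro: dvd_imp_le[OF _ n_pos])

lemma zeta_div: "l dvd n \<Longrightarrow> zeta l = \<zeta> ^ (n div l)"
proof -
  assume "l dvd n"
  then obtain k where k: "n = l * k" by (auto elim: dvdE)
  hence "k > 0" "n div l = k" using n_positive by (auto intro: gr0I)
  thus ?thesis using zeta_mult_power[of k l] k by simp
qed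

lemma zeta_div_in_L: "l dvd n \<Longrightarrow> zeta l \<in> L"
  by (subst zeta_div) auto

lemma aut_zeta_div:
  assumes "\<sigma> \<in> auts L \<rat>" "\<sigma> \<zeta> = \<zeta> ^ b" "l dvd n"
  shows "\<sigma> (zeta l) = zeta l ^ b"
  by (simp add: zeta_div[OF assms(3)] L.aut_power[OF assms(1)] assms(2) power_mult[symmetric] mult.commute)

text \<open>Roots of unity of order dividing the radical of \<open>n\<close>, in coordinates: one
  exponent for each prime.\<close>

definition root_prod :: "(nat \<Rightarrow> nat) \<Rightarrow> complex"
  where "root_prod f = (\<Prod>l\<in>n_primes. zeta l ^ f l)"

lemma root_prod_in_L: "root_prod f \<in> L"
  unfolding root_prod_def by (auto intro!: L.prod L.power zeta_div_in_L simp: n_primes_def)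

text \<open>Raising to the power \<open>R\<close>, the product of the other primes, isolates the
  factor at \<open>l\<close>, and \<open>R\<close> is prime to \<open>l\<close>.\<close>

lemma root_prod_eq_iff: "root_prod f = root_prod g \<longleftrightarrow> (\<forall>l\<in>n_primes. [f l = g l] (mod l))"
proof (intro iffI ballI)
  fix l assume eq: "root_prod f = root_prod g" and l: "l \<in> n_primes"
  have pl: "prime l" and l0: "l > 0" using l prime_gt_0_nat[of l] by (auto simp: n_primes_def)
  define R where "R = \<Prod>(n_primes - {l})"
  have pow: "root_prod h ^ R = zeta l ^ (h l * R)" for h
  proof -
    have "root_prod h ^ R = (\<Prod>k\<in>n_primes. zeta k ^ (h k * R))"
      by (simp add: root_prod_def prod_power_distrib power_mult)
    also have "\<dots> = zeta l ^ (h l * R) * (\<Prod>k\<in>n_primes - {l}. zeta k ^ (h k * R))"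
      using l by (intro prod.remove) auto
    also have "(\<Prod>k\<in>n_primes - {l}. zeta k ^ (h k * R)) = 1"
    proof (rule prod.neutral, rule ballI)
      fix k assume k: "k \<in> n_primes - {l}"
      hence "k dvd h k * R" unfolding R_def by (intro dvd_mult dvd_prodI) auto
      moreover have "k > 0" using k prime_gt_0_nat[of k] by (auto simp: n_primes_def)
      ultimately show "zeta k ^ (h k * R) = 1" using zeta_power_eq_1_iff by blast
    qed
    finally show ?thesis by simp
  qed
  have "[f l * R = g l * R] (mod l)" using eq pow zeta_power_eq_iff[OF l0] by metis
  moreover have "coprime R l" unfolding R_def
    by (rule prod_coprime_left) (use pl in \<open>auto simp: n_primes_def primes_coprime\<close>)
  ultimately show "[f l = g l] (mod l)" using cong_mult_rcancel_nat by blast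
next
  assume *: "\<forall>l\<in>n_primes. [f l = g l] (mod l)"
  show "root_prod f = root_prod g" unfolding root_prod_def
  proof (rule prod.cong[OF refl])
    fix l assume l: "l \<in> n_primes"
    hence "l > 0" using prime_gt_0_nat[of l] by (auto simp: n_primes_def)
    thus "zeta l ^ f l = zeta l ^ g l" using * l zeta_power_eq_iff by blast
  qed
qed

lemma aut_root_prod:
  assumes "\<sigma> \<in> auts L \<rat>" "\<sigma> \<zeta> = \<zeta> ^ b"
  shows "\<sigma> (root_prod f) = root_prod (\<lambda>l. b * f l)"
proof -
  have "\<sigma> (root_prod f) = (\<Prod>l\<in>n_primes. \<sigma> (zeta l ^ f l))"
    unfolding root_prod_def
    by (rule L.aut_prod[OF assms(1)]) (auto intro!: L.power zeta_div_in_L simp: n_primes_def)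
  also have "\<dots> = root_prod (\<lambda>l. b * f l)" unfolding root_prod_def
  proof (rule prod.cong[OF refl])
    fix l assume "l \<in> n_primes"
    hence l: "l dvd n" by (simp add: n_primes_def)
    hence "zeta l \<in> L" by (rule zeta_div_in_L)
    thus "\<sigma> (zeta l ^ f l) = zeta l ^ (b * f l)"
      by (simp add: L.aut_power[OF assms(1)] aut_zeta_div[OF assms l] power_mult)
  qed
  finally show ?thesis .
qed

text \<open>The roots of unity whose order is exactly the radical of \<open>n\<close>; leaving out
  exponent 0 makes them primitive.\<close>

definition root_prods where "root_prods = root_prod ` (\<Pi>\<^sub>E l\<in>n_primes. {1..<l})"

text \<open>The sum over exponent families factors over the primes, and the nontrivial
  \<open>l\<close>-th roots of unity sum to \<open>-1\<close>.\<close>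

lemma sum_root_prods: "\<Sum>root_prods = (-1) ^ card n_primes"
proof -
  have inj: "inj_on root_prod (\<Pi>\<^sub>E l\<in>n_primes. {1..<l})"
  proof (rule inj_onI)
    fix f g assume fg: "f \<in> (\<Pi>\<^sub>E l\<in>n_primes. {1..<l})" "g \<in> (\<Pi>\<^sub>E l\<in>n_primes. {1..<l})" "root_prod f = root_prod g"
    show "f = g"
    proof (rule PiE_ext[OF fg(1,2)])
      fix l assume l: "l \<in> n_primes"
      hence "[f l = g l] (mod l)" "f l < l" "g l < l" using fg root_prod_eq_iff by (auto dest: PiE_mem)
      thus "f l = g l" by (simp add: cong_def)
    qed
  qed
  have "\<Sum>root_prods = (\<Sum>f\<in>(\<Pi>\<^sub>E l\<in>n_primes. {1..<l}). \<Prod>l\<in>n_primes. zeta l ^ f l)"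
    unfolding root_prods_def sum.reindex[OF inj] by (simp add: root_prod_def)
  also have "\<dots> = (\<Prod>l\<in>n_primes. \<Sum>x\<in>{1..<l}. zeta l ^ x)"
    by (rule prod_sum_PiE[symmetric]) auto
  also have "\<dots> = (\<Prod>l\<in>n_primes. -1)"
  proof (rule prod.cong[OF refl])
    fix l assume "l \<in> n_primes"
    hence l: "l > 1" using prime_gt_1_nat[of l] by (auto simp: n_primes_def)
    have "(\<Sum>x<l. zeta l ^ x) = 0" using sum_zeta_power[of l 1] l by (auto dest: dvd_imp_le)
    moreover have "{..<l} = insert 0 {1..<l}" using l by auto
    ultimately show "(\<Sum>x\<in>{1..<l}. zeta l ^ x) = -1" by (simp add: eq_neg_iff_add_eq_0 add.commute)
  qed
  finally show ?thesis by simp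
qed

lemma aut_root_prods:
  assumes "\<sigma> \<in> auts L \<rat>" "y \<in> root_prods"
  shows "\<sigma> y \<in> root_prods"
proof -
  obtain b where b: "coprime b n" "\<sigma> \<zeta> = \<zeta> ^ b" using aut_zeta[OF assms(1)] .
  obtain f where f: "f \<in> (\<Pi>\<^sub>E l\<in>n_primes. {1..<l})" "y = root_prod f" using assms(2) by (auto simp: root_prods_def)
  define g where "g = (\<lambda>l\<in>n_primes. (b * f l) mod l)"
  have "\<sigma> y = root_prod g"
    unfolding f(2) aut_root_prod[OF assms(1) b(2)] root_prod_eq_iff by (simp add: g_def cong_def)
  moreover have "g \<in> (\<Pi>\<^sub>E l\<in>n_primes. {1..<l})"
  proof (rule PiE_I)
    fix l assume l: "l \<in> n_primes"
    hence pl: "prime l" "l dvd n" by (auto simp: n_primes_def)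
    have "f l \<in> {1..<l}" using f(1) l by (rule PiE_mem)
    hence "\<not> l dvd f l" by (auto dest: dvd_imp_le)
    moreover have "\<not> l dvd b" using b(1) pl by (metis coprime_common_divisor not_prime_unit)
    ultimately have "\<not> l dvd b * f l" using pl(1) prime_dvd_mult_iff by blast
    hence "(b * f l) mod l \<noteq> 0" by (simp add: dvd_eq_mod_eq_0)
    thus "g l \<in> {1..<l}" using l prime_gt_0_nat[OF pl(1)] by (simp add: g_def)
  qed (simp add: g_def)
  ultimately show ?thesis by (auto simp: root_prods_def)
qed

text \<open>Every exponent is prime to its \<open>l\<close> and can be cancelled, so all elements of
  \<open>root_prods\<close> have the same stabilizer.\<close>

lemma aut_fix_root_prods_iff:
  assumes "\<sigma> \<in> auts L \<rat>" "\<sigma> \<zeta> = \<zeta> ^ b" "y \<in> root_prods"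
  shows "\<sigma> y = y \<longleftrightarrow> (\<forall>l\<in>n_primes. [b = 1] (mod l))"
proof -
  obtain f where f: "f \<in> (\<Pi>\<^sub>E l\<in>n_primes. {1..<l})" "y = root_prod f" using assms(3) by (auto simp: root_prods_def)
  have "[b * f l = f l] (mod l) \<longleftrightarrow> [b = 1] (mod l)" if l: "l \<in> n_primes" for l
  proof -
    have pl: "prime l" using l by (simp add: n_primes_def)
    have "f l \<in> {1..<l}" using f(1) l by (rule PiE_mem)
    hence "\<not> l dvd f l" by (auto dest: dvd_imp_le)
    hence "coprime l (f l)" by (rule prime_imp_coprime_nat[OF pl])
    hence "coprime (f l) l" by (simp only: coprime_commute)
    thus ?thesis using cong_mult_rcancel_nat[of "f l" l b 1] by simp
  qed
  thus ?thesis unfolding f(2) aut_root_prod[OF assms(1,2)] root_prod_eq_iff by simp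
qed

end

context conductor
begin

text \<open>The product of the wild inertia groups of the conductor field over \<open>K\<close>.\<close>

definition N where "N = {\<sigma> \<in> H. \<exists>b. \<sigma> \<zeta> = \<zeta> ^ b \<and> rad_one b}"

lemma rad_one_iff: "rad_one b \<longleftrightarrow> (\<forall>l\<in>n_primes. [b = 1] (mod l))"
  by (auto simp: rad_one_def n_primes_def)

text \<open>The sign of \<open>sum_root_prods\<close> is absorbed into \<open>x0\<close>. The last
  clause places \<open>x0\<close> in the field of \<open>m\<close>-th roots of unity in the wild
  case, so that \<open>E\<close> and \<open>\<tau>\<close> fix it.\<close>

lemma minimal_trace:
  obtains x0 where "x0 \<in> \<O> L" "K.Tr x0 = of_nat (card N)"
    "\<And>\<sigma> b. \<sigma> \<in> auts L \<rat> \<Longrightarrow> \<sigma> \<zeta> = \<zeta> ^ b \<Longrightarrow> rad_one b \<Longrightarrow> \<sigma> x0 = x0"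
proof -
  have W: "finite root_prods" "root_prods \<subseteq> L"
    by (auto simp: root_prods_def root_prod_in_L intro!: finite_imageI finite_PiE)
  have stab: "{\<sigma> \<in> auts L K. \<sigma> y = y} = N" if y: "y \<in> root_prods" for y
  proof -
    have "\<sigma> y = y \<longleftrightarrow> (\<exists>b. \<sigma> \<zeta> = \<zeta> ^ b \<and> rad_one b)" if "\<sigma> \<in> H" for \<sigma>
    proof -
      have \<sigma>: "\<sigma> \<in> auts L \<rat>" using that H_subset by blast
      obtain b where b: "coprime b n" "\<sigma> \<zeta> = \<zeta> ^ b" using aut_zeta[OF \<sigma>] .
      show ?thesis using aut_fix_root_prods_iff[OF \<sigma> _ y] b(2) unfolding rad_one_iff by blast
    qed
    thus ?thesis unfolding N_def H_def by blast
  qed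
  have "\<exists>R\<subseteq>root_prods. K.Tr (\<Sum>R) = of_nat (card N) * \<Sum>root_prods"
  proof (rule K.orbit_transversal[OF W])
    show "\<sigma> y \<in> root_prods" if "\<sigma> \<in> auts L K" "y \<in> root_prods" for \<sigma> y
      using aut_root_prods[OF _ that(2)] that(1) H_subset unfolding H_def by blast
    show "card {\<sigma> \<in> auts L K. \<sigma> y = y} = card N" if "y \<in> root_prods" for y
      unfolding stab[OF that] ..
  qed
  then obtain R where R: "R \<subseteq> root_prods" "K.Tr (\<Sum>R) = of_nat (card N) * \<Sum>root_prods" by blast
  define x0 where "x0 = (-1) ^ card n_primes * \<Sum>R"
  have RL: "\<Sum>R \<in> L" using R(1) W(2) by (intro L.sum) auto
  have "algebraic_int y" if "y \<in> root_prods" for y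
    using that by (auto simp: root_prods_def root_prod_def intro!: algebraic_int_prod algebraic_int_power)
  hence "\<Sum>R \<in> \<O> L" using RL R(1) by (auto simp: ring_of_integers_def intro!: algebraic_int_sum)
  hence 1: "x0 \<in> \<O> L" unfolding x0_def by (intro L.integers_closed) auto
  have "K.Tr x0 = (-1) ^ card n_primes * K.Tr (\<Sum>R)"
    unfolding x0_def by (rule K.Tr_mult) (auto intro!: K.power K.uminus RL)
  also have "\<dots> = of_nat (card N) * ((-1) ^ card n_primes * (-1) ^ card n_primes)"
    unfolding R(2) sum_root_prods by simp
  also have "\<dots> = of_nat (card N)" by (simp add: power_add[symmetric] mult_2[symmetric])
  finally have 2: "K.Tr x0 = of_nat (card N)" .
  have 3: "\<sigma> x0 = x0" if \<sigma>: "\<sigma> \<in> auts L \<rat>" "\<sigma> \<zeta> = \<zeta> ^ b" "rad_one b" for \<sigma> b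
  proof -
    have "\<sigma> y = y" if "y \<in> R" for y
      using aut_fix_root_prods_iff[OF \<sigma>(1,2)] that R(1) \<sigma>(3) unfolding rad_one_iff by blast
    moreover have "\<sigma> (\<Sum>R) = (\<Sum>y\<in>R. \<sigma> y)" using R(1) W(2) by (intro L.aut_sum[OF \<sigma>(1)]) auto
    ultimately have "\<sigma> (\<Sum>R) = \<Sum>R" by simp
    moreover have "\<sigma> ((-1) ^ card n_primes) = (-1) ^ card n_primes"
      using L.aut_power[OF \<sigma>(1), of "-1"] L.aut_of_int[OF \<sigma>(1), of "-1"] by auto
    ultimately show ?thesis unfolding x0_def
      by (subst L.aut_mult[OF \<sigma>(1)]) (auto intro!: L.power L.uminus RL)
  qed
  show thesis using that 1 2 3 by blast
qed

lemma id_in_N: "(\<lambda>x\<in>L. x) \<in> N"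
  unfolding N_def using H_id by (auto simp: rad_one_def intro!: exI[of _ 1])

lemma N_exp:
  assumes "\<sigma> \<in> N" obtains b where "\<sigma> \<in> H" "\<sigma> \<zeta> = \<zeta> ^ b" "rad_one b" "H_exp b"
  using assms unfolding N_def H_exp_def by blast

lemma N_eqI:
  assumes "\<sigma> \<in> N" "\<tau> \<in> N" "\<sigma> \<zeta> = \<zeta> ^ b" "\<tau> \<zeta> = \<zeta> ^ c" "[b = c] (mod n)"
  shows "\<sigma> = \<tau>"
  using assms zeta_power_eq_iff[OF n_pos, of b c] by (intro K.aut_eqI) (auto simp: N_def H_def)

text \<open>Nontrivial exponents are 3 modulo 4, but a product of two of them is 9, that is 1,
  modulo 4. So the product is trivial, and as squares are trivial too, the two exponents
  agree.\<close>

lemma wild_structure: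
  assumes "N \<noteq> {\<lambda>x\<in>L. x}"
  defines "e \<equiv> multiplicity 2 n"
  obtains \<tau> b where "\<tau> \<in> H" "\<tau> \<zeta> = \<zeta> ^ b" "rad_one b" "\<tau> \<noteq> (\<lambda>x\<in>L. x)" "card N = 2"
    "e \<ge> 3" "[b = 3] (mod 4)" "[b = 1] (mod n div 2 ^ e)" "[b + 1 = 0] (mod 2 ^ (e - 1))" "[b ^ 2 = 1] (mod n)"
proof -
  obtain \<tau> where \<tau>: "\<tau> \<in> N" "\<tau> \<noteq> (\<lambda>x\<in>L. x)" using assms(1) id_in_N by blast
  obtain b where b: "\<tau> \<in> H" "\<tau> \<zeta> = \<zeta> ^ b" "rad_one b" "H_exp b" using N_exp[OF \<tau>(1)] .
  have nontriv: "\<not> [c = 1] (mod n)" if "\<sigma> \<in> N" "\<sigma> \<zeta> = \<zeta> ^ c" "\<sigma> \<noteq> (\<lambda>x\<in>L. x)" for \<sigma> c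
    using N_eqI[OF that(1) id_in_N that(2), of 1] that(3) by auto
  note w = rad_one_trivial_or_wild[OF b(4,3) nontriv[OF \<tau>(1) b(2) \<tau>(2)]]
  have sq: "[b ^ 2 = 1] (mod n)" by (rule rad_one_square[OF b(4,3)])
  have "\<sigma> = \<tau>" if \<sigma>: "\<sigma> \<in> N" "\<sigma> \<noteq> (\<lambda>x\<in>L. x)" for \<sigma>
  proof -
    obtain c where c: "\<sigma> \<in> H" "\<sigma> \<zeta> = \<zeta> ^ c" "rad_one c" "H_exp c" using N_exp[OF \<sigma>(1)] .
    note w' = rad_one_trivial_or_wild[OF c(4,3) nontriv[OF \<sigma>(1) c(2) \<sigma>(2)]]
    have "[b * c = 3 * 3] (mod 4)" by (rule cong_mult[OF w(1) w'(1)])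
    hence "\<not> [b * c = 3] (mod 4)" by (simp add: cong_def)
    hence bc: "[b * c = 1] (mod n)"
      using rad_one_trivial_or_wild(1)[OF H_exp_mult[OF b(4) c(4)] rad_one_mult[OF b(3) c(3)]] by blast
    have "[b * (b * c) = b * 1] (mod n)" by (rule cong_scalar_left[OF bc])
    moreover have "[b ^ 2 * c = 1 * c] (mod n)" by (rule cong_scalar_right[OF sq])
    ultimately have "[c = b] (mod n)" by (simp add: power2_eq_square mult.assoc) (metis cong_sym cong_trans)
    thus ?thesis using N_eqI[OF \<sigma>(1) \<tau>(1) c(2) b(2)] by blast
  qed
  hence "N = {\<lambda>x\<in>L. x, \<tau>}" using id_in_N \<tau>(1) by blast
  hence "card N = 2" using \<tau>(2) by simp
  thus thesis using that[of \<tau> b] b \<tau>(2) w sq unfolding e_def by blast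
qed

end

section \<open>Ramification of the conductor field\<close>

context prime_split
begin

lemma xi_root: "\<xi> ^ (p ^ a) = 1"
  unfolding \<xi>_def using p_pos by simp

lemma xi_nonzero: "\<xi> \<noteq> 0"
  by (simp add: \<xi>_def)

lemma xi_integer [simp, intro]: "\<xi> \<in> int_adjoin \<zeta>"
  by (auto intro: int_adjoin_xi)

lemma xi_in_L: "\<xi> \<in> L" "\<xi> ^ k \<in> L"
  by (auto simp: xi_eq power_mult[symmetric])

lemma aut_xi:
  assumes "\<sigma> \<in> auts L \<rat>" "\<sigma> \<zeta> = \<zeta> ^ b" shows "\<sigma> \<xi> = \<xi> ^ b"
  by (simp add: xi_eq L.aut_power[OF assms(1)] assms(2) power_mult[symmetric] mult.commute)

lemma aut_zeta_m:
  assumes "\<sigma> \<in> auts L \<rat>" "\<sigma> \<zeta> = \<zeta> ^ b" shows "\<sigma> (zeta m) = zeta m ^ b"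
  by (simp add: zeta_m_eq L.aut_power[OF assms(1)] assms(2) power_mult[symmetric] mult.commute)

text \<open>The cofactor of \<open>\<theta>\<close> is a sum of \<open>k\<close> powers of
  \<open>\<xi>\<close>, each congruent to 1 modulo \<open>\<theta>\<close>. Thus an automorphism
  with exponent \<open>k\<close> multiplies \<open>\<theta>\<close> by \<open>k\<close> to first
  order.\<close>

lemma one_minus_xi_power_mod:
  assumes "a > 0"
  shows "\<exists>w\<in>int_adjoin \<zeta>. 1 - \<xi> ^ k = \<theta> * (of_nat k + \<theta> * w)"
proof -
  define w where "w = - (\<Sum>j<k. \<Sum>i<j. \<xi> ^ i)"
  have d: "1 - \<xi> ^ j = \<theta> * (\<Sum>i<j. \<xi> ^ i)" for j
    using one_diff_power_eq[of \<xi> j] assms by (simp add: \<theta>_def)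
  have xi: "\<xi> ^ j = 1 - \<theta> * (\<Sum>i<j. \<xi> ^ i)" for j
    unfolding d[symmetric] by simp
  note d[of k]
  also have "(\<Sum>j<k. \<xi> ^ j) = (\<Sum>j<k. 1 - \<theta> * (\<Sum>i<j. \<xi> ^ i))" by (rule sum.cong[OF refl xi])
  also have "\<dots> = of_nat k + \<theta> * w" by (simp add: sum_subtractf w_def sum_distrib_left)
  finally show ?thesis
    by (intro bexI[of _ w]) (auto simp: w_def intro!: int_adjoin_uminus int_adjoin_sum int_adjoin_power)
qed

lemma one_minus_xi_power_unit:
  assumes "a > 0" "coprime k p"
  obtains u v where "u \<in> int_adjoin \<zeta>" "v \<in> int_adjoin \<zeta>" "u * v = 1" "1 - \<xi> ^ k = \<theta> * u"
proof -
  have "p ^ a > 1" using one_less_power p_pos(2) assms(1) by blast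
  moreover have "coprime k (p ^ a)" using assms(2) by simp
  ultimately obtain u v where "u \<in> int_adjoin \<xi>" "v \<in> int_adjoin \<xi>" "u * v = 1" "1 - \<xi> ^ k = (1 - \<xi>) * u"
    unfolding \<xi>_def by (rule one_minus_zeta_power_unit)
  thus thesis by (intro that[of u v]) (use assms(1) in \<open>simp_all add: \<theta>_def int_adjoin_xi\<close>)
qed

lemma theta_not_unit: "y \<in> \<O> L \<Longrightarrow> \<theta> * y \<noteq> 1"
proof
  assume y: "y \<in> \<O> L" "\<theta> * y = 1"
  obtain U V where UV: "U \<in> int_adjoin \<zeta>" "V \<in> int_adjoin \<zeta>" "U * V = 1" "of_nat p = \<theta> ^ q * U" by (rule p_theta)
  have "of_nat p * (V * y ^ q) = (\<theta> * y) ^ q * (U * V)" using UV(4) by (simp add: power_mult_distrib mult_ac)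
  hence "of_nat 1 = of_nat p * (V * y ^ q)" using y(2) UV(3) by simp
  moreover have "algebraic_int (V * y ^ q)"
    using y(1) int_adjoin_algebraic_int[OF _ UV(2)]
    by (intro algebraic_int_plus_times algebraic_int_power) (auto simp: ring_of_integers_def)
  ultimately have "p dvd 1" using algebraic_int_of_nat_divide[OF p_pos(1)] by blast
  thus False using p_pos(2) by simp
qed

end

context prime_over
begin

text \<open>\<open>\<mu> ^ N\<close> is \<open>\<mu>\<close> modulo \<open>\<theta>\<close>, so
  \<open>\<mu> ^ (N - 2)\<close> inverts \<open>\<mu>\<close> modulo \<open>P\<close>.\<close>

lemma exists_inverse_mod_P:
  assumes "\<mu> \<in> \<O> L" "\<mu> \<notin> P"
  obtains \<nu> where "\<nu> \<in> \<O> L" "1 - \<nu> * \<mu> \<in> P"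
proof -
  define N where "N = p ^ (totient m * 1)"
  have "p \<le> N" unfolding N_def using p_pos m_pos by (intro self_le_power) auto
  hence N: "N \<ge> 2" using p_pos(2) by simp
  obtain w where w: "w \<in> \<O> L" "\<mu> ^ N = \<mu> + \<theta> * w"
    using frobenius_theta[of \<mu> 1] assms(1) unfolding N_def integers_L by blast
  have "\<mu> * (1 - \<mu> ^ (N - 1)) = \<theta> * (- w)"
    using w(2) power_minus_mult[of N \<mu>] N by (simp add: algebra_simps)
  moreover have "\<theta> * (- w) \<in> P" using w(1) by (intro theta_mult_in_P) auto
  ultimately have "\<mu> * (1 - \<mu> ^ (N - 1)) \<in> P" by simp
  hence "1 - \<mu> ^ (N - 1) \<in> P" using assms P_prime[of \<mu> "1 - \<mu> ^ (N - 1)"] by auto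
  moreover have "\<mu> ^ (N - 1) = \<mu> ^ (N - 2) * \<mu>"
    using power_minus_mult[of "N - 1" \<mu>] N by (simp add: numeral_2_eq_2)
  ultimately show thesis using that[of "\<mu> ^ (N - 2)"] assms(1) by auto
qed

lemma P_power_ideal: "ideal (P_power k) (integer_ring L)"
  by (rule L.ideal_power_ideal[OF P_ideal])

text \<open>For the converse of \<open>P_power_cofactor\<close> let
  \<open>\<pi> = 1 - \<nu> * \<mu>\<close>, an element of \<open>P\<close>. Then
  \<open>1 - \<pi> ^ k\<close> is a multiple of \<open>\<mu>\<close>, which splits \<open>x\<close>
  into a multiple of \<open>\<theta> ^ k\<close> and \<open>\<pi> ^ k * x\<close>, both in the
  \<open>k\<close>-th power.\<close>

lemma P_power_iff:
  assumes x: "x \<in> \<O> L"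
  shows "x \<in> P_power k \<longleftrightarrow> (\<exists>\<mu>\<in>\<O> L - P. \<exists>y\<in>\<O> L. \<mu> * x = \<theta> ^ k * y)"
proof
  assume "\<exists>\<mu>\<in>\<O> L - P. \<exists>y\<in>\<O> L. \<mu> * x = \<theta> ^ k * y"
  then obtain \<mu> y where \<mu>: "\<mu> \<in> \<O> L" "\<mu> \<notin> P" "y \<in> \<O> L" "\<mu> * x = \<theta> ^ k * y" by blast
  obtain \<nu> where \<nu>: "\<nu> \<in> \<O> L" "1 - \<nu> * \<mu> \<in> P" using exists_inverse_mod_P[OF \<mu>(1,2)] .
  define \<pi> where "\<pi> = 1 - \<nu> * \<mu>"
  have \<pi>: "\<pi> \<in> \<O> L" using \<nu> \<mu> by (auto simp: \<pi>_def)
  have "1 - \<pi> ^ k = \<nu> * \<mu> * (\<Sum>i<k. \<pi> ^ i)" using one_diff_power_eq[of \<pi> k] by (simp add: \<pi>_def)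
  hence "x * (1 - \<pi> ^ k) = \<nu> * (\<Sum>i<k. \<pi> ^ i) * (\<mu> * x)" by simp
  hence "x = \<theta> ^ k * (\<nu> * (\<Sum>i<k. \<pi> ^ i) * y) + \<pi> ^ k * x" unfolding \<mu>(4) by (simp add: algebra_simps)
  moreover have "\<theta> ^ k * (\<nu> * (\<Sum>i<k. \<pi> ^ i) * y) \<in> P_power k"
    using \<nu>(1) \<mu>(3) \<pi> by (intro theta_power_in L.integers_closed L.integers_sum)
  moreover have "\<pi> ^ k * x \<in> P_power k"
    using \<nu>(2) x by (intro L.mult_power_in_ideal_power[OF P_ideal]) (simp_all add: \<pi>_def)
  ultimately show "x \<in> P_power k" using L.ideal_add[OF P_power_ideal] by metis
qed (rule P_power_cofactor)

lemma theta_power_cancel_iff: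
  assumes "x \<in> \<O> L"
  shows "\<theta> ^ i * x \<in> P_power (i + k) \<longleftrightarrow> x \<in> P_power k"
proof -
  have "\<mu> * (\<theta> ^ i * x) = \<theta> ^ (i + k) * y \<longleftrightarrow> \<mu> * x = \<theta> ^ k * y" for \<mu> y
  proof -
    have 1: "\<mu> * (\<theta> ^ i * x) = \<theta> ^ i * (\<mu> * x)" by simp
    have 2: "\<theta> ^ (i + k) * y = \<theta> ^ i * (\<theta> ^ k * y)" by (simp only: power_add mult.assoc)
    show ?thesis unfolding 1 2 using theta_nonzero by simp
  qed
  moreover have "\<theta> ^ i * x \<in> \<O> L" using assms theta_integer by auto
  ultimately show ?thesis using assms by (simp add: P_power_iff)
qed

end

context conductor
begin

lemma integers_K_subset: "\<O> K \<subseteq> \<O> L"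
  using K.F_in_L by (auto simp: ring_of_integers_def)

lemma K_Tr_integer: "x \<in> \<O> L \<Longrightarrow> K.Tr x \<in> \<O> K"
  by (auto simp: ring_of_integers_def intro: K.Tr_in_F K.Tr_algebraic_int)

lemma K_Tr_aut:
  assumes "\<sigma> \<in> auts L \<rat>" "x \<in> L" shows "K.Tr (\<sigma> x) = \<sigma> (K.Tr x)"
proof -
  have "K.Tr (\<sigma> x) = (\<Sum>\<rho>\<in>auts L K. \<sigma> (\<rho> x))"
    unfolding aut_trace_def using auts_commute[OF _ assms] H_subset unfolding H_def by (intro sum.cong refl) blast
  also have "\<dots> = \<sigma> (K.Tr x)"
    unfolding aut_trace_def by (rule L.aut_sum[OF assms(1), symmetric]) (use L.aut_closed assms(2) in blast)
  finally show ?thesis .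
qed

text \<open>If the trace of \<open>x0\<close> is 1, then the trace of \<open>x0 * \<theta> ^ (p - 1)\<close> has valuation exactly \<open>p - 1\<close>
  at \<open>P\<close>, because every element of \<open>H\<close> fixes \<open>\<theta> ^ (p - 1)\<close> modulo \<open>\<theta> ^ p\<close> by Fermat.\<close>

lemma tame_witness:
  assumes "prime_over n p a m P" and x0: "x0 \<in> \<O> L" "K.Tr x0 = 1"
  shows "\<not> P \<inter> \<O> K \<subseteq> P [^]\<^bsub>ideals_set (integer_ring L)\<^esub> p"
proof
  interpret P: prime_over n p a m P by (rule assms(1))
  assume sub: "P \<inter> \<O> K \<subseteq> P.P_power p"
  have p1: "Suc (p - 1) = p" using P.p_pos by simp
  show False
  proof (cases "a = 0")
    case True
    \<comment> \<open>In the unramified case \<open>p\<close> itself is an integer of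
      \<open>K\<close> with valuation 1 at \<open>P\<close>.\<close>
    have \<theta>: "P.\<theta> = of_nat p" unfolding P.\<theta>_def using True by simp
    have "of_nat p \<in> P \<inter> \<O> K" using P.p_in_P by (auto simp: ring_of_integers_def)
    hence "of_nat p \<in> P.P_power p" using sub by blast
    hence "of_nat p \<in> P.P_power 2" using P.P_power_decseq[of 2 p] P.p_pos(2) by auto
    hence "P.\<theta> ^ 1 * 1 \<in> P.P_power (Suc 1)" by (simp only: \<theta> power_one_right mult_1_right Suc_1)
    hence "1 \<in> P" by (intro P.theta_power_cancel[of 1 1]) auto
    thus False using P.one_notin_P by blast
  next
    case False
    have sig: "\<exists>y\<in>\<O> L. \<sigma> (P.\<theta> ^ (p - 1)) = P.\<theta> ^ (p - 1) * (1 + P.\<theta> * y)" if "\<sigma> \<in> H" for \<sigma>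
    proof -
      have \<sigma>: "\<sigma> \<in> auts L \<rat>" using that H_subset by blast
      obtain b where b: "coprime b n" "\<sigma> \<zeta> = \<zeta> ^ b" using aut_zeta[OF \<sigma>] .
      have "\<sigma> P.\<theta> = 1 - \<sigma> P.\<xi>" using False P.xi_in_L
        by (simp add: P.\<theta>_def L.aut_diff[OF \<sigma>] L.aut_one[OF \<sigma>])
      hence "\<sigma> P.\<theta> = 1 - P.\<xi> ^ b" using P.aut_xi[OF \<sigma> b(2)] by simp
      then obtain w where w: "w \<in> int_adjoin \<zeta>" "\<sigma> P.\<theta> = P.\<theta> * (of_nat b + P.\<theta> * w)"
        using P.one_minus_xi_power_mod[of b] False by auto
      obtain w' where w': "w' \<in> int_adjoin \<zeta>"
        "(of_nat b + P.\<theta> * w) ^ (p - 1) = of_nat b ^ (p - 1) + P.\<theta> * w'"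
        using P.power_theta_mod[of "of_nat b" w "p - 1"] w(1) by auto
      have "p dvd n" using False by (simp add: P.n_eq)
      hence "\<not> p dvd b" using b(1) P.prime_p by (metis coprime_common_divisor not_prime_unit)
      hence "[b ^ (p - 1) = 1] (mod p)" by (rule fermat_theorem[OF P.prime_p])
      hence "int p dvd int b ^ (p - 1) - 1" by (metis cong_iff_dvd_diff cong_int_iff of_nat_1 of_nat_power)
      then obtain c where "int b ^ (p - 1) - 1 = int p * c" by (auto elim: dvdE)
      hence "int b ^ (p - 1) = 1 + int p * c" by simp
      hence c: "of_nat b ^ (p - 1) = (1 + of_nat p * of_int c :: complex)"
        by (metis of_int_1 of_int_add of_int_mult of_int_of_nat_eq of_int_power)
      obtain p' where p': "p' \<in> int_adjoin \<zeta>" "of_nat p = P.\<theta> * p'" by (rule P.p_theta_dvd)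
      have "P.\<theta> \<in> L" using P.theta_integer by (simp add: ring_of_integers_def)
      hence "\<sigma> (P.\<theta> ^ (p - 1)) = (\<sigma> P.\<theta>) ^ (p - 1)" by (rule L.aut_power[OF \<sigma>])
      also have "\<dots> = P.\<theta> ^ (p - 1) * (1 + P.\<theta> * (p' * of_int c + w'))"
        unfolding w(2) power_mult_distrib w'(2) c p'(2) by (simp add: algebra_simps)
      finally show ?thesis using p' w' unfolding P.integers_L
        by (intro bexI[of _ "p' * of_int c + w'"]) auto
    qed
    then obtain Y where Y: "\<And>\<sigma>. \<sigma> \<in> H \<Longrightarrow> Y \<sigma> \<in> \<O> L"
      "\<And>\<sigma>. \<sigma> \<in> H \<Longrightarrow> \<sigma> (P.\<theta> ^ (p - 1)) = P.\<theta> ^ (p - 1) * (1 + P.\<theta> * Y \<sigma>)" by metis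
    define z where "z = K.Tr (x0 * P.\<theta> ^ (p - 1))"
    define T where "T = (\<Sum>\<sigma>\<in>H. \<sigma> x0 * Y \<sigma>)"
    have th: "P.\<theta> ^ (p - 1) \<in> \<O> L" using P.theta_integer by auto
    have xL: "x0 \<in> L" "P.\<theta> ^ (p - 1) \<in> L" using x0(1) th by (auto simp: ring_of_integers_def)
    have \<sigma>x: "\<sigma> x0 \<in> \<O> L" if "\<sigma> \<in> H" for \<sigma>
      using L.aut_closed[of \<sigma> \<rat> x0] L.aut_algebraic_int[of \<sigma> \<rat> x0] that H_subset x0(1)
      by (auto simp: ring_of_integers_def)
    have T: "T \<in> \<O> L" unfolding T_def using Y(1) \<sigma>x by (intro L.integers_sum) auto
    have "z = (\<Sum>\<sigma>\<in>H. \<sigma> x0 * (P.\<theta> ^ (p - 1) * (1 + P.\<theta> * Y \<sigma>)))"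
      unfolding z_def aut_trace_def H_def[symmetric]
    proof (rule sum.cong[OF refl])
      fix \<sigma> assume \<sigma>: "\<sigma> \<in> H"
      have "\<sigma> (x0 * P.\<theta> ^ (p - 1)) = \<sigma> x0 * \<sigma> (P.\<theta> ^ (p - 1))"
        using L.aut_mult[of \<sigma> \<rat>] xL \<sigma> H_subset by blast
      thus "\<sigma> (x0 * P.\<theta> ^ (p - 1)) = \<sigma> x0 * (P.\<theta> ^ (p - 1) * (1 + P.\<theta> * Y \<sigma>))" using Y(2)[OF \<sigma>] by simp
    qed
    also have "\<dots> = P.\<theta> ^ (p - 1) * (K.Tr x0 + P.\<theta> * T)"
      by (simp add: aut_trace_def H_def[symmetric] T_def sum_distrib_left sum_distrib_right sum.distrib algebra_simps)
    finally have z: "z = P.\<theta> ^ (p - 1) * (1 + P.\<theta> * T)" using x0(2) by simp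
    have "z \<in> \<O> K" unfolding z_def using x0(1) th by (intro K_Tr_integer) auto
    moreover have "z \<in> P"
    proof -
      have "P.\<theta> ^ (p - 1) = P.\<theta> * P.\<theta> ^ (p - 2)" using P.p_pos(2) power_minus_mult[of "p - 1" P.\<theta>]
        by (simp add: mult.commute numeral_2_eq_2)
      hence "z = P.\<theta> * (P.\<theta> ^ (p - 2) * (1 + P.\<theta> * T))" unfolding z by simp
      thus ?thesis using T P.theta_integer by (auto intro!: P.theta_mult_in_P)
    qed
    ultimately have "P.\<theta> ^ (p - 1) * (1 + P.\<theta> * T) \<in> P.P_power (Suc (p - 1))" using sub z p1 by auto
    hence "1 + P.\<theta> * T \<in> P" using T P.theta_integer by (intro P.theta_power_cancel[of _ "p - 1"]) auto
    hence "(1 + P.\<theta> * T) - P.\<theta> * T \<in> P" using P.theta_mult_in_P[OF T] by (rule P.P_diff)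
    thus False using P.one_notin_P by simp
  qed
qed

text \<open>At a prime above \<open>l\<close> the ramification index lies between 1 and
  \<open>l - 1\<close>, so \<open>l\<close> does not divide it. The same bound shows that the
  maximum defining the index exists.\<close>

theorem tamely_ramified_if_trivial:
  assumes "N = {\<lambda>x\<in>L. x}"
  shows "tamely_ramified L K"
  unfolding tamely_ramified_def
proof (intro allI impI notI)
  fix \<pp> assume "primeideal \<pp> (integer_ring K) \<and> \<pp> \<noteq> {0}" "wildly_ramified_at L K \<pp>"
  then obtain P l where P: "primeideal P (integer_ring L)" "prime l" "of_nat l \<in> P" "l dvd ramification_index L K P"
    unfolding wildly_ramified_at_def by blast
  obtain m where "prime_split n l (multiplicity l n) m" by (rule prime_split_exists[OF P(2) n_positive])
  then interpret P: prime_over n l "multiplicity l n" m P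
    using P by (simp add: prime_over_def prime_over_axioms_def)
  obtain x0 where x0: "x0 \<in> \<O> L" "K.Tr x0 = of_nat (card N)" by (rule minimal_trace)
  define e where "e = ramification_index L K P"
  have e: "e = (GREATEST k. P \<inter> \<O> K \<subseteq> P.P_power k)"
    unfolding e_def by (rule P.ramification_index_eq) (use integers_K_subset in blast)
  have 1: "P \<inter> \<O> K \<subseteq> P.P_power 1" unfolding P.P_power_1 by blast
  have less: "k \<le> l - 1" if "P \<inter> \<O> K \<subseteq> P.P_power k" for k
  proof (rule ccontr)
    assume "\<not> k \<le> l - 1"
    hence "P.P_power k \<subseteq> P.P_power l" by (intro P.P_power_decseq) simp
    hence "P \<inter> \<O> K \<subseteq> P.P_power l" using that by blast
    moreover have "\<not> P \<inter> \<O> K \<subseteq> P.P_power l"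
      by (rule tame_witness[OF P.prime_over_axioms x0(1)]) (simp add: x0(2) assms)
    ultimately show False by blast
  qed
  have "P \<inter> \<O> K \<subseteq> P.P_power e" unfolding e
    by (rule GreatestI_nat[where P = "\<lambda>k. P \<inter> \<O> K \<subseteq> P.P_power k" and b = "l - 1", OF 1]) (rule less)
  hence "e \<le> l - 1" by (rule less)
  moreover have "1 \<le> e" unfolding e
    by (rule Greatest_le_nat[where P = "\<lambda>k. P \<inter> \<O> K \<subseteq> P.P_power k" and b = "l - 1", OF 1]) (rule less)
  ultimately show False using P(4) P.p_pos(2) by (auto simp: e_def dest!: dvd_imp_le)
qed

end

section \<open>The wildly ramified case\<close>

text \<open>Here \<open>m\<close> is the odd part of \<open>n\<close>. By the congruences for
  \<open>b\<close>, \<open>\<tau>\<close> fixes the \<open>m\<close>-th roots of unity and maps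
  \<open>\<xi>\<close> to \<open>1 / \<xi>\<close> up to sign.\<close>

locale wild = conductor n K + prime_split n 2 e m for n K e m +
  fixes \<tau> :: "complex \<Rightarrow> complex" and b :: nat
  assumes e3: "e \<ge> 3" and tau_H: "\<tau> \<in> H" and tau_zeta: "\<tau> \<zeta> = \<zeta> ^ b" and tau_nontrivial: "\<tau> \<noteq> (\<lambda>x\<in>L. x)"
    and b_m: "[b = 1] (mod m)" and b_2: "[b + 1 = 0] (mod 2 ^ (e - 1))" and b_sq: "[b ^ 2 = 1] (mod n)"
    and card_N: "card N = 2"
begin

lemma tau_aut: "\<tau> \<in> auts L \<rat>"
  using tau_H H_subset by blast

lemma tau_tau: "x \<in> L \<Longrightarrow> \<tau> (\<tau> x) = x"
proof -
  assume x: "x \<in> L"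
  have "compose L \<tau> \<tau> = (\<lambda>x\<in>L. x)"
  proof (rule aut_eqI[OF L.auts_compose[OF tau_aut tau_aut F_subset] L.auts_one[OF F_subset]])
    show "compose L \<tau> \<tau> \<zeta> = (\<lambda>x\<in>L. x) \<zeta>"
      using b_sq zeta_power_eq_iff[OF n_pos, of "b ^ 2" 1]
      by (simp add: compose_eq tau_zeta L.aut_power[OF tau_aut] power_mult[symmetric] power2_eq_square)
  qed
  thus ?thesis using x by (metis compose_eq restrict_apply')
qed

lemma q_eq: "q = 2 ^ (e - 1)"
  using e3 by (simp add: q_def totient_prime_power)

definition h where "h = q div 2"

text \<open>\<open>e >= 3\<close> makes \<open>h = 2 ^ (e - 2)\<close> even, which later forces the
  middle coefficient of a \<open>\<tau>\<close>-fixed integer to vanish.\<close>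

lemma q_h: "q = 2 * h" "even h" "h > 0"
proof -
  have "e - 1 = Suc (Suc (e - 3))" using e3 by simp
  hence q: "q = 2 * (2 * 2 ^ (e - 3))" unfolding q_eq by (simp only: power_Suc)
  show "q = 2 * h" "even h" "h > 0" unfolding h_def q by auto
qed

lemma pow_e: "2 ^ e = 2 * q"
  using e3 by (simp add: q_eq power_eq_if)

lemma xi_q: "\<xi> ^ q = -1"
proof -
  have "(\<xi> ^ q) ^ 2 = 1" using xi_root by (simp add: pow_e power_mult[symmetric] mult.commute)
  moreover have "\<xi> ^ q \<noteq> 1"
    using zeta_power_eq_1_iff[of "2 ^ e" q] q_pos unfolding \<xi>_def pow_e by (auto dest: dvd_imp_le)
  ultimately show ?thesis by (simp add: power2_eq_1_iff)
qed

lemma M_L_subset: "M.L \<subseteq> L"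
proof
  fix x assume "x \<in> M.L"
  then obtain p where p: "p \<in> polys_over \<rat>" "x = poly p (zeta m)" by (rule M.in_LE)
  have "zeta m \<in> L" by (simp add: zeta_m_eq)
  moreover have "coeff p i \<in> L" for i using p(1) L.Rats_subset by (auto simp: polys_over_def)
  ultimately show "x \<in> L" unfolding p(2) poly_altdef by (auto intro!: L.sum L.mult L.power)
qed

sublocale W: sub_cyclotomic "cyclotomic_field m" n
  by (rule sub_cyclotomic.intro[OF M.L.complex_subfield_axioms]) (simp add: sub_cyclotomic_axioms_def n_positive M_L_subset)

lemma int_adjoin_M: "x \<in> int_adjoin (zeta m) \<Longrightarrow> x \<in> M.L"
  using cyclotomic_integers[OF m_pos] by (auto simp: ring_of_integers_def)

lemma integers_L: "\<O> L = int_adjoin \<zeta>"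
  by (rule cyclotomic_integers[OF n_pos])

lemma auts_W:
  assumes "\<sigma> \<in> auts L \<rat>" "\<sigma> \<zeta> = \<zeta> ^ c" "[c = 1] (mod m)"
  shows "\<sigma> \<in> auts L M.L"
proof -
  have z: "\<sigma> (zeta m) = zeta m"
    unfolding aut_zeta_m[OF assms(1,2)] using zeta_power_eq_iff[OF m_pos, of c 1] assms(3) by simp
  have "\<sigma> x = x" if xM: "x \<in> M.L" for x
  proof -
    obtain p where p: "p \<in> polys_over \<rat>" "x = poly p (zeta m)" by (rule M.in_LE[OF xM])
    have "zeta m \<in> L" by (simp add: zeta_m_eq)
    thus ?thesis using L.aut_poly_fix[OF assms(1) p(1) F_subset, of "zeta m"] z p(2) by simp
  qed
  thus ?thesis using assms(1) unfolding auts_iff by blast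
qed

lemma auts_W_subset: "auts L M.L \<subseteq> auts L \<rat>"
  by (rule auts_mono) (rule M.L.Rats_subset)

text \<open>On the basis of the context this is the projection onto the components with \<open>i = 0\<close>, so that the
  adjusted trace is the trace of \<open>x - E x / 2\<close>.\<close>

definition E where "E x = W.Tr x / of_nat (card (auts L M.L))"

lemma card_auts_W: "of_nat (card (auts L M.L)) \<noteq> (0 :: complex)"
proof -
  have "(\<lambda>x\<in>L. x) \<in> auts L M.L" by (rule L.auts_one[OF M_L_subset])
  hence "card (auts L M.L) \<noteq> 0" using W.finite_auts by (metis card_eq_0_iff empty_iff)
  thus ?thesis by simp
qed

lemma E_in_M: "x \<in> L \<Longrightarrow> E x \<in> M.L"
  unfolding E_def by (intro M.L.divide W.Tr_in_F) auto

lemma E_in_L: "x \<in> L \<Longrightarrow> E x \<in> L"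
  using E_in_M M_L_subset by blast

lemma E_add: "x \<in> L \<Longrightarrow> y \<in> L \<Longrightarrow> E (x + y) = E x + E y"
  by (simp add: E_def W.Tr_add add_divide_distrib)

lemma E_sum: "(\<And>i. i \<in> I \<Longrightarrow> g i \<in> L) \<Longrightarrow> E (sum g I) = (\<Sum>i\<in>I. E (g i))"
  by (simp add: E_def W.Tr_sum sum_divide_distrib)

lemma E_mult: "c \<in> M.L \<Longrightarrow> x \<in> L \<Longrightarrow> E (c * x) = c * E x"
  by (simp add: E_def W.Tr_mult)

lemma E_one: "E 1 = 1"
  using card_auts_W by (simp add: E_def aut_trace_def L.aut_one cong: sum.cong)

lemma E_M: "c \<in> M.L \<Longrightarrow> E c = c"
  using E_mult[of c 1] by (simp add: E_one L.one)

lemma E_aut: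
  assumes "\<sigma> \<in> auts L \<rat>" "x \<in> L" shows "E (\<sigma> x) = \<sigma> (E x)"
proof -
  have "W.Tr (\<sigma> x) = (\<Sum>\<rho>\<in>auts L M.L. \<sigma> (\<rho> x))"
    unfolding aut_trace_def using auts_commute[OF _ assms] auts_W_subset by (intro sum.cong refl) blast
  also have "\<dots> = \<sigma> (W.Tr x)" unfolding aut_trace_def
    by (rule L.aut_sum[OF assms(1), symmetric]) (use L.aut_closed assms(2) in blast)
  finally show ?thesis unfolding E_def
    by (simp add: L.aut_divide[OF assms(1)] W.Tr_in_L assms(2) L.aut_of_nat[OF assms(1)])
qed

lemma E_aut_W:
  assumes "\<sigma> \<in> auts L M.L" "x \<in> L" shows "E (\<sigma> x) = E x"
  using E_aut[of \<sigma> x] assms auts_W_subset L.aut_fix[OF assms(1) E_in_M] by auto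

text \<open>Some automorphism over the field of \<open>m\<close>-th roots of unity changes the sign
  of \<open>\<xi> ^ i\<close>, while \<open>E\<close> is invariant under it.\<close>

lemma E_xi:
  assumes "0 < i" "i < q"
  shows "E (\<xi> ^ i) = 0"
proof -
  define r where "r = multiplicity 2 i"
  obtain j where j: "i = 2 ^ r * j" "\<not> 2 dvd j"
    using multiplicity_decompose'[of i 2] assms(1) unfolding r_def by auto
  have "2 ^ r \<le> i" using j assms(1) by (cases j) auto
  hence "(2::nat) ^ r < 2 ^ (e - 1)" using assms(2) unfolding q_eq by (rule le_less_trans)
  hence r: "r < e - 1" by (rule power_less_imp_less_exp[rotated]) simp
  \<comment> \<open>Chosen so that \<open>c * i = i + q * (m * j)\<close> with \<open>m * j\<close>
    odd; as \<open>\<xi> ^ q = -1\<close>, the sign changes. It is odd because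
    \<open>r < e - 1\<close>.\<close>
  define c where "c = 1 + m * 2 ^ (e - 1 - r)"
  have c1: "[c = 1] (mod m)" unfolding c_def cong_add_lcancel_0_nat cong_0_iff by simp
  have "coprime c n"
  proof -
    have "coprime c m" using cong_imp_coprime[OF cong_sym[OF c1]] by simp
    moreover have "Suc r < e" using r by arith
    hence "odd c" by (simp add: c_def)
    ultimately show ?thesis unfolding n_eq by (simp add: coprime_commute)
  qed
  then obtain \<sigma> where \<sigma>: "\<sigma> \<in> auts L \<rat>" "\<sigma> \<zeta> = \<zeta> ^ c" by (rule exists_aut)
  have \<sigma>W: "\<sigma> \<in> auts L M.L" using auts_W \<sigma> c1 by blast
  have "c * i = i + q * (m * j)"
  proof -
    have "(2::nat) ^ (e - 1 - r) * 2 ^ r = q" using r by (simp add: q_eq power_add[symmetric])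
    thus ?thesis by (simp add: c_def j(1) algebra_simps)
  qed
  moreover have "(-1 :: complex) ^ (m * j) = -1" using j(2) p_m by (intro neg_one_odd_power) auto
  ultimately have "\<xi> ^ (c * i) = - (\<xi> ^ i)" by (simp add: power_add power_mult[of _ q] xi_q)
  moreover have "\<sigma> (\<xi> ^ i) = \<xi> ^ (c * i)"
    using xi_in_L by (simp add: L.aut_power[OF \<sigma>(1)] aut_xi[OF \<sigma>] power_mult)
  ultimately have "E (- (\<xi> ^ i)) = E (\<xi> ^ i)" using E_aut_W[OF \<sigma>W xi_in_L(2)[of i]] by simp
  moreover have "E (- (\<xi> ^ i)) = - E (\<xi> ^ i)"
    using E_mult[of "-1" "\<xi> ^ i"] xi_in_L by (auto intro: M.L.uminus)
  ultimately show ?thesis by simp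
qed

text \<open>All integers of \<open>L\<close> are integer polynomials in
  \<open>\<zeta> = zeta m ^ s * \<xi> ^ t\<close>, so it suffices that the span \<open>A\<close> is
  stable under \<open>\<xi>\<close> and under \<open>int_adjoin (zeta m)\<close>.\<close>

lemma xi_expansion:
  assumes "x \<in> \<O> L"
  obtains a where "\<And>k. a k \<in> int_adjoin (zeta m)" "x = (\<Sum>k<q. a k * \<xi> ^ k)"
proof -
  define A where "A = {\<Sum>k<q. a k * \<xi> ^ k |a. \<forall>k. a k \<in> int_adjoin (zeta m)}"
  have AI: "x \<in> A" if "\<And>k. a k \<in> int_adjoin (zeta m)" "x = (\<Sum>k<q. a k * \<xi> ^ k)" for x a
    using that by (auto simp: A_def)
  have add: "x + y \<in> A" if xy: "x \<in> A" "y \<in> A" for x y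
  proof -
    obtain a a' where "\<forall>k. a k \<in> int_adjoin (zeta m)" "x = (\<Sum>k<q. a k * \<xi> ^ k)"
      "\<forall>k. a' k \<in> int_adjoin (zeta m)" "y = (\<Sum>k<q. a' k * \<xi> ^ k)" using xy by (auto simp: A_def)
    thus ?thesis by (intro AI[of "\<lambda>k. a k + a' k"]) (auto simp: distrib_right sum.distrib)
  qed
  have mult: "c * x \<in> A" if xc: "c \<in> int_adjoin (zeta m)" "x \<in> A" for c x
  proof -
    obtain a where "\<forall>k. a k \<in> int_adjoin (zeta m)" "x = (\<Sum>k<q. a k * \<xi> ^ k)" using xc(2) by (auto simp: A_def)
    thus ?thesis using xc(1) by (intro AI[of "\<lambda>k. c * a k"]) (auto simp: sum_distrib_left mult.assoc)
  qed
  have xi: "\<xi> * x \<in> A" if x: "x \<in> A" for x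
  proof -
    obtain a where a: "\<forall>k. a k \<in> int_adjoin (zeta m)" "x = (\<Sum>k<q. a k * \<xi> ^ k)" using x by (auto simp: A_def)
    obtain r where r: "q = Suc r" using q_pos by (cases q) auto
    \<comment> \<open>Multiplication by \<open>\<xi>\<close> shifts the coefficients; the top one
      returns to position 0 with a sign, since \<open>\<xi> ^ q = -1\<close>.\<close>
    define a' where "a' k = (if k = 0 then - a r else a (k - 1))" for k
    have "\<xi> * x = (\<Sum>k<r. a k * \<xi> ^ Suc k) + a r * \<xi> ^ q"
      unfolding a(2) r by (simp add: sum_distrib_left distrib_left mult_ac)
    also have "\<dots> = (\<Sum>k<q. a' k * \<xi> ^ k)"
      unfolding xi_q unfolding r sum.lessThan_Suc_shift by (simp add: a'_def)
    finally show ?thesis using a(1) by (intro AI[of a']) (auto simp: a'_def)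
  qed
  obtain s t where st: "\<zeta> = zeta m ^ s * \<xi> ^ t" by (rule zeta_decompose)
  have xit: "\<xi> ^ k * x \<in> A" if "x \<in> A" for x k
    using that by (induction k) (auto simp: mult.assoc xi)
  have const: "c \<in> A" if c: "c \<in> int_adjoin (zeta m)" for c
  proof -
    have "(\<Sum>k<q. (if k = 0 then c else 0) * \<xi> ^ k) = (\<Sum>k<q. if k = 0 then c else 0)"
      by (rule sum.cong[OF refl]) auto
    hence "c = (\<Sum>k<q. (if k = 0 then c else 0) * \<xi> ^ k)" using q_pos by simp
    thus ?thesis using c by (intro AI[of "\<lambda>k. if k = 0 then c else 0"]) auto
  qed
  obtain P :: "int poly" where P: "x = poly (map_poly of_int P) \<zeta>"
    using assms integers_L by (auto simp: int_adjoin_def)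
  have "poly (map_poly of_int P) \<zeta> \<in> A"
  proof (induction P)
    case (pCons c P)
    have "\<zeta> * poly (map_poly of_int P) \<zeta> = zeta m ^ s * (\<xi> ^ t * poly (map_poly of_int P) \<zeta>)"
      by (subst (1) st) (simp add: mult.assoc)
    also have "\<dots> \<in> A" by (intro mult xit pCons.IH int_adjoin_power int_adjoin_gen)
    finally show ?case by (simp add: of_int_hom.map_poly_pCons_hom add const)
  qed (simp add: const)
  thus thesis using that P by (auto simp: A_def)
qed

lemma E_expansion:
  assumes "\<And>k. a k \<in> M.L"
  shows "E (\<Sum>k<q. a k * \<xi> ^ k) = a 0"
proof -
  have "E (\<Sum>k<q. a k * \<xi> ^ k) = (\<Sum>k<q. a k * E (\<xi> ^ k))"
    using assms M_L_subset xi_in_L by (subst E_sum) (auto simp: E_mult intro!: L.mult)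
  also have "\<dots> = (\<Sum>k<q. if k = 0 then a 0 else 0)"
    by (rule sum.cong[OF refl]) (use E_one E_xi in auto)
  finally show ?thesis using q_pos by simp
qed

text \<open>Despite the division in the definition of \<open>E\<close>, integrality persists:
  \<open>E x\<close> is the coefficient of 1 in the integral expansion.\<close>

lemma E_integer: "x \<in> \<O> L \<Longrightarrow> E x \<in> int_adjoin (zeta m)"
proof -
  assume x: "x \<in> \<O> L"
  obtain a where a: "\<And>k. a k \<in> int_adjoin (zeta m)" "x = (\<Sum>k<q. a k * \<xi> ^ k)"
    using xi_expansion[OF x] by blast
  show ?thesis unfolding a(2) by (subst E_expansion) (auto simp: a(1) intro: int_adjoin_M)
qed

text \<open>Division by \<open>\<xi> ^ i\<close> moves the \<open>i\<close>-th coefficient to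
  position 0, where \<open>E\<close> reads it off; wrapping around costs a sign.\<close>

lemma xi_expansion_unique_aux:
  assumes "\<And>k. a k \<in> M.L" "(\<Sum>k<q. a k * \<xi> ^ k) = 0" "i < q"
  shows "a i = 0"
proof -
  define c where "c k = (if k + i < q then a (k + i) else - a (k + i - q))" for k
  have "(\<Sum>k<q. c k * \<xi> ^ k) * \<xi> ^ i = (\<Sum>k<q. a k * \<xi> ^ k)"
  proof -
    have "(\<Sum>k<q. c k * \<xi> ^ k) * \<xi> ^ i = (\<Sum>k<q. c k * \<xi> ^ (k + i))"
      by (simp add: sum_distrib_right power_add mult.assoc)
    also have "\<dots> = (\<Sum>k<q. a (if k + i < q then k + i else k + i - q) * \<xi> ^ (if k + i < q then k + i else k + i - q))"
    proof (rule sum.cong[OF refl])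
      fix k
      show "c k * \<xi> ^ (k + i) = a (if k + i < q then k + i else k + i - q) * \<xi> ^ (if k + i < q then k + i else k + i - q)"
      proof (cases "k + i < q")
        case False
        hence "\<xi> ^ (k + i) = \<xi> ^ q * \<xi> ^ (k + i - q)" by (simp add: power_add[symmetric])
        thus ?thesis using False by (simp add: c_def xi_q)
      qed (simp add: c_def)
    qed
    also have "\<dots> = (\<Sum>k<q. a k * \<xi> ^ k)"
      by (rule sum.reindex_bij_witness[where j = "\<lambda>k. if k + i < q then k + i else k + i - q"
            and i = "\<lambda>k. if i \<le> k then k - i else k + q - i"]) (use assms(3) in auto)
    finally show ?thesis .
  qed
  hence "(\<Sum>k<q. c k * \<xi> ^ k) = 0" using assms(2) xi_nonzero by simp
  moreover have "c k \<in> M.L" for k using assms(1) by (auto simp: c_def)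
  ultimately have "c 0 = 0" using E_expansion[of c] E_M[of 0] by simp
  thus ?thesis using assms(3) by (simp add: c_def)
qed

lemma xi_expansion_unique:
  assumes "\<And>k. a k \<in> M.L" "\<And>k. c k \<in> M.L" "(\<Sum>k<q. a k * \<xi> ^ k) = (\<Sum>k<q. c k * \<xi> ^ k)" "i < q"
  shows "a i = c i"
  using xi_expansion_unique_aux[of "\<lambda>k. a k - c k" i] assms
  by (simp add: M.L.diff left_diff_distrib sum_subtractf)

text \<open>The sign by which \<open>\<tau>\<close> differs from inversion on \<open>\<xi>\<close>;
  both values have to be treated.\<close>

definition s :: complex where "s = \<xi> ^ (b + 1)"

lemma s_cases: "s = 1 \<or> s = -1"
proof -
  have "q dvd b + 1" using b_2 by (simp add: q_eq cong_0_iff)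
  then obtain t where "b + 1 = q * t" by (auto elim: dvdE)
  hence "s = (-1) ^ t" unfolding s_def by (simp only: power_mult xi_q)
  thus ?thesis by (cases "even t") auto
qed

lemma s_sq: "s * s = 1"
  using s_cases by auto

lemma tau_xi: "\<tau> \<xi> = s / \<xi>"
  using aut_xi[OF tau_aut tau_zeta] xi_nonzero by (simp add: s_def)

lemma tau_xi_power: "\<tau> (\<xi> ^ k) = s ^ k / \<xi> ^ k"
  using xi_in_L by (simp add: L.aut_power[OF tau_aut] tau_xi power_divide)

lemma tau_W: "\<tau> \<in> auts L M.L"
  using auts_W tau_aut tau_zeta b_m by blast

lemma tau_M: "c \<in> M.L \<Longrightarrow> \<tau> c = c"
  using L.aut_fix[OF tau_W] by blast

text \<open>Comparing coefficients of \<open>x\<close> and \<open>\<tau> x\<close> gives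
  \<open>a k = - (s ^ k) * a (q - k)\<close> for \<open>0 < k < q\<close>. So the terms above
  \<open>h\<close> are the images under \<open>\<tau>\<close> of those below, and the middle
  coefficient vanishes because \<open>s ^ h = 1\<close>.\<close>

lemma tau_fixed_expansion:
  assumes "x \<in> \<O> L" "\<tau> x = x"
  obtains a where "\<And>k. a k \<in> int_adjoin (zeta m)" "a 0 = E x"
    "x = a 0 + (\<Sum>k\<in>{0<..<h}. a k * \<xi> ^ k) + (\<Sum>k\<in>{0<..<h}. a k * \<tau> (\<xi> ^ k))"
proof -
  obtain a where a: "\<And>k. a k \<in> int_adjoin (zeta m)" "x = (\<Sum>k<q. a k * \<xi> ^ k)"
    using xi_expansion[OF assms(1)] by blast
  have aM: "a k \<in> M.L" for k using a(1) by (rule int_adjoin_M)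
  have aL: "a k \<in> L" for k using aM M_L_subset by blast
  have Ex: "E x = a 0" unfolding a(2) by (rule E_expansion[OF aM])
  have split: "{..<q} = insert 0 {0<..<q}" using q_pos by auto
  have xi_inv: "1 / \<xi> ^ k = - (\<xi> ^ (q - k))" if "k < q" for k
  proof -
    have "\<xi> ^ (q - k) * \<xi> ^ k = -1" using that xi_q by (simp add: power_add[symmetric])
    thus ?thesis using xi_nonzero by (simp add: field_simps)
  qed
  have s_pow: "s ^ (q - k) = s ^ k" if "k \<le> q" for k
  proof -
    have "s ^ (q - k) * s ^ k = (s * s) ^ h" using that q_h(1) by (simp add: power_add[symmetric] power_mult power2_eq_square)
    hence "s ^ (q - k) * s ^ k = 1" by (simp add: s_sq)
    moreover have "s ^ k * s ^ k = 1" by (simp add: power_mult_distrib[symmetric] s_sq)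
    ultimately show ?thesis by (metis mult.right_neutral mult.assoc mult.commute)
  qed
  define c where "c k = (if k = 0 then a 0 else - (s ^ k) * a (q - k))" for k
  have sM: "s \<in> M.L" using s_cases M.L.uminus[OF M.L.one] M.L.one by auto
  have cM: "c k \<in> M.L" for k unfolding c_def using aM sM by (auto intro!: M.L.mult M.L.uminus M.L.power)
  have "\<tau> x = (\<Sum>k<q. a k * (s ^ k / \<xi> ^ k))"
    unfolding a(2) using aL xi_in_L
    by (subst L.aut_sum[OF tau_aut]) (auto simp: L.aut_mult[OF tau_aut] tau_M[OF aM] tau_xi_power intro!: L.mult)
  also have "\<dots> = a 0 + (\<Sum>k\<in>{0<..<q}. a k * (s ^ k / \<xi> ^ k))" unfolding split by simp
  also have "(\<Sum>k\<in>{0<..<q}. a k * (s ^ k / \<xi> ^ k)) = (\<Sum>k\<in>{0<..<q}. c k * \<xi> ^ k)"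
  proof (rule sum.reindex_bij_witness[where i = "\<lambda>k. q - k" and j = "\<lambda>k. q - k"])
    fix k assume k: "k \<in> {0<..<q}"
    have "c (q - k) * \<xi> ^ (q - k) = a k * (s ^ k * (- (\<xi> ^ (q - k))))"
      using k s_pow[of k] by (simp add: c_def)
    also have "- (\<xi> ^ (q - k)) = 1 / \<xi> ^ k" using xi_inv[of k] k by simp
    finally show "c (q - k) * \<xi> ^ (q - k) = a k * (s ^ k / \<xi> ^ k)" by simp
  qed auto
  also have "a 0 + (\<Sum>k\<in>{0<..<q}. c k * \<xi> ^ k) = (\<Sum>k<q. c k * \<xi> ^ k)" unfolding split by (simp add: c_def)
  finally have "(\<Sum>k<q. a k * \<xi> ^ k) = (\<Sum>k<q. c k * \<xi> ^ k)" using assms(2) a(2) by simp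
  hence ac: "a k = c k" if "k < q" for k using xi_expansion_unique[of a c k, OF aM cM _ that] by blast
  have hq: "h < q" "h > 0" using q_h by auto
  have "s ^ h = 1"
  proof -
    obtain t where "h = 2 * t" using q_h(2) by (auto elim: evenE)
    thus ?thesis by (simp add: power_mult power2_eq_square s_sq)
  qed
  hence "a h = - a h" using ac[OF hq(1)] hq q_h(1) by (simp add: c_def)
  hence ah: "a h = 0" by simp
  have "{..<q} = insert 0 ({0<..<h} \<union> insert h {h<..<q})" using hq by auto
  hence "x = (\<Sum>k\<in>insert 0 ({0<..<h} \<union> insert h {h<..<q}). a k * \<xi> ^ k)" using a(2) by simp
  also have "\<dots> = a 0 + ((\<Sum>k\<in>{0<..<h}. a k * \<xi> ^ k) + (\<Sum>k\<in>insert h {h<..<q}. a k * \<xi> ^ k))"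
    using hq by (subst sum.insert) (auto simp: sum.union_disjoint)
  also have "(\<Sum>k\<in>insert h {h<..<q}. a k * \<xi> ^ k) = (\<Sum>k\<in>{h<..<q}. a k * \<xi> ^ k)" by (simp add: ah)
  also have "\<dots> = (\<Sum>k\<in>{0<..<h}. a k * \<tau> (\<xi> ^ k))"
  proof (rule sum.reindex_bij_witness[where i = "\<lambda>k. q - k" and j = "\<lambda>k. q - k"])
    fix k assume k: "k \<in> {h<..<q}"
    hence k': "q - k < q" "q - k \<noteq> 0" "q - (q - k) = k" using hq by auto
    have "\<tau> (\<xi> ^ (q - k)) = s ^ (q - k) * (1 / \<xi> ^ (q - k))" by (simp add: tau_xi_power)
    hence t: "\<tau> (\<xi> ^ (q - k)) = s ^ (q - k) * - (\<xi> ^ k)" using xi_inv[OF k'(1)] k'(3) by simp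
    have a': "a (q - k) = - (s ^ (q - k)) * a k" using ac[OF k'(1)] k' by (simp add: c_def)
    have "a (q - k) * \<tau> (\<xi> ^ (q - k)) = (s * s) ^ (q - k) * (a k * \<xi> ^ k)"
      unfolding t a' power_mult_distrib by simp
    thus "a (q - k) * \<tau> (\<xi> ^ (q - k)) = a k * \<xi> ^ k" by (simp add: s_sq)
  qed (use q_h in auto)
  finally show thesis using that[of a] a(1) Ex by (simp add: add.assoc)
qed

end

section \<open>Even valuations on the integers fixed by \<tau>, and wildness above 2\<close>

context wild
begin

text \<open>Generates the \<open>\<tau>\<close>-fixed integers over
  \<open>int_adjoin (zeta m)\<close> and has valuation 2 at each prime above 2.\<close>

definition \<eta> where "\<eta> = \<xi> + \<tau> \<xi>"

lemma xi_inverse_integer: "1 / \<xi> \<in> int_adjoin \<zeta>"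
proof -
  have "\<xi> ^ (2 ^ e - 1) * \<xi> = 1" using power_minus_mult[of "2 ^ e" \<xi>] xi_root by simp
  hence "1 / \<xi> = \<xi> ^ (2 ^ e - 1)" using xi_nonzero by (simp add: field_simps)
  thus ?thesis by auto
qed

text \<open>\<open>\<eta>\<close> is a unit times \<open>1 + s * \<xi> ^ 2\<close>, which factors as
  \<open>(1 - \<xi> ^ k) * (1 + \<xi> ^ k)\<close> for an odd \<open>k\<close>, and each factor is a
  unit times \<open>\<theta>\<close>.\<close>

lemma eta_theta:
  obtains u v where "u \<in> int_adjoin \<zeta>" "v \<in> int_adjoin \<zeta>" "u * v = 1" "\<eta> = \<theta> ^ 2 * u"
proof -
  \<comment> \<open>The requirement is \<open>\<xi> ^ (2 * k) = - s * \<xi> ^ 2\<close>. For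
    \<open>s = 1\<close> the shift by \<open>h\<close> supplies the sign, as
    \<open>\<xi> ^ (2 * h) = -1\<close>. Adding \<open>q\<close> to the exponent turns
    \<open>1 - \<xi> ^ k\<close> into \<open>1 + \<xi> ^ k\<close>.\<close>
  define k where "k = (if s = 1 then 1 + h else 1)"
  have k: "coprime k 2" "coprime (k + q) 2" using q_h by (auto simp: k_def)
  have e0: "e > 0" using e3 by simp
  obtain u1 v1 where 1: "u1 \<in> int_adjoin \<zeta>" "v1 \<in> int_adjoin \<zeta>" "u1 * v1 = 1" "1 - \<xi> ^ k = \<theta> * u1"
    using one_minus_xi_power_unit[OF e0 k(1)] by blast
  obtain u2 v2 where 2: "u2 \<in> int_adjoin \<zeta>" "v2 \<in> int_adjoin \<zeta>" "u2 * v2 = 1" "1 - \<xi> ^ (k + q) = \<theta> * u2"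
    using one_minus_xi_power_unit[OF e0 k(2)] by blast
  have sq: "\<xi> ^ (2 * k) = \<xi> ^ k * \<xi> ^ k" by (simp add: mult_2 power_add)
  have "(1 - \<xi> ^ k) * (1 - \<xi> ^ (k + q)) = 1 - \<xi> ^ (2 * k)"
    unfolding power_add xi_q sq by (simp add: algebra_simps)
  also have "\<xi> ^ (2 * k) = - s * \<xi> ^ 2"
  proof (cases "s = 1")
    case True
    have "\<xi> ^ (2 * k) = \<xi> ^ (q + 2)" using True by (simp add: k_def q_h(1))
    thus ?thesis using True by (simp add: power_add xi_q power2_eq_square)
  next
    case False
    thus ?thesis using s_cases by (simp add: k_def)
  qed
  finally have eq: "1 + s * \<xi> ^ 2 = \<theta> ^ 2 * (u1 * u2)" using 1(4) 2(4) by (simp add: power2_eq_square mult_ac)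
  have "\<eta> = s * (1 / \<xi>) * (1 + s * \<xi> ^ 2)"
  proof -
    have "s * (1 / \<xi>) * (1 + s * \<xi> ^ 2) = s / \<xi> + s * s * (\<xi> ^ 2 / \<xi>)"
      by (simp add: distrib_left mult_ac)
    also have "\<xi> ^ 2 / \<xi> = \<xi>" using xi_nonzero by (simp add: power2_eq_square)
    finally show ?thesis unfolding s_sq by (simp add: \<eta>_def tau_xi)
  qed
  hence "\<eta> = \<theta> ^ 2 * (s * (1 / \<xi>) * (u1 * u2))" unfolding eq by simp
  moreover have "(s * (1 / \<xi>) * (u1 * u2)) * (s * \<xi> * (v1 * v2)) = 1"
  proof -
    have "(s * (1 / \<xi>) * (u1 * u2)) * (s * \<xi> * (v1 * v2)) = (s * s) * (u1 * v1) * (u2 * v2) * (1 / \<xi> * \<xi>)"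
      by (simp only: mult_ac)
    thus ?thesis using 1(3) 2(3) s_sq xi_nonzero by simp
  qed
  moreover have "s \<in> int_adjoin \<zeta>" using s_cases int_adjoin_uminus[OF int_adjoin_1] int_adjoin_1 by auto
  moreover have "s * (1 / \<xi>) * (u1 * u2) \<in> int_adjoin \<zeta>" "s * \<xi> * (v1 * v2) \<in> int_adjoin \<zeta>"
    using 1(1,2) 2(1,2) xi_inverse_integer xi_integer \<open>s \<in> int_adjoin \<zeta>\<close> by (blast intro: int_adjoin_mult)+
  ultimately show thesis using that by blast
qed

text \<open>Power sums of two numbers with sum \<open>\<eta>\<close> and product \<open>s\<close>
  satisfy a two-term recurrence, hence the induction on consecutive pairs.\<close>

lemma xi_plus_tau_xi: "\<xi> ^ k + \<tau> (\<xi> ^ k) \<in> int_adjoin \<eta>"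
proof -
  define \<beta> where "\<beta> = s / \<xi>"
  have \<beta>: "\<xi> * \<beta> = s" "\<eta> = \<xi> + \<beta>" "\<tau> (\<xi> ^ j) = \<beta> ^ j" for j
    using xi_nonzero by (simp_all add: \<beta>_def \<eta>_def tau_xi tau_xi_power power_divide)
  have sI: "s \<in> int_adjoin \<eta>" using s_cases int_adjoin_uminus[OF int_adjoin_1] int_adjoin_1 by auto
  have "\<xi> ^ k + \<beta> ^ k \<in> int_adjoin \<eta> \<and> \<xi> ^ Suc k + \<beta> ^ Suc k \<in> int_adjoin \<eta>"
  proof (induction k)
    case 0
    have "\<xi> ^ 0 + \<beta> ^ 0 = of_nat 2" by simp
    moreover have "\<xi> ^ Suc 0 + \<beta> ^ Suc 0 = \<eta>" using \<beta>(2) by simp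
    ultimately show ?case by (metis int_adjoin_of_nat int_adjoin_gen)
  next
    case (Suc k)
    have "\<xi> ^ Suc (Suc k) + \<beta> ^ Suc (Suc k) = \<eta> * (\<xi> ^ Suc k + \<beta> ^ Suc k) - (\<xi> * \<beta>) * (\<xi> ^ k + \<beta> ^ k)"
      by (simp add: \<beta>(2) algebra_simps)
    also have "\<dots> \<in> int_adjoin \<eta>" unfolding \<beta>(1) using Suc sI by auto
    finally show ?case using Suc by blast
  qed
  thus ?thesis by (simp add: \<beta>(3))
qed

definition M_polys where "M_polys = {p :: complex poly. \<forall>i. coeff p i \<in> int_adjoin (zeta m)}"

lemma tau_fixed_eta:
  assumes "x \<in> \<O> L" "\<tau> x = x"
  obtains p where "p \<in> M_polys" "x = poly p \<eta>"
proof -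
  obtain a where a: "\<And>k. a k \<in> int_adjoin (zeta m)"
    "x = a 0 + (\<Sum>k\<in>{0<..<h}. a k * \<xi> ^ k) + (\<Sum>k\<in>{0<..<h}. a k * \<tau> (\<xi> ^ k))"
    using tau_fixed_expansion[OF assms] by metis
  have "\<exists>g :: int poly. \<xi> ^ k + \<tau> (\<xi> ^ k) = poly (map_poly of_int g) \<eta>" for k
    using xi_plus_tau_xi[of k] by (auto simp: int_adjoin_def)
  then obtain g :: "nat \<Rightarrow> int poly" where g: "\<And>k. \<xi> ^ k + \<tau> (\<xi> ^ k) = poly (map_poly of_int (g k)) \<eta>" by metis
  define p where "p = [:a 0:] + (\<Sum>k\<in>{0<..<h}. smult (a k) (map_poly of_int (g k)))"
  have "x = a 0 + (\<Sum>k\<in>{0<..<h}. a k * (\<xi> ^ k + \<tau> (\<xi> ^ k)))"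
    unfolding a(2) by (simp add: sum.distrib distrib_left)
  also have "\<dots> = poly p \<eta>" by (simp add: p_def g poly_sum)
  finally have "x = poly p \<eta>" .
  moreover have "p \<in> M_polys" unfolding M_polys_def p_def
    by (auto simp: coeff_sum coeff_pCons a(1) split: nat.splits intro!: int_adjoin_add int_adjoin_sum int_adjoin_mult)
  ultimately show thesis using that by blast
qed

context
  fixes P assumes prime_over: "prime_over n 2 e m P"
begin

interpretation P: prime_over n 2 e m P by (rule prime_over)

lemma M_polys_integer: "p \<in> M_polys \<Longrightarrow> poly p \<eta> \<in> \<O> L"
proof -
  assume p: "p \<in> M_polys"
  obtain u v where "u \<in> int_adjoin \<zeta>" "v \<in> int_adjoin \<zeta>" "u * v = 1" "\<eta> = \<theta> ^ 2 * u" by (rule eta_theta)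
  hence "\<eta> \<in> \<O> L" using theta_int by (auto simp: integers_L)
  moreover have "coeff p i \<in> \<O> L" for i
    using p int_adjoin_zeta_m by (auto simp: M_polys_def integers_L)
  ultimately show ?thesis unfolding poly_altdef by (intro L.integers_sum L.integers_closed)
qed

text \<open>2 is unramified in the field of \<open>m\<close>-th roots of unity: \<open>a\<close>
  equals \<open>a ^ N'\<close> up to a multiple of 2, and with \<open>q \<le> N'\<close> both terms
  lie in the \<open>q\<close>-th power of \<open>P\<close>.\<close>

lemma M_in_P:
  assumes "a \<in> int_adjoin (zeta m)" "a \<in> P"
  shows "a \<in> P.P_power q"
proof -
  define N' where "N' = (2::nat) ^ (totient m * q)"
  have "q \<le> 2 ^ q" by (simp add: order.strict_implies_order)
  also have "2 ^ q \<le> N'" unfolding N'_def using m_pos by (intro power_increasing) (simp_all add: Suc_le_eq)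
  finally have qN: "q \<le> N'" .
  obtain w where w: "w \<in> int_adjoin (zeta m)" "a ^ N' = a + of_nat 2 * w"
    unfolding N'_def using frobenius_fixed[OF prime_p p_m m_pos assms(1)] by blast
  obtain U V where UV: "U \<in> int_adjoin \<zeta>" "V \<in> int_adjoin \<zeta>" "U * V = 1" "of_nat 2 = \<theta> ^ q * U" by (rule p_theta)
  have "a ^ N' * 1 \<in> P.P_power N'" using assms(2) by (intro L.mult_power_in_ideal_power[OF P.P_ideal]) auto
  hence "a ^ N' \<in> P.P_power q" using P.P_power_decseq[OF qN] by auto
  moreover have "\<theta> ^ q * (U * w) \<in> P.P_power q"
    using UV(1) int_adjoin_zeta_m[OF w(1)] by (intro P.theta_power_in) (auto simp: integers_L)
  ultimately have "a ^ N' - \<theta> ^ q * (U * w) \<in> P.P_power q" by (rule L.ideal_diff[OF P.P_power_ideal])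
  also have "a ^ N' - \<theta> ^ q * (U * w) = a" unfolding w(2) UV(4) by (simp add: mult.assoc)
  finally show ?thesis .
qed

text \<open>Write \<open>p = a + X * p'\<close>. If the value lies in \<open>P\<close>, so does
  \<open>a\<close>; then \<open>a\<close> lies in the \<open>q\<close>-th power and is negligible
  below \<open>q\<close>. What remains is \<open>\<eta>\<close>, of valuation 2, times a value of
  \<open>p'\<close>.\<close>

lemma even_valuation:
  assumes "p \<in> M_polys" "poly p \<eta> \<in> P.P_power (2 * j + 1)" "2 * j + 1 < q"
  shows "poly p \<eta> \<in> P.P_power (2 * j + 2)"
  using assms
proof (induction j arbitrary: p)
  case (0 p)
  have q2: "2 \<le> q" using q_h by simp
  obtain a p' where p: "p = pCons a p'" by (cases p)
  have p': "p' \<in> M_polys" "a \<in> int_adjoin (zeta m)" using 0(1) unfolding p M_polys_def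
    by (auto simp: coeff_pCons split: nat.splits)
  obtain u v where u: "u \<in> int_adjoin \<zeta>" "v \<in> int_adjoin \<zeta>" "u * v = 1" "\<eta> = \<theta> ^ 2 * u" by (rule eta_theta)
  have uy: "u * poly p' \<eta> \<in> \<O> L" using u(1) M_polys_integer[OF p'(1)] by (auto simp: integers_L)
  have eq: "poly p \<eta> = a + \<theta> ^ 2 * (u * poly p' \<eta>)" by (simp add: p u(4))
  have th: "\<theta> ^ 2 * (u * poly p' \<eta>) \<in> P.P_power 2" using uy by (rule P.theta_power_in)
  have "poly p \<eta> \<in> P" using 0(2) P.P_power_1 by simp
  moreover have "\<theta> ^ 2 * (u * poly p' \<eta>) \<in> P" using th P.P_power_decseq[of 1 2] P.P_power_1 by auto
  ultimately have "poly p \<eta> - \<theta> ^ 2 * (u * poly p' \<eta>) \<in> P" by (rule P.P_diff)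
  hence "a \<in> P" by (simp add: eq)
  hence "a \<in> P.P_power 2" using M_in_P[OF p'(2)] P.P_power_decseq[OF q2] by blast
  hence "a + \<theta> ^ 2 * (u * poly p' \<eta>) \<in> P.P_power 2" by (rule L.ideal_add[OF P.P_power_ideal _ th])
  thus ?case unfolding eq by (simp only: mult_0_right add_0)
next
  case (Suc j p)
  obtain a p' where p: "p = pCons a p'" by (cases p)
  have p': "p' \<in> M_polys" "a \<in> int_adjoin (zeta m)" using Suc.prems(1) unfolding p M_polys_def
    by (auto simp: coeff_pCons split: nat.splits)
  obtain u v where u: "u \<in> int_adjoin \<zeta>" "v \<in> int_adjoin \<zeta>" "u * v = 1" "\<eta> = \<theta> ^ 2 * u" by (rule eta_theta)
  have y: "poly p' \<eta> \<in> \<O> L" by (rule M_polys_integer[OF p'(1)])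
  have uy: "u * poly p' \<eta> \<in> \<O> L" using u(1) y by (auto simp: integers_L)
  have eq: "poly p \<eta> = a + \<theta> ^ 2 * (u * poly p' \<eta>)" by (simp add: p u(4))
  have "\<theta> ^ 2 * (u * poly p' \<eta>) \<in> P.P_power 1"
    using P.theta_power_in[OF uy, of 2] P.P_power_decseq[of 1 2] by auto
  moreover have "poly p \<eta> \<in> P.P_power 1" using Suc.prems(2) P.P_power_decseq[of 1 "2 * Suc j + 1"] by auto
  ultimately have "poly p \<eta> - \<theta> ^ 2 * (u * poly p' \<eta>) \<in> P" using P.P_diff unfolding P.P_power_1 by blast
  hence "a \<in> P" by (simp add: eq)
  hence aq: "a \<in> P.P_power q" by (rule M_in_P[OF p'(2)])
  hence "a \<in> P.P_power (2 * Suc j + 1)" using P.P_power_decseq[of "2 * Suc j + 1" q] Suc.prems(3) by auto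
  from L.ideal_diff[OF P.P_power_ideal Suc.prems(2) this]
  have "\<theta> ^ 2 * (u * poly p' \<eta>) \<in> P.P_power (2 + (2 * j + 1))" by (simp add: eq)
  hence "u * poly p' \<eta> \<in> P.P_power (2 * j + 1)" using P.theta_power_cancel_iff[OF uy] by blast
  moreover have "v \<in> \<O> L" using u(2) by (simp add: integers_L)
  ultimately have "v * (u * poly p' \<eta>) \<in> P.P_power (2 * j + 1)" using L.ideal_mult[OF P.P_power_ideal] by blast
  also have "v * (u * poly p' \<eta>) = (u * v) * poly p' \<eta>" by (simp add: mult_ac)
  also have "\<dots> = poly p' \<eta>" by (simp add: u(3))
  finally have "poly p' \<eta> \<in> P.P_power (2 * j + 1)" .
  hence "poly p' \<eta> \<in> P.P_power (2 * j + 2)" using Suc.IH[OF p'(1)] Suc.prems(3) by simp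
  hence "u * poly p' \<eta> \<in> P.P_power (2 * j + 2)"
    using u(1) L.ideal_mult[OF P.P_power_ideal] unfolding integers_L by blast
  hence "\<theta> ^ 2 * (u * poly p' \<eta>) \<in> P.P_power (2 + (2 * j + 2))" using P.theta_power_cancel_iff[OF uy] by blast
  moreover have "2 * Suc j + 2 \<le> q" using Suc.prems(3) q_h(1) by presburger
  hence "a \<in> P.P_power (2 + (2 * j + 2))" using aq P.P_power_decseq[of "2 + (2 * j + 2)" q] by auto
  ultimately have "a + \<theta> ^ 2 * (u * poly p' \<eta>) \<in> P.P_power (2 + (2 * j + 2))"
    using L.ideal_add[OF P.P_power_ideal] by blast
  thus ?case unfolding eq by simp
qed

text \<open>As 2 has valuation \<open>q\<close>, the index is at most \<open>q\<close>. Were it odd,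
  it would be less than the even number \<open>q\<close>, and the integers of \<open>K\<close> in
  \<open>P\<close>, being fixed by \<open>\<tau>\<close>, would all lie in the next power of
  \<open>P\<close>.\<close>

lemma even_ramification_index: "2 dvd ramification_index L K P"
proof -
  define r where "r = ramification_index L K P"
  let ?Q = "\<lambda>k. P \<inter> \<O> K \<subseteq> P.P_power k"
  have r: "r = (GREATEST k. ?Q k)"
    unfolding r_def by (rule P.ramification_index_eq) (use integers_K_subset in blast)
  have 1: "?Q 1" unfolding P.P_power_1 by blast
  obtain U V where UV: "U \<in> int_adjoin \<zeta>" "V \<in> int_adjoin \<zeta>" "U * V = 1" "of_nat 2 = \<theta> ^ q * U" by (rule p_theta)
  have bound: "k \<le> q" if k: "?Q k" for k
  proof (rule ccontr)
    assume "\<not> k \<le> q"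
    hence "P.P_power k \<subseteq> P.P_power (Suc q)" by (intro P.P_power_decseq) simp
    moreover have "of_nat 2 \<in> P \<inter> \<O> K" using P.p_in_P K.integers_nums(3)[of 2] by blast
    ultimately have "\<theta> ^ q * U \<in> P.P_power (Suc q)" using k unfolding UV(4) by blast
    hence "U \<in> P" using UV(1) by (intro P.theta_power_cancel) (auto simp: integers_L)
    thus False using P.unit_notin_P[of U V] UV by (simp add: integers_L)
  qed
  have Qr: "?Q r" unfolding r by (rule GreatestI_nat[where P = ?Q and b = q, OF 1]) (rule bound)
  have max: "k \<le> r" if "?Q k" for k
    unfolding r by (rule Greatest_le_nat[where P = ?Q and b = q, OF that]) (rule bound)
  show ?thesis
  proof (rule ccontr)
    assume "\<not> 2 dvd ramification_index L K P"
    then obtain j where j: "r = 2 * j + 1" unfolding r_def by (auto elim: oddE)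
    have "r < q" using bound[OF Qr] q_h(1) j by presburger
    have "?Q (2 * j + 2)"
    proof
      fix x assume x: "x \<in> P \<inter> \<O> K"
      hence xL: "x \<in> \<O> L" using integers_K_subset by blast
      have "\<tau> x = x" using x tau_H L.aut_fix unfolding H_def by (auto simp: ring_of_integers_def)
      then obtain p where p: "p \<in> M_polys" "x = poly p \<eta>" using tau_fixed_eta[OF xL] by blast
      have "x \<in> P.P_power (2 * j + 1)" using x Qr j by blast
      thus "x \<in> P.P_power (2 * j + 2)" using even_valuation[OF p(1), of j] \<open>r < q\<close> j p(2) by simp
    qed
    thus False using max[of "2 * j + 2"] j by simp
  qed
qed

end

theorem not_tamely_ramified: "\<not> tamely_ramified L K"
proof -
  obtain U V where UV: "U \<in> int_adjoin \<zeta>" "V \<in> int_adjoin \<zeta>" "U * V = 1" "of_nat 2 = \<theta> ^ q * U" by (rule p_theta)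
  have th: "\<theta> \<in> \<O> L" using theta_int by (simp add: integers_L)
  obtain P where P: "primeideal P (integer_ring L)" "\<theta> \<in> P"
    using L.exists_prime_ideal[OF th theta_not_unit] by blast
  have Pi: "ideal P (integer_ring L)" using P(1) by (simp add: primeideal_def)
  have "\<theta> ^ q * U = (\<theta> ^ (q - 1) * U) * \<theta>" using power_minus_mult[OF q_pos, of \<theta>] by (simp add: mult_ac)
  also have "\<dots> \<in> P" using P(2) th UV(1) by (intro L.ideal_mult[OF Pi]) (auto simp: integers_L)
  finally have two: "of_nat 2 \<in> P" by (simp only: UV(4))
  have po: "prime_over n 2 e m P"
    using prime_split_axioms P(1) two by (simp add: prime_over_def prime_over_axioms_def)
  interpret P: prime_over n 2 e m P by (rule po)
  define \<pp> where "\<pp> = P \<inter> \<O> K"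
  have "primeideal \<pp> (integer_ring K)"
  proof -
    interpret R: cring "integer_ring K" by (rule K.cring_integer_ring)
    have "ideal \<pp> (integer_ring K)"
    proof (rule idealI)
      show "ring (integer_ring K)" by (rule R.ring_axioms)
      show "subgroup \<pp> (add_monoid (integer_ring K))"
      proof (rule R.add.subgroupI)
        show "\<pp> \<noteq> {}" using P.P_zero K.integers_nums(1) by (auto simp: \<pp>_def)
        fix x assume x: "x \<in> \<pp>"
        hence xK: "x \<in> \<O> K" by (simp add: \<pp>_def)
        have "x \<oplus>\<^bsub>integer_ring K\<^esub> (- x) = \<zero>\<^bsub>integer_ring K\<^esub>" by simp
        hence "\<ominus>\<^bsub>integer_ring K\<^esub> x = - x"
          using xK K.integers_closed(4)[OF xK] R.minus_equality[of "- x" x] by simp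
        moreover have "- x \<in> P" using P.P_mult[of "-1" x] x L.integers_closed(4)[OF L.integers_nums(2)]
          by (simp add: \<pp>_def)
        ultimately show "\<ominus>\<^bsub>integer_ring K\<^esub> x \<in> \<pp>"
          using K.integers_closed(4)[OF xK] by (simp add: \<pp>_def)
      qed (use P.P_add K.integers_closed in \<open>auto simp: \<pp>_def\<close>)
    next
      fix x y assume xy: "x \<in> \<pp>" "y \<in> carrier (integer_ring K)"
      hence "y * x \<in> P" "y * x \<in> \<O> K" using P.P_mult[of y x] integers_K_subset K.integers_closed(2)
        by (auto simp: \<pp>_def)
      thus "y \<otimes>\<^bsub>integer_ring K\<^esub> x \<in> \<pp>" "x \<otimes>\<^bsub>integer_ring K\<^esub> y \<in> \<pp>" by (simp_all add: \<pp>_def mult.commute)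
    qed
    thus ?thesis
    proof (rule primeidealI)
      show "cring (integer_ring K)" by (rule R.cring_axioms)
      show "carrier (integer_ring K) \<noteq> \<pp>" using P.one_notin_P K.integers_nums(2) by (auto simp: \<pp>_def)
      fix x y assume "x \<in> carrier (integer_ring K)" "y \<in> carrier (integer_ring K)" "x \<otimes>\<^bsub>integer_ring K\<^esub> y \<in> \<pp>"
      thus "x \<in> \<pp> \<or> y \<in> \<pp>" using P.P_prime[of x y] integers_K_subset by (auto simp: \<pp>_def)
    qed
  qed
  moreover have "of_nat 2 \<in> \<pp>" using two K.integers_nums(3)[of 2] by (simp only: \<pp>_def) blast
  hence "\<pp> \<noteq> {0}" by auto
  moreover have "wildly_ramified_at L K \<pp>"
    unfolding wildly_ramified_at_def using P(1) two even_ramification_index[OF po] two_is_prime_nat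
    by (intro exI[of _ P] exI[of _ 2]) (simp add: \<pp>_def)
  ultimately show ?thesis unfolding tamely_ramified_def by blast
qed


section \<open>Image of the adjusted trace in the wild case\<close>

definition adjusted_Tr where "adjusted_Tr x = K.Tr x - K.Tr (E x) / 2"

text \<open>\<open>\<sigma>\<close> and its composite with \<open>\<tau>\<close> agree at a
  \<open>\<tau>\<close>-fixed \<open>x\<close>, so half the trace is a sum of conjugates over
  representatives.\<close>

lemma K_Tr_half:
  assumes "x \<in> \<O> L" "\<tau> x = x"
  shows "K.Tr x / 2 \<in> \<O> K"
proof -
  have xL: "x \<in> L" using assms(1) by (simp add: ring_of_integers_def)
  have ext: "\<sigma> \<in> extensional L" if "\<sigma> \<in> H" for \<sigma> using L.aut_ext that unfolding H_def by blast
  obtain B where B: "B \<subseteq> H" "(\<Sum>\<sigma>\<in>H. \<sigma> x) = 2 * (\<Sum>\<sigma>\<in>B. \<sigma> x)"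
  proof (rule sum_fixed_point_free_involution[of H "\<lambda>\<sigma>. compose L \<sigma> \<tau>" "\<lambda>\<sigma>. \<sigma> x"])
    fix \<sigma> assume \<sigma>: "\<sigma> \<in> H"
    have tcl: "\<tau> y \<in> L" if "y \<in> L" for y using L.aut_closed[OF tau_aut that] .
    show "compose L \<sigma> \<tau> \<in> H" by (rule H_compose[OF \<sigma> tau_H])
    show "compose L (compose L \<sigma> \<tau>) \<tau> = \<sigma>"
      using ext[OF \<sigma>] tcl tau_tau by (auto simp: compose_def fun_eq_iff extensional_def)
    show "compose L \<sigma> \<tau> \<noteq> \<sigma>"
    proof
      assume "compose L \<sigma> \<tau> = \<sigma>"
      hence "\<sigma> (\<tau> \<zeta>) = \<sigma> \<zeta>" by (metis compose_eq zeta_in_L)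
      hence "\<tau> \<zeta> = \<zeta>" using L.aut_eq_iff[of \<sigma> K] \<sigma> tcl zeta_in_L unfolding H_def by blast
      hence "\<tau> = (\<lambda>x\<in>L. x)" by (intro aut_eqI tau_aut L.auts_one F_subset) simp
      thus False using tau_nontrivial by blast
    qed
    show "compose L \<sigma> \<tau> x = \<sigma> x" using xL assms(2) by (simp add: compose_eq)
  qed simp
  hence "K.Tr x / 2 = (\<Sum>\<sigma>\<in>B. \<sigma> x)" by (simp add: aut_trace_def H_def)
  moreover have "algebraic_int (\<Sum>\<sigma>\<in>B. \<sigma> x)"
    using B(1) assms(1) L.aut_algebraic_int xL unfolding H_def
    by (intro algebraic_int_sum) (auto simp: ring_of_integers_def)
  moreover have "K.Tr x / 2 \<in> K" by (intro K.divide K.Tr_in_F xL) auto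
  ultimately show ?thesis by (simp add: ring_of_integers_def)
qed

lemma E_integer_L: "x \<in> \<O> L \<Longrightarrow> E x \<in> \<O> L"
  using E_integer int_adjoin_zeta_m by (simp add: integers_L)

lemma adjusted_Tr_integers: "adjusted_Tr ` \<O> L = \<O> K"
proof
  show "adjusted_Tr ` \<O> L \<subseteq> \<O> K"
  proof
    fix y assume "y \<in> adjusted_Tr ` \<O> L"
    then obtain x where x: "x \<in> \<O> L" "y = adjusted_Tr x" by blast
    have "E x \<in> M.L" using E_integer[OF x(1)] by (rule int_adjoin_M)
    hence "K.Tr (E x) / 2 \<in> \<O> K" using E_integer_L[OF x(1)] tau_M by (intro K_Tr_half) auto
    thus "y \<in> \<O> K" using K_Tr_integer[OF x(1)] by (simp add: x(2) adjusted_Tr_def K.integers_closed(3))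
  qed
  show "\<O> K \<subseteq> adjusted_Tr ` \<O> L"
  proof
    fix y assume y: "y \<in> \<O> K"
    have yL: "y \<in> \<O> L" using y integers_K_subset by blast
    have fix_y: "\<sigma> y = y" if "\<sigma> \<in> H" for \<sigma>
      using that y L.aut_fix unfolding H_def by (auto simp: ring_of_integers_def)
    obtain a where a: "\<And>k. a k \<in> int_adjoin (zeta m)" "a 0 = E y"
      "y = a 0 + (\<Sum>k\<in>{0<..<h}. a k * \<xi> ^ k) + (\<Sum>k\<in>{0<..<h}. a k * \<tau> (\<xi> ^ k))"
      using tau_fixed_expansion[OF yL fix_y[OF tau_H]] by metis
    obtain x0 where x0: "x0 \<in> \<O> L" "K.Tr x0 = of_nat (card N)"
      "\<And>\<sigma> b. \<sigma> \<in> auts L \<rat> \<Longrightarrow> \<sigma> \<zeta> = \<zeta> ^ b \<Longrightarrow> rad_one b \<Longrightarrow> \<sigma> x0 = x0" by (rule minimal_trace) blast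
    have inL: "z \<in> L" if "z \<in> \<O> L" for z using that by (simp add: ring_of_integers_def)
    have "\<sigma> x0 = x0" if \<sigma>: "\<sigma> \<in> auts L M.L" for \<sigma>
    proof -
      have \<sigma>Q: "\<sigma> \<in> auts L \<rat>" using \<sigma> auts_W_subset by blast
      obtain c where c: "coprime c n" "\<sigma> \<zeta> = \<zeta> ^ c" using aut_zeta[OF \<sigma>Q] .
      have "zeta m \<in> M.L" by (rule M.zeta_in_L)
      hence "zeta m ^ c = zeta m ^ 1" using L.aut_fix[OF \<sigma>] aut_zeta_m[OF \<sigma>Q c(2)] by simp
      hence cm: "[c = 1] (mod m)" using zeta_power_eq_iff[OF m_pos] by blast
      \<comment> \<open>An odd prime dividing \<open>n\<close> divides \<open>m\<close>; modulo 2
        the exponent is 1 because it is prime to \<open>n\<close>.\<close>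
      have "rad_one c" unfolding rad_one_def
      proof (intro allI impI)
        fix l assume l: "prime l" "l dvd n"
        show "[c = 1] (mod l)"
        proof (cases "l = 2")
          case True
          have "\<not> 2 dvd c" using c(1) l(2) unfolding True by (metis coprime_common_divisor odd_one)
          thus ?thesis using True by (simp add: cong_def odd_iff_mod_2_eq_one)
        next
          case False
          have "l dvd 2 ^ e \<or> l dvd m" using l prime_dvd_mult_iff n_eq by metis
          hence "l dvd m" using False l(1) prime_dvd_power primes_dvd_imp_eq two_is_prime_nat by blast
          thus ?thesis using cm cong_dvd_modulus_nat by blast
        qed
      qed
      thus ?thesis using x0(3)[OF \<sigma>Q c(2)] by blast
    qed
    hence x0M: "x0 \<in> M.L" using W.fixed_in_base[OF inL[OF x0(1)]] by blast
    define w where "w = (\<Sum>k\<in>{0<..<h}. a k * \<xi> ^ k)"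
    have aM: "a k \<in> M.L" for k using a(1) by (rule int_adjoin_M)
    have aL: "a k \<in> \<O> L" for k using int_adjoin_zeta_m[OF a(1)] by (simp add: integers_L)
    have xiO: "\<xi> ^ k \<in> \<O> L" for k by (auto simp: integers_L)
    have w: "w \<in> \<O> L" unfolding w_def by (intro L.integers_sum L.integers_closed(2) aL xiO)
    have tw: "\<tau> w = (\<Sum>k\<in>{0<..<h}. a k * \<tau> (\<xi> ^ k))"
      unfolding w_def using aL xi_in_L inL
      by (subst L.aut_sum[OF tau_aut]) (auto simp: L.aut_mult[OF tau_aut] tau_M[OF aM] intro!: L.mult)
    have y_eq: "y - a 0 = w + \<tau> w" using a(3) tw w_def by simp
    have "E w = (\<Sum>k\<in>{0<..<h}. a k * E (\<xi> ^ k))"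
      unfolding w_def using aM xi_in_L M_L_subset by (subst E_sum) (auto simp: E_mult intro!: L.mult)
    also have "\<dots> = 0" using E_xi q_h by (intro sum.neutral) auto
    finally have Ew: "E w = 0" .
    have "a 0 \<in> K"
    proof (rule K.fixed_in_base[OF inL[OF aL]])
      fix \<sigma> assume "\<sigma> \<in> auts L K"
      hence "\<sigma> \<in> auts L \<rat>" "\<sigma> y = y" using fix_y H_subset unfolding H_def by blast+
      thus "\<sigma> (a 0) = a 0" using E_aut[of \<sigma> y] inL[OF yL] a(2) by simp
    qed
    \<comment> \<open>\<open>x0\<close> has trace 2. On \<open>a 0 * x0\<close>, which is
      \<open>E x\<close>, the halving turns the trace \<open>2 * a 0\<close> into
      \<open>a 0\<close>. On \<open>x0 * w\<close>, which \<open>E\<close> kills, the trace is half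
      that of \<open>x0 * (w + \<tau> w)\<close>, namely \<open>y - a 0\<close>.\<close>
    define x where "x = x0 * (a 0 + w)"
    have x0L: "x0 \<in> L" "a 0 \<in> L" "w \<in> L" "y \<in> L" using inL x0(1) aL w yL by blast+
    have Ex: "E x = a 0 * x0"
      unfolding x_def using x0M x0L aM Ew by (simp add: E_mult E_add E_M L.add)
    have Tr_a: "K.Tr (a 0 * x0) = 2 * a 0"
      using K.Tr_mult[OF \<open>a 0 \<in> K\<close> x0L(1)] x0(2) card_N by simp
    have Tr_tau: "K.Tr (\<tau> z) = K.Tr z" if "z \<in> L" for z
      using K_Tr_aut[OF tau_aut that] K.Tr_aut[of \<tau> z] tau_H that by (simp add: H_def)
    have "2 * K.Tr (x0 * w) = K.Tr (x0 * w) + K.Tr (\<tau> (x0 * w))" using Tr_tau[of "x0 * w"] x0L by (simp add: L.mult)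
    also have "\<tau> (x0 * w) = x0 * \<tau> w" using x0L by (simp add: L.aut_mult[OF tau_aut] tau_M[OF x0M])
    also have "K.Tr (x0 * w) + K.Tr (x0 * \<tau> w) = K.Tr (x0 * w + x0 * \<tau> w)"
      using x0L L.aut_closed[OF tau_aut x0L(3)] by (intro K.Tr_add[symmetric] L.mult)
    also have "x0 * w + x0 * \<tau> w = (y - a 0) * x0" unfolding y_eq by (simp add: algebra_simps)
    also have "K.Tr ((y - a 0) * x0) = (y - a 0) * 2"
      using y \<open>a 0 \<in> K\<close> x0L(1) x0(2) card_N by (subst K.Tr_mult) (auto simp: ring_of_integers_def)
    finally have "2 * K.Tr (x0 * w) = 2 * (y - a 0)" by (simp only: mult.commute)
    hence Tr_w: "K.Tr (x0 * w) = y - a 0" by (simp only: mult_cancel_left) simp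
    have "K.Tr x = K.Tr (a 0 * x0) + K.Tr (x0 * w)"
      unfolding x_def distrib_left using x0L by (simp add: K.Tr_add L.mult mult.commute)
    hence "adjusted_Tr x = y" unfolding adjusted_Tr_def Ex Tr_a Tr_w by simp
    moreover have "x \<in> \<O> L" unfolding x_def using x0(1) aL w by (intro L.integers_closed)
    ultimately show "y \<in> adjusted_Tr ` \<O> L" by blast
  qed
qed

end

section \<open>The field trace as a sum over automorphisms\<close>

lemma combine_eq_sum:
  "length Ks = length Us \<Longrightarrow> ring.combine \<CC> Ks Us = (\<Sum>i<length Us. Ks ! i * Us ! i)"
proof (induction Ks Us rule: list_induct2)
  case Nil
  interpret C: field \<CC> by (rule field_complex)
  show ?case by simp
next
  case (Cons k Ks u Us)
  interpret C: field \<CC> by (rule field_complex)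
  show ?case using Cons.IH by (simp add: sum.lessThan_Suc_shift del: sum.lessThan_Suc)
qed

context complex_subfield
begin

lemma Span_iff:
  "x \<in> ring.Span \<CC> F bs \<longleftrightarrow> (\<exists>c. (\<forall>i<length bs. c i \<in> F) \<and> x = (\<Sum>i<length bs. c i * bs ! i))"
proof -
  interpret C: field \<CC> by (rule field_complex)
  have "x \<in> C.Span F bs \<longleftrightarrow> (\<exists>Ks. set Ks \<subseteq> F \<and> length Ks = length bs \<and> x = C.combine Ks bs)"
    by (rule C.Span_mem_iff_length_version[OF subfield]) simp
  also have "\<dots> \<longleftrightarrow> (\<exists>c. (\<forall>i<length bs. c i \<in> F) \<and> x = (\<Sum>i<length bs. c i * bs ! i))"
  proof
    assume "\<exists>Ks. set Ks \<subseteq> F \<and> length Ks = length bs \<and> x = C.combine Ks bs"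
    then obtain Ks where "set Ks \<subseteq> F" "length Ks = length bs" "x = C.combine Ks bs" by blast
    thus "\<exists>c. (\<forall>i<length bs. c i \<in> F) \<and> x = (\<Sum>i<length bs. c i * bs ! i)"
      by (intro exI[of _ "\<lambda>i. Ks ! i"]) (auto simp: combine_eq_sum dest: nth_mem)
  next
    assume "\<exists>c. (\<forall>i<length bs. c i \<in> F) \<and> x = (\<Sum>i<length bs. c i * bs ! i)"
    then obtain c where "\<forall>i<length bs. c i \<in> F" "x = (\<Sum>i<length bs. c i * bs ! i)" by blast
    thus "\<exists>Ks. set Ks \<subseteq> F \<and> length Ks = length bs \<and> x = C.combine Ks bs"
      by (intro exI[of _ "map c [0..<length bs]"]) (auto simp: combine_eq_sum)
  qed
  finally show ?thesis .
qed

lemma independent_unique: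
  assumes "ring.independent \<CC> F bs" "\<And>i. i < length bs \<Longrightarrow> c i \<in> F" "\<And>i. i < length bs \<Longrightarrow> d i \<in> F"
    "(\<Sum>i<length bs. c i * bs ! i) = (\<Sum>i<length bs. d i * bs ! i)" "i < length bs"
  shows "c i = d i"
proof -
  interpret C: field \<CC> by (rule field_complex)
  define Ks where "Ks = map (\<lambda>i. c i - d i) [0..<length bs]"
  have len: "length Ks = length bs" by (simp add: Ks_def)
  have "C.combine Ks bs = 0"
    using assms(4) by (simp add: combine_eq_sum[OF len]) (simp add: Ks_def left_diff_distrib sum_subtractf)
  moreover have "set Ks \<subseteq> F" using assms(2,3) by (auto simp: Ks_def)
  ultimately have "set (take (length bs) Ks) \<subseteq> {0}"
    using C.independent_imp_trivial_combine[OF subfield assms(1)] by simp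
  hence "Ks ! i \<in> {0}" using len assms(5) by (metis nth_mem order_refl subsetD take_all)
  thus ?thesis using assms(5) by (simp add: Ks_def)
qed

end

context sub_cyclotomic
begin

text \<open>The coordinates with respect to a basis are expressed through the trace by Fourier inversion;
  this replaces the dual basis.\<close>

lemma matrix_trace_eq:
  assumes ind: "ring.independent \<CC> F bs" and span: "ring.Span \<CC> F bs = L" and x: "x \<in> L"
    and MF: "\<And>i j. i < length bs \<Longrightarrow> j < length bs \<Longrightarrow> M i j \<in> F"
    and M: "\<And>i. i < length bs \<Longrightarrow> x * bs ! i = (\<Sum>j<length bs. M i j * bs ! j)"
  shows "(\<Sum>i<length bs. M i i) = Tr x"
proof -
  let ?d = "length bs"
  have "\<exists>c. (\<forall>i<?d. c i \<in> F) \<and> \<zeta> ^ k = (\<Sum>i<?d. c i * bs ! i)" for k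
    using Span_iff[of "\<zeta> ^ k" bs] span zeta_power_in_L by blast
  then obtain \<phi> where \<phi>: "\<And>k i. i < ?d \<Longrightarrow> \<phi> k i \<in> F" "\<And>k. \<zeta> ^ k = (\<Sum>i<?d. \<phi> k i * bs ! i)" by metis
  have bL: "bs ! i \<in> L" if "i < ?d" for i
  proof -
    have "bs ! i = (\<Sum>j<?d. (if j = i then 1 else 0) * bs ! j)"
      using that by (simp add: if_distrib[of "\<lambda>t. t * _"] cong: if_cong)
    hence "bs ! i \<in> ring.Span \<CC> F bs" unfolding Span_iff by (intro exI[of _ "\<lambda>j. if j = i then 1 else 0"]) auto
    thus ?thesis using span by simp
  qed
  have xb: "x * bs ! i / \<zeta> ^ k \<in> L" if "i < ?d" for i k using x bL[OF that] by auto
  have eq: "of_nat n * M i j = (\<Sum>k<n. Tr (x * bs ! i / \<zeta> ^ k) * \<phi> k j)" if ij: "i < ?d" "j < ?d" for i j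
  proof (rule independent_unique[OF ind _ _ _ ij(2)])
    show "of_nat n * M i j' \<in> F" if "j' < ?d" for j' using MF[OF ij(1) that] by auto
    show "(\<Sum>k<n. Tr (x * bs ! i / \<zeta> ^ k) * \<phi> k j') \<in> F" if "j' < ?d" for j'
      using xb[OF ij(1)] \<phi>(1)[OF that] by (intro sum mult Tr_in_F) auto
    have "(\<Sum>j<?d. of_nat n * M i j * bs ! j) = of_nat n * (x * bs ! i)"
      unfolding M[OF ij(1)] by (simp add: sum_distrib_left mult.assoc)
    also have "\<dots> = (\<Sum>k<n. Tr (x * bs ! i / \<zeta> ^ k) * \<zeta> ^ k)"
      by (rule fourier_inversion) (use x bL[OF ij(1)] in auto)
    also have "\<dots> = (\<Sum>k<n. \<Sum>j<?d. Tr (x * bs ! i / \<zeta> ^ k) * \<phi> k j * bs ! j)"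
      by (subst \<phi>(2)) (simp add: sum_distrib_left mult.assoc)
    also have "\<dots> = (\<Sum>j<?d. (\<Sum>k<n. Tr (x * bs ! i / \<zeta> ^ k) * \<phi> k j) * bs ! j)"
      by (subst sum.swap) (simp add: sum_distrib_right)
    finally show "(\<Sum>j<?d. of_nat n * M i j * bs ! j) = (\<Sum>j<?d. (\<Sum>k<n. Tr (x * bs ! i / \<zeta> ^ k) * \<phi> k j) * bs ! j)" .
  qed
  have "of_nat n * (\<Sum>i<?d. M i i) = (\<Sum>i<?d. \<Sum>k<n. Tr (x * bs ! i / \<zeta> ^ k) * \<phi> k i)"
    unfolding sum_distrib_left by (rule sum.cong[OF refl]) (use eq in simp)
  also have "\<dots> = (\<Sum>k<n. \<Sum>i<?d. \<phi> k i * Tr (x * bs ! i / \<zeta> ^ k))"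
    by (subst sum.swap) (simp add: mult.commute)
  also have "\<dots> = (\<Sum>k<n. Tr x)"
  proof (rule sum.cong[OF refl])
    fix k
    have "(\<Sum>i<?d. \<phi> k i * Tr (x * bs ! i / \<zeta> ^ k)) = (\<Sum>i<?d. Tr (\<phi> k i * (x * bs ! i / \<zeta> ^ k)))"
      by (rule sum.cong[OF refl], rule Tr_mult[symmetric]) (use \<phi>(1) xb in auto)
    also have "\<dots> = Tr (\<Sum>i<?d. \<phi> k i * (x * bs ! i / \<zeta> ^ k))"
      using \<phi>(1) xb F_in_L by (intro Tr_sum[symmetric] L.mult) auto
    also have "(\<Sum>i<?d. \<phi> k i * (x * bs ! i / \<zeta> ^ k)) = x / \<zeta> ^ k * (\<Sum>i<?d. \<phi> k i * bs ! i)"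
      by (simp add: sum_distrib_left mult_ac)
    also have "\<dots> = x" unfolding \<phi>(2)[symmetric] by simp
    finally show "(\<Sum>i<?d. \<phi> k i * Tr (x * bs ! i / \<zeta> ^ k)) = Tr x" .
  qed
  finally have "of_nat n * (\<Sum>i<?d. M i i) = of_nat n * Tr x" by simp
  thus ?thesis using n_pos by simp
qed

text \<open>\<open>THE\<close> asks for one basis and for agreement of all: a basis is filtered out
  of the powers of \<open>\<zeta>\<close>, which span by Fourier inversion, and
  \<open>matrix_trace_eq\<close> gives the same value for every basis.\<close>

lemma field_trace_eq:
  assumes x: "x \<in> L"
  shows "field_trace L F x = Tr x"
  unfolding field_trace_def
proof (rule the_equality)
  interpret C: field \<CC> by (rule field_complex)
  define us where "us = map (\<lambda>k. \<zeta> ^ k) [0..<n]"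
  have "C.Span F us = L"
  proof (intro equalityI subsetI)
    fix y assume "y \<in> C.Span F us"
    then obtain c where "\<forall>i<length us. c i \<in> F" "y = (\<Sum>i<length us. c i * us ! i)" unfolding Span_iff by blast
    thus "y \<in> L" by (auto simp: us_def F_in_L intro!: L.sum L.mult)
  next
    fix y assume y: "y \<in> L"
    have "y = (\<Sum>k<n. Tr (y / \<zeta> ^ k) / of_nat n * \<zeta> ^ k)"
    proof -
      have "y = (of_nat n * y) / of_nat n" using n_pos by simp
      also have "\<dots> = (\<Sum>k<n. Tr (y / \<zeta> ^ k) / of_nat n * \<zeta> ^ k)"
        unfolding fourier_inversion[OF y] by (simp add: sum_divide_distrib)
      finally show ?thesis .
    qed
    moreover have "Tr (y / \<zeta> ^ k) / of_nat n \<in> F" for k using y by (intro divide Tr_in_F L.divide) auto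
    ultimately show "y \<in> C.Span F us"
      unfolding Span_iff by (intro exI[of _ "\<lambda>k. Tr (y / \<zeta> ^ k) / of_nat n"]) (auto simp: us_def)
  qed
  then obtain bs where bs: "C.independent F bs" "C.Span F bs = L"
    using C.filter_base[OF subfield, of us] by (metis complex_field_simps(1) subset_UNIV)
  have "\<exists>c. (\<forall>j<length bs. c j \<in> F) \<and> x * bs ! i = (\<Sum>j<length bs. c j * bs ! j)" if "i < length bs" for i
  proof -
    have "bs ! i \<in> C.Span F bs" using C.Span_base_incl[OF subfield, of bs] that by auto
    hence "x * bs ! i \<in> C.Span F bs" using x bs(2) by auto
    thus ?thesis unfolding Span_iff .
  qed
  then obtain M where M: "\<And>i. i < length bs \<Longrightarrow> (\<forall>j<length bs. M i j \<in> F) \<and> x * bs ! i = (\<Sum>j<length bs. M i j * bs ! j)"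
    by metis
  hence "Tr x = (\<Sum>i<length bs. M i i)" using matrix_trace_eq[OF bs x, of M] by metis
  thus "\<exists>bs M. C.independent F bs \<and> C.Span F bs = L \<and> (\<forall>i<length bs. \<forall>j<length bs. M i j \<in> F) \<and>
      (\<forall>i<length bs. x * bs ! i = (\<Sum>j<length bs. M i j * bs ! j)) \<and> Tr x = (\<Sum>i<length bs. M i i)"
    using bs M by blast
next
  fix t assume "\<exists>bs M. ring.independent \<CC> F bs \<and> ring.Span \<CC> F bs = L \<and> (\<forall>i<length bs. \<forall>j<length bs. M i j \<in> F) \<and>
      (\<forall>i<length bs. x * bs ! i = (\<Sum>j<length bs. M i j * bs ! j)) \<and> t = (\<Sum>i<length bs. M i i)"
  thus "t = Tr x" using matrix_trace_eq[OF _ _ x] by blast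
qed

end


section \<open>The adjusted trace\<close>

context cyclotomic
begin

lemma common_denominator:
  assumes "x \<in> L" obtains k where "k > 0" "of_nat k * x \<in> int_adjoin \<zeta>"
proof -
  obtain p where p: "p \<in> polys_over \<rat>" "x = poly p \<zeta>" using assms by (rule in_LE)
  have "\<exists>k>0. of_nat k * poly p \<zeta> \<in> int_adjoin \<zeta>"
    using p(1)
  proof (induction p)
    case (pCons c p)
    hence "c \<in> \<rat>" "p \<in> polys_over \<rat>" by simp_all
    then obtain k where k: "k > 0" "of_nat k * poly p \<zeta> \<in> int_adjoin \<zeta>" using pCons.IH by blast
    obtain a d where ad: "d > 0" "c = of_int a / of_int d" using \<open>c \<in> \<rat>\<close> by (auto elim!: Rats_cases')
    have "of_nat (k * nat d) * poly (pCons c p) \<zeta> =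
        of_nat k * of_int a + of_nat (nat d) * (\<zeta> * (of_nat k * poly p \<zeta>))"
      using ad by (simp add: field_simps)
    also have "\<dots> \<in> int_adjoin \<zeta>" using k(2) by auto
    finally show ?case using k(1) ad(1) by (intro exI[of _ "k * nat d"]) simp
  qed (auto intro: exI[of _ 1])
  thus thesis using that p(2) by blast
qed

text \<open>The roots of the minimal polynomial of \<open>\<zeta>\<close> are powers of
  \<open>\<zeta>\<close> with exponent prime to \<open>n\<close>, so its degree is at most
  \<open>totient n\<close>.\<close>

lemma rational_coordinates:
  assumes "x \<in> L" obtains c :: "nat \<Rightarrow> rat" where "x = (\<Sum>j<totient n. of_rat (c j) * \<zeta> ^ j)"
proof -
  have *: "poly (monom 1 n - 1) \<zeta> = 0" by (simp add: poly_monom)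
  obtain f where f: "f \<in> polys_over \<rat>" "lead_coeff f = 1" "poly f \<zeta> = 0"
    and dvd: "\<And>p. p \<in> polys_over \<rat> \<Longrightarrow> poly p \<zeta> = 0 \<Longrightarrow> f dvd p"
    by (rule minimal_polynomial[OF polys_over_unity[OF complex_subfield_axioms] unity_poly_nonzero[OF n_pos] *]) (rule that)
  have f0: "f \<noteq> 0" using f(2) by auto
  note roots = cyclotomic_poly_roots[OF n_pos dvd[OF polys_over_unity[OF complex_subfield_axioms] *] f0]
  have "{z. poly f z = 0} \<subseteq> (\<lambda>b. \<zeta> ^ b) ` totatives n"
  proof
    fix z assume "z \<in> {z. poly f z = 0}"
    hence z: "poly f z = 0" by simp
    obtain \<sigma> where \<sigma>: "\<sigma> \<in> auts L \<rat>" "\<sigma> \<zeta> = z"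
      by (rule aut_of_root[of z]) (use dvd z in \<open>fastforce elim!: dvdE\<close>)
    obtain b where b: "coprime b n" "\<sigma> \<zeta> = \<zeta> ^ b" by (rule aut_zeta[OF \<sigma>(1)])
    \<comment> \<open>Totatives are taken between 1 and \<open>n\<close>; residue 0 occurs only for
      \<open>n = 1\<close> and is represented by \<open>n\<close>.\<close>
    define b' where "b' = (if b mod n = 0 then n else b mod n)"
    have cong: "[b = b'] (mod n)" by (simp add: b'_def cong_def)
    have "b' \<in> totatives n"
      using n_positive cong_imp_coprime[OF cong b(1)] mod_less_divisor[OF n_positive, of b]
      by (auto simp: totatives_def b'_def)
    moreover have "\<zeta> ^ b = \<zeta> ^ b'" using cong zeta_power_eq_iff[OF n_pos] by blast
    hence "z = \<zeta> ^ b'" using \<sigma>(2) b(2) by simp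
    ultimately show "z \<in> (\<lambda>b. \<zeta> ^ b) ` totatives n" by blast
  qed
  hence "card {z. poly f z = 0} \<le> card ((\<lambda>b. \<zeta> ^ b) ` totatives n)" by (rule card_mono[rotated]) simp
  also have "\<dots> \<le> totient n" unfolding totient_def by (rule card_image_le) simp
  finally have deg: "degree f \<le> totient n" using roots(1) by simp
  have deg0: "degree f \<noteq> 0"
  proof
    assume "degree f = 0"
    then obtain c where "f = [:c:]" by (rule degree_eq_zeroE)
    thus False using f(2,3) by simp
  qed
  obtain p where p: "p \<in> polys_over \<rat>" "x = poly p \<zeta>" "p = 0 \<or> degree p < degree f"
    by (rule adjoin_reduce[OF f(1) f0 f(3) assms[unfolded L_eq]])
  have "\<exists>r. coeff p i = of_rat r" for i using p(1) by (auto simp: polys_over_def Rats_def image_iff)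
  then obtain c :: "nat \<Rightarrow> rat" where c: "\<And>i. coeff p i = of_rat (c i)" by metis
  have "x = (\<Sum>i\<le>degree p. coeff p i * \<zeta> ^ i)" by (simp add: p(2) poly_altdef)
  also have "\<dots> = (\<Sum>i<totient n. coeff p i * \<zeta> ^ i)"
    by (rule sum.mono_neutral_left) (use p(3) deg deg0 in \<open>auto simp: coeff_eq_0\<close>)
  finally show thesis using that c by simp
qed

end

context wild
begin

lemma wild_parameters: "e = multiplicity 2 n" "m = n div 2 ^ e"
proof -
  show "e = multiplicity 2 n"
    by (rule multiplicity_eqI[symmetric]) (use p_m in \<open>simp_all add: n_eq mult.commute[of 2]\<close>)
  show "m = n div 2 ^ e" by (simp add: n_eq)
qed

lemma xi_rational_coordinates:
  assumes "x \<in> L"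
  obtains c :: "nat \<Rightarrow> nat \<Rightarrow> rat" where "x = (\<Sum>i<2 ^ (e - 1). \<Sum>j<totient m. of_rat (c i j) * (\<xi> ^ i * zeta m ^ j))"
proof -
  obtain k where k: "k > 0" "of_nat k * x \<in> int_adjoin \<zeta>" by (rule common_denominator[OF assms])
  obtain a where a: "\<And>i. a i \<in> int_adjoin (zeta m)" "of_nat k * x = (\<Sum>i<q. a i * \<xi> ^ i)"
    using xi_expansion[of "of_nat k * x"] k(2) integers_L by blast
  have "\<exists>c :: nat \<Rightarrow> rat. a i = (\<Sum>j<totient m. of_rat (c j) * zeta m ^ j)" for i
    using M.rational_coordinates[OF int_adjoin_M[OF a(1)]] by metis
  then obtain c :: "nat \<Rightarrow> nat \<Rightarrow> rat" where c: "\<And>i. a i = (\<Sum>j<totient m. of_rat (c i j) * zeta m ^ j)" by metis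
  have "x = (of_nat k * x) / of_nat k" using k(1) by simp
  also have "\<dots> = (\<Sum>i<q. \<Sum>j<totient m. of_rat (c i j / of_nat k) * (\<xi> ^ i * zeta m ^ j))"
    unfolding a(2) c by (simp add: sum_divide_distrib sum_distrib_right sum_distrib_left of_rat_divide mult_ac)
  finally show thesis using that[of "\<lambda>i j. c i j / of_nat k"] by (simp add: q_eq)
qed

text \<open>The value is the same for all coordinates that \<open>SOME\<close> may pick: the
  unhalved terms add up to \<open>K.Tr x\<close>, and the correction is half of
  \<open>K.Tr (E x)\<close>, because \<open>E\<close> extracts the part with
  \<open>i = 0\<close>.\<close>

lemma adjusted_trace_wild:
  assumes x: "x \<in> L"
  shows "adjusted_trace n K x = adjusted_Tr x"
proof -
  define b where "b = (\<lambda>i j. \<xi> ^ i * zeta m ^ j)"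
  define c where "c = (SOME c :: nat \<Rightarrow> nat \<Rightarrow> rat. x = (\<Sum>i<2 ^ (e - 1). \<Sum>j<totient m. of_rat (c i j) * b i j))"
  have "\<exists>c :: nat \<Rightarrow> nat \<Rightarrow> rat. x = (\<Sum>i<2 ^ (e - 1). \<Sum>j<totient m. of_rat (c i j) * b i j)"
    using xi_rational_coordinates[OF x] unfolding b_def by metis
  hence "x = (\<Sum>i<2 ^ (e - 1). \<Sum>j<totient m. of_rat (c i j) * b i j)" unfolding c_def by (rule someI_ex)
  hence xc: "x = (\<Sum>i<q. \<Sum>j<totient m. of_rat (c i j) * b i j)" by (simp add: q_eq)
  have zmL: "zeta m ^ j \<in> L" for j by (simp add: zeta_m_eq power_mult[symmetric])
  have bL: "b i j \<in> L" for i j unfolding b_def using xi_in_L zmL by (intro L.mult)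
  have ft: "field_trace L K y = K.Tr y" if "y \<in> L" for y by (rule K.field_trace_eq[OF that])
  have Tr_rat: "K.Tr (of_rat r * y) = of_rat r * K.Tr y" if "y \<in> L" for r y
    using that by (rule K.Tr_mult[OF K.of_rat])
  define a where "a i = (\<Sum>j<totient m. of_rat (c i j) * zeta m ^ j)" for i
  have aM: "a i \<in> M.L" for i unfolding a_def by (auto intro!: M.L.sum M.L.mult M.L.power)
  have "x = (\<Sum>i<q. a i * \<xi> ^ i)" unfolding xc a_def b_def by (simp add: sum_distrib_right sum_distrib_left mult_ac)
  hence Ex: "E x = a 0" using E_expansion[OF aM] by simp
  have TrE: "K.Tr (E x) = (\<Sum>j<totient m. of_rat (c 0 j) * K.Tr (b 0 j))"
    unfolding Ex a_def b_def using zmL by (subst K.Tr_sum) (auto simp: Tr_rat intro!: L.mult)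
  have Trx: "K.Tr x = (\<Sum>i<q. \<Sum>j<totient m. of_rat (c i j) * K.Tr (b i j))"
    unfolding xc using bL by (subst K.Tr_sum, force intro!: L.sum L.mult, subst K.Tr_sum) (auto simp: Tr_rat intro!: L.mult)
  have "adjusted_trace n K x = (\<Sum>i<q. \<Sum>j<totient m.
      of_rat (c i j) * (if i = 0 then K.Tr (zeta m ^ j) / 2 else K.Tr (b i j)))"
    unfolding adjusted_trace_def Let_def if_not_P[OF not_tamely_ramified] wild_parameters(1)[symmetric]
      wild_parameters(2)[symmetric] \<xi>_def[symmetric] b_def[symmetric] c_def[symmetric] q_eq
    using ft[OF zmL] ft[OF bL] by (simp add: c_def b_def cong: if_cong)
  also have "\<dots> = (\<Sum>i<q. (\<Sum>j<totient m. of_rat (c i j) * K.Tr (b i j)) - (if i = 0 then K.Tr (E x) / 2 else 0))"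
  proof (rule sum.cong[OF refl])
    fix i
    show "(\<Sum>j<totient m. of_rat (c i j) * (if i = 0 then K.Tr (zeta m ^ j) / 2 else K.Tr (b i j))) =
        (\<Sum>j<totient m. of_rat (c i j) * K.Tr (b i j)) - (if i = 0 then K.Tr (E x) / 2 else 0)"
      by (simp add: TrE b_def sum_divide_distrib[symmetric])
  qed
  also have "\<dots> = adjusted_Tr x" using q_pos by (simp add: sum_subtractf adjusted_Tr_def Trx)
  finally show ?thesis .
qed

end

section \<open>Independence of automorphisms and restriction to a subfield\<close>

text \<open>Dedekind's elimination: at a point \<open>z\<close> where \<open>\<tau>0\<close> and
  \<open>\<tau>1\<close> differ, the relation at \<open>z * x\<close> minus \<open>\<tau>0 z\<close>
  times the relation at \<open>x\<close> has no term at \<open>\<tau>0\<close>.\<close>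

lemma (in complex_subfield) auts_independent:
  assumes "finite S" "S \<subseteq> auts F \<rat>" "\<And>x. x \<in> F \<Longrightarrow> (\<Sum>\<tau>\<in>S. c \<tau> * \<tau> x) = 0" "\<tau> \<in> S"
  shows "c \<tau> = 0"
  using assms
proof (induction S arbitrary: c \<tau> rule: finite_induct)
  case (insert \<tau>0 S)
  have 0: "\<tau>0 \<in> auts F \<rat>" using insert.prems(1) by blast
  have zero: "c \<tau>1 = 0" if \<tau>1: "\<tau>1 \<in> S" for \<tau>1
  proof -
    have 1: "\<tau>1 \<in> auts F \<rat>" using insert.prems(1) \<tau>1 by blast
    have "\<tau>1 \<noteq> \<tau>0" using \<tau>1 insert.hyps by blast
    then obtain z where z: "z \<in> F" "\<tau>1 z \<noteq> \<tau>0 z"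
      using aut_ext[OF 0] aut_ext[OF 1] extensionalityI by blast
    have "c \<tau>1 * (\<tau>1 z - \<tau>0 z) = 0"
    proof (rule insert.IH[of "\<lambda>\<tau>. c \<tau> * (\<tau> z - \<tau>0 z)"])
      fix x assume x: "x \<in> F"
      have "(\<Sum>\<tau>\<in>insert \<tau>0 S. c \<tau> * \<tau> (z * x)) - \<tau>0 z * (\<Sum>\<tau>\<in>insert \<tau>0 S. c \<tau> * \<tau> x) = 0"
        using insert.prems(2)[of x] insert.prems(2)[of "z * x"] x z(1) by (simp add: mult)
      also have "(\<Sum>\<tau>\<in>insert \<tau>0 S. c \<tau> * \<tau> (z * x)) - \<tau>0 z * (\<Sum>\<tau>\<in>insert \<tau>0 S. c \<tau> * \<tau> x) =
          (\<Sum>\<tau>\<in>insert \<tau>0 S. c \<tau> * (\<tau> z - \<tau>0 z) * \<tau> x)"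
        unfolding sum_distrib_left sum_subtractf[symmetric]
      proof (rule sum.cong[OF refl])
        fix \<tau> assume "\<tau> \<in> insert \<tau>0 S"
        hence "\<tau> \<in> auts F \<rat>" using insert.prems(1) by blast
        hence "\<tau> (z * x) = \<tau> z * \<tau> x" using aut_mult x z(1) by blast
        thus "c \<tau> * \<tau> (z * x) - \<tau>0 z * (c \<tau> * \<tau> x) = c \<tau> * (\<tau> z - \<tau>0 z) * \<tau> x" by (simp add: algebra_simps)
      qed
      also have "\<dots> = (\<Sum>\<tau>\<in>S. c \<tau> * (\<tau> z - \<tau>0 z) * \<tau> x)" using insert.hyps by simp
      finally show "(\<Sum>\<tau>\<in>S. c \<tau> * (\<tau> z - \<tau>0 z) * \<tau> x) = 0" .
    qed (use insert.prems(1) \<tau>1 in auto)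
    thus ?thesis using z(2) by simp
  qed
  have "(\<Sum>\<tau>\<in>insert \<tau>0 S. c \<tau> * \<tau> 1) = 0" by (rule insert.prems(2)) simp
  hence "c \<tau>0 = 0" using insert.hyps zero aut_one[OF 0] by simp
  thus ?case using zero insert.prems(3) by blast
qed simp

context conductor
begin

text \<open>\<open>K\<close> is stable because the Galois group of \<open>L\<close> is
  commutative.\<close>

lemma aut_in_K:
  assumes "\<sigma> \<in> auts L \<rat>" "x \<in> K" shows "\<sigma> x \<in> K"
proof (rule K.fixed_in_base)
  have xL: "x \<in> L" using assms(2) by (rule K.F_in_L)
  show "\<sigma> x \<in> L" by (rule L.aut_closed[OF assms(1) xL])
  fix \<rho> assume \<rho>: "\<rho> \<in> auts L K"
  hence "\<rho> (\<sigma> x) = \<sigma> (\<rho> x)" using auts_commute assms(1) xL H_subset unfolding H_def by blast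
  thus "\<rho> (\<sigma> x) = \<sigma> x" using L.aut_fix[OF \<rho> assms(2)] by simp
qed

lemma restrict_aut:
  assumes "\<sigma> \<in> auts L \<rat>" shows "restrict \<sigma> K \<in> auts K \<rat>"
proof -
  obtain \<rho> where \<rho>: "\<rho> \<in> auts L \<rat>" "\<And>x. x \<in> L \<Longrightarrow> \<rho> (\<sigma> x) = x" "\<And>x. x \<in> L \<Longrightarrow> \<sigma> (\<rho> x) = x"
    by (rule L.auts_inverse[OF assms F_subset]) (rule that)
  have "bij_betw \<sigma> K K"
    by (rule bij_betw_byWitness[where f' = \<rho>]) (use \<rho> K.F_in_L aut_in_K assms in auto)
  hence "bij_betw (restrict \<sigma> K) K K" by (simp add: bij_betw_restrict_eq)
  thus ?thesis unfolding auts_iff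
    using K.F_in_L K.Rats_subset by (auto simp: L.aut_add[OF assms] L.aut_mult[OF assms] L.aut_one[OF assms]
        L.aut_fix[OF assms] K.add K.mult)
qed

text \<open>Fourier inversion writes a nonzero multiple of an automorphism \<open>\<tau>\<close> of
  \<open>K\<close> as a combination of restrictions from \<open>L\<close>; independence forces
  \<open>\<tau>\<close> to be one of them.\<close>

lemma auts_K_eq: "auts K \<rat> = (\<lambda>\<sigma>. restrict \<sigma> K) ` auts L \<rat>"
proof
  define R where "R = (\<lambda>\<sigma>. restrict \<sigma> K) ` auts L \<rat>"
  show "auts K \<rat> \<subseteq> (\<lambda>\<sigma>. restrict \<sigma> K) ` auts L \<rat>"
  proof (rule subsetI, rule ccontr)
    fix \<tau> assume \<tau>: "\<tau> \<in> auts K \<rat>" and "\<tau> \<notin> (\<lambda>\<sigma>. restrict \<sigma> K) ` auts L \<rat>"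
    hence notin: "\<tau> \<notin> R" by (simp add: R_def)
    define t where "t k = K.Tr (\<zeta> ^ k)" for k
    \<comment> \<open>The factor \<open>n\<close> stems from Fourier inversion over the rationals,
      \<open>card H\<close> from applying the trace over \<open>K\<close> to an element of
      \<open>K\<close>.\<close>
    define N' where "N' = n * card H"
    define d where "d \<sigma> = (\<Sum>k<n. \<tau> (t k) / \<sigma> (\<zeta> ^ k))" for \<sigma>
    define c where "c \<rho> = (if \<rho> = \<tau> then - of_nat N' else \<Sum>\<sigma> | \<sigma> \<in> auts L \<rat> \<and> restrict \<sigma> K = \<rho>. d \<sigma>)" for \<rho>
    have tK: "t k \<in> K" for k unfolding t_def by (rule K.Tr_in_F) simp
    have rel: "of_nat N' * \<tau> x = (\<Sum>\<sigma>\<in>auts L \<rat>. d \<sigma> * \<sigma> x)" if x: "x \<in> K" for x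
    proof -
      have xL: "x \<in> L" using x by (rule K.F_in_L)
      have TrQ: "Tr (x / \<zeta> ^ k) \<in> \<rat>" for k using xL by (intro Tr_in_F L.divide) auto
      hence TrK: "Tr (x / \<zeta> ^ k) \<in> K" for k using K.Rats_subset by blast
      have "K.Tr x = (\<Sum>\<sigma>\<in>auts L K. x)"
        unfolding aut_trace_def by (rule sum.cong[OF refl]) (use x L.aut_fix in blast)
      hence "K.Tr (of_nat n * x) = of_nat n * (x * of_nat (card H))"
        using K.Tr_mult[OF K.of_nat xL, of n] by (simp add: H_def)
      moreover have "K.Tr (of_nat n * x) = (\<Sum>k<n. Tr (x / \<zeta> ^ k) * t k)"
        unfolding fourier_inversion[OF xL] t_def using xL TrK K.F_in_L
        by (subst K.Tr_sum) (auto simp: K.Tr_mult intro!: L.mult)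
      ultimately have eq: "of_nat N' * x = (\<Sum>k<n. Tr (x / \<zeta> ^ k) * t k)" by (simp add: N'_def mult_ac)
      have "of_nat N' * \<tau> x = \<tau> (of_nat N' * x)"
        using x by (simp add: K.aut_mult[OF \<tau>] K.aut_of_nat[OF \<tau>])
      also have "\<dots> = (\<Sum>k<n. Tr (x / \<zeta> ^ k) * \<tau> (t k))"
        unfolding eq using TrK tK
        by (subst K.aut_sum[OF \<tau>]) (auto simp: K.aut_mult[OF \<tau>] K.aut_fix[OF \<tau> TrQ] K.mult)
      also have "\<dots> = (\<Sum>k<n. \<Sum>\<sigma>\<in>auts L \<rat>. \<sigma> x / \<sigma> (\<zeta> ^ k) * \<tau> (t k))"
        unfolding aut_trace_def using xL by (simp add: sum_distrib_right L.aut_divide cong: sum.cong)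
      also have "\<dots> = (\<Sum>\<sigma>\<in>auts L \<rat>. d \<sigma> * \<sigma> x)"
        by (subst sum.swap) (simp add: d_def sum_distrib_right sum_distrib_left mult_ac)
      finally show ?thesis .
    qed
    have "c \<tau> = 0"
    proof (rule K.auts_independent[of "insert \<tau> R" c])
      show "finite (insert \<tau> R)" by (simp add: R_def)
      show "insert \<tau> R \<subseteq> auts K \<rat>" using \<tau> restrict_aut by (auto simp: R_def)
      show "(\<Sum>\<rho>\<in>insert \<tau> R. c \<rho> * \<rho> x) = 0" if x: "x \<in> K" for x
      proof -
        have "(\<Sum>\<sigma>\<in>auts L \<rat>. d \<sigma> * \<sigma> x) = (\<Sum>\<rho>\<in>R. \<Sum>\<sigma> | \<sigma> \<in> auts L \<rat> \<and> restrict \<sigma> K = \<rho>. d \<sigma> * \<sigma> x)"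
          unfolding R_def by (rule sum.image_gen) simp
        also have "\<dots> = (\<Sum>\<rho>\<in>R. c \<rho> * \<rho> x)"
        proof (rule sum.cong[OF refl])
          fix \<rho> assume \<rho>: "\<rho> \<in> R"
          hence "c \<rho> = (\<Sum>\<sigma> | \<sigma> \<in> auts L \<rat> \<and> restrict \<sigma> K = \<rho>. d \<sigma>)" using notin by (auto simp: c_def)
          thus "(\<Sum>\<sigma> | \<sigma> \<in> auts L \<rat> \<and> restrict \<sigma> K = \<rho>. d \<sigma> * \<sigma> x) = c \<rho> * \<rho> x"
            unfolding sum_distrib_right using x by (auto simp: sum_distrib_right intro!: sum.cong)
        qed
        finally have "(\<Sum>\<rho>\<in>R. c \<rho> * \<rho> x) = of_nat N' * \<tau> x" using rel[OF x] by simp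
        moreover have "(\<Sum>\<rho>\<in>insert \<tau> R. c \<rho> * \<rho> x) = - of_nat N' * \<tau> x + (\<Sum>\<rho>\<in>R. c \<rho> * \<rho> x)"
          using notin by (simp add: R_def c_def)
        ultimately show ?thesis by simp
      qed
    qed simp
    moreover have "N' \<noteq> 0" using H_id n_positive by (auto simp: N'_def card_eq_0_iff)
    ultimately show False by (simp add: c_def)
  qed
  show "(\<lambda>\<sigma>. restrict \<sigma> K) ` auts L \<rat> \<subseteq> auts K \<rat>" using restrict_aut by blast
qed

definition res :: "((complex \<Rightarrow> complex) \<Rightarrow> complex) \<Rightarrow> (complex \<Rightarrow> complex) \<Rightarrow> complex"
  where "res \<gamma> = (\<lambda>\<tau>\<in>auts K \<rat>. \<Sum>\<sigma> | \<sigma> \<in> auts L \<rat> \<and> restrict \<sigma> K = \<tau>. \<gamma> \<sigma>)"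

text \<open>The members of a coset have the same restriction, since \<open>H\<close> fixes
  \<open>K\<close>; so the sums over cosets and over their members merge into one.\<close>

lemma quotient_map_res:
  "quotient_identification L K \<rat> (quotient_map (Gal L \<rat>) (auts L K) \<gamma>) = res \<gamma>"
proof -
  let ?G = "Gal L \<rat>"
  define Q where "Q = carrier (?G Mod H)"
  have coset: "H #>\<^bsub>?G\<^esub> \<sigma> = (\<lambda>\<rho>. compose L \<rho> \<sigma>) ` H" if "\<sigma> \<in> auts L \<rat>" for \<sigma>
  proof -
    have "\<rho> \<otimes>\<^bsub>?G\<^esub> \<sigma> = compose L \<rho> \<sigma>" if "\<rho> \<in> H" for \<rho>
      using Gal_mult[of \<rho> L \<rat> \<sigma>] that \<open>\<sigma> \<in> auts L \<rat>\<close> H_subset by blast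
    thus ?thesis unfolding r_coset_def by auto
  qed
  have Q: "Q = (\<lambda>\<sigma>. H #>\<^bsub>?G\<^esub> \<sigma>) ` auts L \<rat>"
    unfolding Q_def by (auto simp: FactGroup_def RCOSETS_def)
  have cr: "coset_restriction K (H #>\<^bsub>?G\<^esub> \<sigma>) = restrict \<sigma> K" if \<sigma>: "\<sigma> \<in> auts L \<rat>" for \<sigma>
  proof -
    have "restrict (compose L \<rho> \<sigma>) K = restrict \<sigma> K" if "\<rho> \<in> H" for \<rho>
      using that aut_in_K[OF \<sigma>] K.F_in_L L.aut_fix unfolding H_def
      by (intro restrict_ext) (auto simp: compose_eq)
    hence "(\<lambda>\<sigma>. restrict \<sigma> K) ` (H #>\<^bsub>?G\<^esub> \<sigma>) = {restrict \<sigma> K}"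
      unfolding coset[OF \<sigma>] using H_id by (auto simp: image_image)
    thus ?thesis by (simp add: coset_restriction_def)
  qed
  have fin: "finite Q" unfolding Q by simp
  show ?thesis
  proof
    fix \<tau>
    show "quotient_identification L K \<rat> (quotient_map ?G (auts L K) \<gamma>) \<tau> = res \<gamma> \<tau>"
    proof (cases "\<tau> \<in> auts K \<rat>")
      case True
      have "quotient_identification L K \<rat> (quotient_map ?G (auts L K) \<gamma>) \<tau> =
          (\<Sum>C | C \<in> Q \<and> coset_restriction K C = \<tau>. \<Sum>\<sigma> | \<sigma> \<in> auts L \<rat> \<and> H #>\<^bsub>?G\<^esub> \<sigma> = C. \<gamma> \<sigma>)"
        using True unfolding quotient_identification_def quotient_map_def induced_map_def H_def[symmetric] Q_def[symmetric]
        by (auto intro!: sum.cong)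
      also have "\<dots> = (\<Sum>C | C \<in> Q \<and> coset_restriction K C = \<tau>.
          \<Sum>\<sigma> | \<sigma> \<in> {\<sigma> \<in> auts L \<rat>. restrict \<sigma> K = \<tau>} \<and> H #>\<^bsub>?G\<^esub> \<sigma> = C. \<gamma> \<sigma>)"
        using cr by (intro sum.cong refl arg_cong[of _ _ "sum \<gamma>"]) auto
      also have "\<dots> = (\<Sum>\<sigma>\<in>{\<sigma> \<in> auts L \<rat>. restrict \<sigma> K = \<tau>}. \<gamma> \<sigma>)"
        by (rule sum.group) (use fin cr in \<open>auto simp: Q\<close>)
      finally show ?thesis using True by (simp add: res_def)
    qed (simp add: res_def quotient_identification_def induced_map_def)
  qed
qed

lemma act_res:
  assumes x: "x \<in> K"
  shows "act (Gal K \<rat>) (res \<gamma>) x = act (Gal L \<rat>) \<gamma> x"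
proof -
  have "act (Gal L \<rat>) \<gamma> x = (\<Sum>\<tau>\<in>auts K \<rat>. \<Sum>\<sigma> | \<sigma> \<in> auts L \<rat> \<and> restrict \<sigma> K = \<tau>. \<gamma> \<sigma> * \<sigma> x)"
    unfolding act_def auts_K_eq by (rule sum.image_gen) simp
  also have "\<dots> = act (Gal K \<rat>) (res \<gamma>) x"
    unfolding act_def
  proof (rule sum.cong[OF refl])
    fix \<tau> assume "\<tau> \<in> auts K \<rat>"
    hence "res \<gamma> \<tau> = (\<Sum>\<sigma> | \<sigma> \<in> auts L \<rat> \<and> restrict \<sigma> K = \<tau>. \<gamma> \<sigma>)" by (simp add: res_def)
    thus "(\<Sum>\<sigma> | \<sigma> \<in> auts L \<rat> \<and> restrict \<sigma> K = \<tau>. \<gamma> \<sigma> * \<sigma> x) = res \<gamma> \<tau> * \<tau> x"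
      using x by (auto simp: sum_distrib_right intro!: sum.cong)
  qed
  finally show ?thesis ..
qed

lemma res_associated_order:
  assumes "\<gamma> \<in> associated_order L \<rat>"
  shows "res \<gamma> \<in> associated_order K \<rat>"
proof -
  have \<gamma>: "\<gamma> \<in> group_algebra \<rat> (Gal L \<rat>)" "\<And>x. x \<in> \<O> L \<Longrightarrow> act (Gal L \<rat>) \<gamma> x \<in> \<O> L"
    using assms by (auto simp: associated_order_def)
  have \<gamma>Q: "\<gamma> \<sigma> \<in> \<rat>" if "\<sigma> \<in> auts L \<rat>" for \<sigma>
    using \<gamma>(1) that unfolding group_algebra_def by (auto dest: PiE_mem)
  have 1: "res \<gamma> \<in> group_algebra \<rat> (Gal K \<rat>)"
    unfolding group_algebra_def res_def using \<gamma>Q by (auto intro!: complex_subfield.sum[OF complex_subfield_Rats])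
  have "act (Gal K \<rat>) (res \<gamma>) x \<in> \<O> K" if x: "x \<in> \<O> K" for x
  proof -
    have xK: "x \<in> K" using x by (simp add: ring_of_integers_def)
    have "act (Gal L \<rat>) \<gamma> x \<in> K" unfolding act_def
      using \<gamma>Q K.Rats_subset aut_in_K xK by (intro K.sum K.mult) auto
    moreover have "act (Gal L \<rat>) \<gamma> x \<in> \<O> L" using \<gamma>(2) x integers_K_subset by blast
    ultimately show ?thesis unfolding act_res[OF xK] by (simp add: ring_of_integers_def)
  qed
  thus ?thesis using 1 by (auto simp: associated_order_def)
qed

lemma finite_auts_K: "finite (auts K \<rat>)"
  unfolding auts_K_eq by simp

lemma act_diff: "act (Gal K \<rat>) \<gamma> x - act (Gal K \<rat>) \<delta> x = (\<Sum>\<tau>\<in>auts K \<rat>. (\<gamma> \<tau> - \<delta> \<tau>) * \<tau> x)"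
  by (simp add: act_def sum_subtractf left_diff_distrib)

text \<open>The adjusted trace is abstracted to a map \<open>T\<close>, of which linearity over the
  rationals, equivariance and the image of \<open>\<O> L\<close> are required.\<close>

theorem associated_order_descent:
  assumes T_add: "\<And>x y. x \<in> L \<Longrightarrow> y \<in> L \<Longrightarrow> T (x + y) = T x + T y"
    and T_mult: "\<And>r x. r \<in> \<rat> \<Longrightarrow> x \<in> L \<Longrightarrow> T (r * x) = r * T x"
    and T_aut: "\<And>\<sigma> x. \<sigma> \<in> auts L \<rat> \<Longrightarrow> x \<in> L \<Longrightarrow> T (\<sigma> x) = \<sigma> (T x)"
    and T_int: "T ` \<O> L = \<O> K"
    and \<alpha>: "\<alpha> \<in> \<O> L" and orbit: "\<O> L = order_orbit L \<rat> \<alpha>"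
  shows "associated_order K \<rat> = res ` associated_order L \<rat>" "\<O> K = order_orbit K \<rat> (T \<alpha>)"
proof -
  define \<beta> where "\<beta> = T \<alpha>"
  have \<beta>: "\<beta> \<in> \<O> K" unfolding \<beta>_def using T_int \<alpha> by blast
  hence \<beta>K: "\<beta> \<in> K" by (simp add: ring_of_integers_def)
  have \<alpha>L: "\<alpha> \<in> L" using \<alpha> by (simp add: ring_of_integers_def)
  have T_sum: "T (\<Sum>\<sigma>\<in>A. g \<sigma>) = (\<Sum>\<sigma>\<in>A. T (g \<sigma>))" if "finite A" "\<And>\<sigma>. \<sigma> \<in> A \<Longrightarrow> g \<sigma> \<in> L" for A and g :: "(complex \<Rightarrow> complex) \<Rightarrow> complex"
    using that
  proof (induction A rule: finite_induct)
    case empty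
    show ?case using T_mult[of 0 0] by simp
  qed (auto simp: T_add L.sum)
  have T_act: "T (act (Gal L \<rat>) \<gamma> \<alpha>) = act (Gal L \<rat>) \<gamma> \<beta>" if "\<gamma> \<in> associated_order L \<rat>" for \<gamma>
  proof -
    have \<gamma>Q: "\<gamma> \<sigma> \<in> \<rat>" if "\<sigma> \<in> auts L \<rat>" for \<sigma>
      using \<open>\<gamma> \<in> associated_order L \<rat>\<close> that unfolding associated_order_def group_algebra_def by (auto dest: PiE_mem)
    have mem: "\<gamma> \<sigma> * \<sigma> \<alpha> \<in> L" if "\<sigma> \<in> auts L \<rat>" for \<sigma>
      using \<gamma>Q[OF that] L.Rats_subset L.aut_closed[OF that \<alpha>L] by (intro L.mult) auto
    have "T (act (Gal L \<rat>) \<gamma> \<alpha>) = (\<Sum>\<sigma>\<in>auts L \<rat>. T (\<gamma> \<sigma> * \<sigma> \<alpha>))"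
      unfolding act_def using mem by (intro T_sum) auto
    also have "\<dots> = act (Gal L \<rat>) \<gamma> \<beta>" unfolding act_def \<beta>_def
    proof (rule sum.cong[OF refl])
      fix \<sigma> assume \<sigma>: "\<sigma> \<in> auts L \<rat>"
      show "T (\<gamma> \<sigma> * \<sigma> \<alpha>) = \<gamma> \<sigma> * \<sigma> (T \<alpha>)"
        using T_mult[OF \<gamma>Q[OF \<sigma>] L.aut_closed[OF \<sigma> \<alpha>L]] T_aut[OF \<sigma> \<alpha>L] by simp
    qed
    finally show ?thesis .
  qed
  have OK: "\<O> K = (\<lambda>\<gamma>. act (Gal K \<rat>) (res \<gamma>) \<beta>) ` associated_order L \<rat>"
  proof -
    have "\<O> K = T ` (\<lambda>\<gamma>. act (Gal L \<rat>) \<gamma> \<alpha>) ` associated_order L \<rat>"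
      using T_int orbit unfolding order_orbit_def by simp
    also have "\<dots> = (\<lambda>\<gamma>. act (Gal K \<rat>) (res \<gamma>) \<beta>) ` associated_order L \<rat>"
      unfolding image_image by (rule image_cong[OF refl]) (simp add: T_act act_res[OF \<beta>K])
    finally show ?thesis .
  qed
  have act_OK: "act (Gal K \<rat>) \<delta> \<beta> \<in> \<O> K" if "\<delta> \<in> associated_order K \<rat>" for \<delta>
    using that \<beta> by (auto simp: associated_order_def)
  show "\<O> K = order_orbit K \<rat> (T \<alpha>)"
    unfolding \<beta>_def[symmetric] order_orbit_def
  proof (intro equalityI subsetI)
    fix x assume "x \<in> \<O> K"
    then obtain \<gamma> where "\<gamma> \<in> associated_order L \<rat>" "x = act (Gal K \<rat>) (res \<gamma>) \<beta>" using OK by blast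
    thus "x \<in> (\<lambda>\<gamma>. act (Gal K \<rat>) \<gamma> \<beta>) ` associated_order K \<rat>" using res_associated_order by blast
  qed (use act_OK in blast)
  show "associated_order K \<rat> = res ` associated_order L \<rat>"
  proof (intro equalityI subsetI)
    fix \<delta> assume \<delta>: "\<delta> \<in> associated_order K \<rat>"
    then obtain \<gamma> where \<gamma>: "\<gamma> \<in> associated_order L \<rat>" "act (Gal K \<rat>) \<delta> \<beta> = act (Gal K \<rat>) (res \<gamma>) \<beta>"
      using act_OK OK by blast
    \<comment> \<open>\<open>D\<close> is the operator of \<open>\<delta> - res \<gamma>\<close> and
      kills \<open>\<beta>\<close>. As it commutes with the Galois group, it kills the conjugates of
      \<open>\<beta>\<close>, hence \<open>\<O> K\<close> and, after clearing denominators,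
      \<open>K\<close>.\<close>
    define \<epsilon> where "\<epsilon> \<tau> = \<delta> \<tau> - res \<gamma> \<tau>" for \<tau>
    define D where "D x = (\<Sum>\<tau>\<in>auts K \<rat>. \<epsilon> \<tau> * \<tau> x)" for x
    have algK: "\<delta>' \<tau> \<in> \<rat>" if "\<tau> \<in> auts K \<rat>" "\<delta>' \<in> associated_order K \<rat>" for \<tau> \<delta>'
      using that unfolding associated_order_def group_algebra_def by (auto dest: PiE_mem)
    have \<epsilon>Q: "\<epsilon> \<tau> \<in> \<rat>" if "\<tau> \<in> auts K \<rat>" for \<tau>
      unfolding \<epsilon>_def using algK[OF that \<delta>] algK[OF that res_associated_order[OF \<gamma>(1)]] by (rule Rats_diff)
    have D\<beta>: "D \<beta> = 0" using \<gamma>(2) act_diff[of \<delta> \<beta> "res \<gamma>"] by (simp add: D_def \<epsilon>_def)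
    have D_add: "D (x + y) = D x + D y" if "x \<in> K" "y \<in> K" for x y
      using that by (simp add: D_def K.aut_add sum.distrib distrib_left cong: sum.cong)
    have D_rat: "D (r * x) = r * D x" if "r \<in> \<rat>" "x \<in> K" for r x
    proof -
      have "r \<in> K" using that(1) K.Rats_subset by blast
      have "D (r * x) = (\<Sum>\<tau>\<in>auts K \<rat>. r * (\<epsilon> \<tau> * \<tau> x))" unfolding D_def
      proof (rule sum.cong[OF refl])
        fix \<tau> assume \<tau>: "\<tau> \<in> auts K \<rat>"
        show "\<epsilon> \<tau> * \<tau> (r * x) = r * (\<epsilon> \<tau> * \<tau> x)"
          using K.aut_mult[OF \<tau> \<open>r \<in> K\<close> \<open>x \<in> K\<close>] K.aut_fix[OF \<tau> \<open>r \<in> \<rat>\<close>] by simp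
      qed
      thus ?thesis by (simp add: D_def sum_distrib_left)
    qed
    have D_aut: "D (\<sigma> x) = \<sigma> (D x)" if \<sigma>: "\<sigma> \<in> auts L \<rat>" and x: "x \<in> K" for \<sigma> x
    proof -
      have comm: "\<tau> (\<sigma> x) = \<sigma> (\<tau> x)" "\<tau> x \<in> K" if \<tau>: "\<tau> \<in> auts K \<rat>" for \<tau>
      proof -
        obtain \<rho> where \<rho>: "\<rho> \<in> auts L \<rat>" "\<tau> = restrict \<rho> K" using \<tau> unfolding auts_K_eq by blast
        show "\<tau> (\<sigma> x) = \<sigma> (\<tau> x)"
          using auts_commute[OF \<rho>(1) \<sigma> K.F_in_L[OF x]] aut_in_K[OF \<sigma> x] x by (simp add: \<rho>(2))
        show "\<tau> x \<in> K" by (rule K.aut_closed[OF \<tau> x])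
      qed
      have \<epsilon>L: "\<epsilon> \<tau> \<in> L" if "\<tau> \<in> auts K \<rat>" for \<tau> using \<epsilon>Q[OF that] L.Rats_subset by blast
      have "\<sigma> (D x) = (\<Sum>\<tau>\<in>auts K \<rat>. \<sigma> (\<epsilon> \<tau> * \<tau> x))"
        unfolding D_def using \<epsilon>L comm(2) K.F_in_L by (intro L.aut_sum[OF \<sigma>] L.mult) auto
      also have "\<dots> = D (\<sigma> x)" unfolding D_def
        using \<epsilon>L \<epsilon>Q comm K.F_in_L by (intro sum.cong refl) (simp add: L.aut_mult[OF \<sigma>] L.aut_fix[OF \<sigma>])
      finally show ?thesis ..
    qed
    have D_OK: "D x = 0" if "x \<in> \<O> K" for x
    proof -
      obtain \<gamma>' where \<gamma>': "\<gamma>' \<in> associated_order L \<rat>" "x = act (Gal K \<rat>) (res \<gamma>') \<beta>" using \<open>x \<in> \<O> K\<close> OK by blast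
      have \<gamma>Q: "\<gamma>' \<sigma> \<in> \<rat>" if "\<sigma> \<in> auts L \<rat>" for \<sigma>
        using \<gamma>'(1) that unfolding associated_order_def group_algebra_def by (auto dest: PiE_mem)
      have "D (\<Sum>\<sigma>\<in>A. \<gamma>' \<sigma> * \<sigma> \<beta>) = 0" if "finite A" "A \<subseteq> auts L \<rat>" for A
        using that
      proof (induction A rule: finite_induct)
        case empty
        show ?case using D_rat[of 0 0] by simp
      next
        case (insert \<sigma> A)
        have \<sigma>: "\<sigma> \<in> auts L \<rat>" using insert.prems by blast
        have mem: "\<gamma>' \<rho> * \<rho> \<beta> \<in> K" if "\<rho> \<in> auts L \<rat>" for \<rho>
          using \<gamma>Q[OF that] K.Rats_subset aut_in_K[OF that \<beta>K] by (intro K.mult) auto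
        have "D (\<Sum>\<rho>\<in>insert \<sigma> A. \<gamma>' \<rho> * \<rho> \<beta>) = D (\<gamma>' \<sigma> * \<sigma> \<beta>) + D (\<Sum>\<rho>\<in>A. \<gamma>' \<rho> * \<rho> \<beta>)"
          using insert mem by (simp add: D_add K.sum subset_iff)
        also have "D (\<gamma>' \<sigma> * \<sigma> \<beta>) = \<gamma>' \<sigma> * \<sigma> (D \<beta>)"
          using D_rat[OF \<gamma>Q[OF \<sigma>] aut_in_K[OF \<sigma> \<beta>K]] D_aut[OF \<sigma> \<beta>K] by simp
        finally show ?case using insert D\<beta> L.aut_zero[OF \<sigma>] by simp
      qed
      from this[OF finite_auts order_refl] show ?thesis
        unfolding \<gamma>'(2) act_res[OF \<beta>K] by (simp only: act_def)
    qed
    have D0: "D x = 0" if x: "x \<in> K" for x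
    proof -
      obtain k where k: "k > 0" "of_nat k * x \<in> int_adjoin \<zeta>"
        by (rule common_denominator[OF K.F_in_L[OF x]])
      have "of_nat k * x \<in> \<O> K"
        using x k(2) int_adjoin_algebraic_int[OF algebraic_int_zeta] by (auto simp: ring_of_integers_def)
      hence "of_nat k * D x = 0" using D_OK D_rat[of "of_nat k" x] x by simp
      thus ?thesis using k(1) by simp
    qed
    have "\<epsilon> \<tau> = 0" if "\<tau> \<in> auts K \<rat>" for \<tau>
      by (rule K.auts_independent[OF finite_auts_K order_refl _ that]) (use D0 in \<open>simp add: D_def\<close>)
    hence "\<delta> \<tau> = res \<gamma> \<tau>" if "\<tau> \<in> auts K \<rat>" for \<tau> using that by (simp add: \<epsilon>_def)
    moreover have "\<delta> \<in> extensional (auts K \<rat>)" "res \<gamma> \<in> extensional (auts K \<rat>)"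
      using \<delta> by (auto simp: associated_order_def group_algebra_def PiE_def res_def)
    ultimately have "\<delta> = res \<gamma>" by (intro extensionalityI) auto
    thus "\<delta> \<in> res ` associated_order L \<rat>" using \<gamma>(1) by blast
  qed (use res_associated_order in blast)
qed

lemma tame_trace_integers:
  assumes "N = {\<lambda>x\<in>L. x}"
  shows "K.Tr ` \<O> L = \<O> K"
proof
  show "K.Tr ` \<O> L \<subseteq> \<O> K" using K_Tr_integer by blast
  obtain x0 where x0: "x0 \<in> \<O> L" "K.Tr x0 = of_nat (card N)" by (rule minimal_trace)
  show "\<O> K \<subseteq> K.Tr ` \<O> L"
  proof
    fix y assume y: "y \<in> \<O> K"
    have "K.Tr (y * x0) = y" using y x0 assms by (simp add: K.Tr_mult ring_of_integers_def)
    moreover have "y * x0 \<in> \<O> L" using y integers_K_subset x0(1) by auto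
    ultimately show "y \<in> K.Tr ` \<O> L" by (metis image_eqI)
  qed
qed

text \<open>The two cases of the definition are matched with triviality of \<open>N\<close> by
  \<open>tamely_ramified_if_trivial\<close> and \<open>not_tamely_ramified\<close>; in the wild case
  the properties are read off from the closed form \<open>adjusted_Tr\<close>.\<close>

theorem adjusted_trace_properties:
  shows "\<And>x y. x \<in> L \<Longrightarrow> y \<in> L \<Longrightarrow> adjusted_trace n K (x + y) = adjusted_trace n K x + adjusted_trace n K y"
    and "\<And>r x. r \<in> \<rat> \<Longrightarrow> x \<in> L \<Longrightarrow> adjusted_trace n K (r * x) = r * adjusted_trace n K x"
    and "\<And>\<sigma> x. \<sigma> \<in> auts L \<rat> \<Longrightarrow> x \<in> L \<Longrightarrow> adjusted_trace n K (\<sigma> x) = \<sigma> (adjusted_trace n K x)"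
    and "adjusted_trace n K ` \<O> L = \<O> K"
proof -
  have RK: "r \<in> K" if "r \<in> \<rat>" for r using that K.Rats_subset by blast
  let ?T = "adjusted_trace n K"
  have "(\<forall>x\<in>L. \<forall>y\<in>L. ?T (x + y) = ?T x + ?T y) \<and> (\<forall>r\<in>\<rat>. \<forall>x\<in>L. ?T (r * x) = r * ?T x) \<and>
      (\<forall>\<sigma>\<in>auts L \<rat>. \<forall>x\<in>L. ?T (\<sigma> x) = \<sigma> (?T x)) \<and> ?T ` \<O> L = \<O> K"
  proof (cases "N = {\<lambda>x\<in>L. x}")
    case True
    have T: "?T x = K.Tr x" if "x \<in> L" for x
      using tamely_ramified_if_trivial[OF True] K.field_trace_eq[OF that] by (simp add: adjusted_trace_def)
    have "?T ` \<O> L = K.Tr ` \<O> L" by (rule image_cong[OF refl]) (simp add: T ring_of_integers_def)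
    thus ?thesis using tame_trace_integers[OF True]
      by (auto simp: T L.add K.Tr_add K.Tr_mult RK K.F_in_L L.mult K_Tr_aut L.aut_closed)
  next
    case False
    define e where "e = multiplicity 2 n"
    obtain m where m: "prime_split n 2 e m"
      unfolding e_def by (rule prime_split_exists[OF two_is_prime_nat n_positive])
    obtain \<tau> b where w: "\<tau> \<in> H" "\<tau> \<zeta> = \<zeta> ^ b" "\<tau> \<noteq> (\<lambda>x\<in>L. x)" "card N = 2" "e \<ge> 3"
      "[b = 1] (mod n div 2 ^ e)" "[b + 1 = 0] (mod 2 ^ (e - 1))" "[b ^ 2 = 1] (mod n)"
      using wild_structure[OF False] unfolding e_def by blast
    have "n div 2 ^ e = m" using m by (simp add: prime_split_def)
    then interpret W: wild n K e m \<tau> b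
      using m w conductor_axioms by (simp add: wild_def wild_axioms_def)
    have T: "?T x = W.adjusted_Tr x" if "x \<in> L" for x by (rule W.adjusted_trace_wild[OF that])
    have E_rat: "W.E (r * x) = r * W.E x" if "r \<in> \<rat>" "x \<in> L" for r x
      using that W.M.L.Rats_subset by (intro W.E_mult) auto
    have "?T ` \<O> L = W.adjusted_Tr ` \<O> L" by (rule image_cong[OF refl]) (simp add: T ring_of_integers_def)
    moreover have "W.adjusted_Tr (\<sigma> x) = \<sigma> (W.adjusted_Tr x)" if \<sigma>: "\<sigma> \<in> auts L \<rat>" and x: "x \<in> L" for \<sigma> x
    proof -
      have 2: "\<sigma> 2 = 2" using L.aut_of_nat[OF \<sigma>, of 2] by simp
      show ?thesis unfolding W.adjusted_Tr_def
        using x W.E_in_L[OF x] by (simp add: K_Tr_aut \<sigma> W.E_aut L.aut_diff[OF \<sigma>] L.aut_divide[OF \<sigma>] K.Tr_in_L L.divide 2)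
    qed
    ultimately show ?thesis using W.adjusted_Tr_integers
      by (auto simp: T L.add L.mult RK K.F_in_L L.aut_closed W.adjusted_Tr_def W.E_add E_rat W.E_in_L K.Tr_add K.Tr_mult
          algebra_simps add_divide_distrib)
  qed
  thus "\<And>x y. x \<in> L \<Longrightarrow> y \<in> L \<Longrightarrow> ?T (x + y) = ?T x + ?T y" "\<And>r x. r \<in> \<rat> \<Longrightarrow> x \<in> L \<Longrightarrow> ?T (r * x) = r * ?T x"
    "\<And>\<sigma> x. \<sigma> \<in> auts L \<rat> \<Longrightarrow> x \<in> L \<Longrightarrow> ?T (\<sigma> x) = \<sigma> (?T x)" "?T ` \<O> L = \<O> K" by blast+
qed

end

theorem theorem6p6:
  fixes K :: "complex set" and n :: nat and \<alpha> :: complex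
    and L :: "complex set" and G :: "(complex \<Rightarrow> complex) monoid" and H :: "(complex \<Rightarrow> complex) set"
    and \<pi> :: "((complex \<Rightarrow> complex) \<Rightarrow> complex) \<Rightarrow> (complex \<Rightarrow> complex) set \<Rightarrow> complex"
    and \<beta> :: complex
  assumes "abelian_number_field K"
    and "is_conductor K n"
    and "L = cyclotomic_field n"
    and "G = Gal L \<rat>"
    and "H = carrier (Gal L K)"
    and "\<pi> = quotient_map G H"
    and "\<alpha> \<in> \<O> L"
    and "\<O> L = order_orbit L \<rat> \<alpha>"
    and "\<beta> = adjusted_trace n K \<alpha>"
  shows "associated_order K \<rat>
           = quotient_identification L K \<rat> ` \<pi> ` associated_order L \<rat>
       \<and> \<O> K = order_orbit K \<rat> \<beta>"
proof -
  interpret conductor n K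
    using assms(1,2)
    by (simp add: conductor_def conductor_axioms_def cyclotomic_def complex_subfield_def
        abelian_number_field_def number_field_def is_conductor_def)
  note descent = associated_order_descent[OF adjusted_trace_properties
      assms(7)[unfolded assms(3)] assms(8)[unfolded assms(3)]]
  have "quotient_identification L K \<rat> ` \<pi> ` associated_order L \<rat> = res ` associated_order L \<rat>"
    unfolding image_image assms(4-6) assms(3) quotient_map_res ..
  thus ?thesis using descent unfolding assms(3,9) by simp
qed

end
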